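(* Let $\mathcal{G}=(\mathsf V,\mathsf E)$ be a finite, connected, compact metric graph without loops, let $q\in L^\infty(\mathcal G)\cap\bigoplus_{\mathsf e\in\mathsf E}C^\infty(0,\ell_{\mathsf e})$ be real-valued and let $\sigma=(\sigma_{\mathsf v})_{\mathsf v\in\mathsf V}\in\mathbb R^{|\mathsf V|}$. Assume that the Schrödinger operator $H_{\mathcal G}^{q,\sigma}$ is such that the following implication holds: $$\int_{\mathcal G} q\,\mathrm dx+2\sum_{\mathsf v\in\mathsf V}\frac{\sigma_{\mathsf v}}{\deg(\mathsf v)}=0\ \Longrightarrow\ \int_{\mathcal G} q\,\mathrm dx+\sum_{\mathsf v\in\mathsf V}\sigma_{\mathsf v}\le 0.$$ Then, if $\lambda_n^{q,\sigma}=\lambda_n^0$ for all $n\in\mathbb N_0=\{0,1,2,\dots\}$, where $\lambda_n^0$ are the eigenvalues of $H_{\mathcal G}^0$, one has $q=0$ and $\sigma=0$.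
   Context: $\mathcal G=(\mathsf V,\mathsf E)$ is a finite, connected, compact metric graph with vertex set $\mathsf V$ and edge set $\mathsf E$; each edge $\mathsf e\in\mathsf E$ is identified with an interval of length $\ell_{\mathsf e}\in(0,\infty)$. The graph is assumed to have no loops (no edge joining a vertex to itself). $\deg(\mathsf v)$ is the degree of the vertex $\mathsf v$ (the number of edges incident to $\mathsf v$). The Hilbert space is $L^2(\mathcal G)=\bigoplus_{\mathsf e\in\mathsf E}L^2(0,\ell_{\mathsf e})$, and $\int_{\mathcal G}$ denotes the sum of the integrals over all edges. $C(\mathcal G)$ is the space of continuous functions on $\mathcal G$ (in particular continuous across vertices), and $H^1(\mathcal G):=\bigoplus_{\mathsf e\in\mathsf E}H^1(0,\ell_{\mathsf e})\cap C(\mathcal G)$. For real-valued $q=(q_{\mathsf e})_{\mathsf e\in\mathsf E}\in L^\infty(\mathcal G)\cap\bigoplus_{\mathsf e\in\mathsf E}C^\infty(0,\ell_{\mathsf e})$ and $\sigma=(\sigma_{\mathsf v})_{\mathsf v\in\mathsf V}\in\mathbb R^{|\mathsf V|}$, $H_{\mathcal G}^{q,\sigma}=-\frac{\mathrm d^2}{\mathrm dx^2}+q(x)$ is the self-adjoint operator on $L^2(\mathcal G)$ associated with the quadratic form $$h_{\mathcal G}^{q,\sigma}(f)=\int_{\mathcal G}|f'|^2\,\mathrm dx+\int_{\mathcal G}q|f|^2\,\mathrm dx+\sum_{\mathsf v\in\mathsf V}\sigma_{\mathsf v}|f(\mathsf v)|^2$$ with form domain $H^1(\mathcal G)$. It has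 compact resolvent, hence purely discrete spectrum, with eigenvalues (counted with multiplicity) $\lambda_0^{q,\sigma}<\lambda_1^{q,\sigma}\le\lambda_2^{q,\sigma}\le\dots\to+\infty$. $H_{\mathcal G}^0:=H_{\mathcal G}^{q=0,\sigma=0}$ denotes the operator with zero potential and $\sigma=0$, and $(\lambda_n^0)_{n\in\mathbb N_0}$ denotes its eigenvalues, ordered in the same way. *)

theory Defs
  imports
    "HOL-Analysis.Analysis"
    "HOL-Library.Function_Algebras"
    "Graph_Theory.Digraph_Component"
begin

section \<open>Metric graphs\<close>

text \<open>
  The edges of an undirected multigraph are given an arbitrary orientation: the edge \<open>e\<close> is
  identified with the interval from \<open>0\<close> (at \<open>tail G e\<close>) to \<open>len e\<close> (at \<open>head G e\<close>).
  \<^const>\<open>Digraph_Component.connected\<close> refers to the underlying undirected graph.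
  The graph consisting of a single point, for which the \<open>L\<^sup>2\<close>-space is trivial, is excluded.
\<close>

locale metric_graph = fin_digraph G + loopfree_digraph G
  for G :: "('v, 'e) pre_digraph" +
  fixes len :: "'e \<Rightarrow> real"
  assumes connected: "Digraph_Component.connected G"
    and arcs_nonempty: "arcs G \<noteq> {}"
    and length_pos: "e \<in> arcs G \<Longrightarrow> 0 < len e"

definition vertex_degree :: "('v, 'e) pre_digraph \<Rightarrow> 'v \<Rightarrow> nat" where
  "vertex_degree G v = card {e \<in> arcs G. tail G e = v \<or> head G e = v}"

definition graph_integral ::
  "('v, 'e) pre_digraph \<Rightarrow> ('e \<Rightarrow> real) \<Rightarrow>
    ('e \<Rightarrow> real \<Rightarrow> 'a::{banach, second_countable_topology}) \<Rightarrow> 'a" where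
  "graph_integral G len f = (\<Sum>e\<in>arcs G. \<integral>x. f e x \<partial>lebesgue_on {0<..<len e})"


section \<open>Function spaces\<close>

definition smooth_on :: "real set \<Rightarrow> (real \<Rightarrow> real) \<Rightarrow> bool" where
  "smooth_on S f \<longleftrightarrow> (\<forall>n. \<forall>x\<in>S. (deriv ^^ n) f differentiable (at x))"

definition test_functions :: "real \<Rightarrow> (real \<Rightarrow> real) set" where
  "test_functions l = {\<phi>. smooth_on UNIV \<phi> \<and>
     (\<exists>a b. 0 < a \<and> b < l \<and> (\<forall>x. x \<notin> {a..b} \<longrightarrow> \<phi> x = 0))}"

definition L2_interval :: "real \<Rightarrow> (real \<Rightarrow> complex) set" where
  "L2_interval l = {f. f \<in> borel_measurable (lebesgue_on {0<..<l}) \<and>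
     integrable (lebesgue_on {0<..<l}) (\<lambda>x. (cmod (f x))\<^sup>2)}"

definition has_weak_deriv ::
  "real \<Rightarrow> (real \<Rightarrow> complex) \<Rightarrow> (real \<Rightarrow> complex) \<Rightarrow> bool" where
  "has_weak_deriv l f g \<longleftrightarrow> (\<forall>\<phi>\<in>test_functions l.
     (\<integral>x. f x * of_real (deriv \<phi> x) \<partial>lebesgue_on {0<..<l})
       = - (\<integral>x. g x * of_real (\<phi> x) \<partial>lebesgue_on {0<..<l}))"

definition H1_interval :: "real \<Rightarrow> (real \<Rightarrow> complex) set" where
  "H1_interval l = {f \<in> L2_interval l. \<exists>g\<in>L2_interval l. has_weak_deriv l f g}"

text \<open>The weak derivative is determined only almost everywhere; any representative may be chosen.\<close>

definition weak_deriv :: "real \<Rightarrow> (real \<Rightarrow> complex) \<Rightarrow> real \<Rightarrow> complex" where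
  "weak_deriv l f = (SOME g. g \<in> L2_interval l \<and> has_weak_deriv l f g)"

text \<open>
  \<open>L\<^sup>2\<close>-functions on the graph are functions rather than equivalence classes modulo null sets.
\<close>

definition L2_graph ::
  "('v, 'e) pre_digraph \<Rightarrow> ('e \<Rightarrow> real) \<Rightarrow> ('e \<Rightarrow> real \<Rightarrow> complex) set" where
  "L2_graph G len = {f. \<forall>e\<in>arcs G. f e \<in> L2_interval (len e)}"

definition L2_inner ::
  "('v, 'e) pre_digraph \<Rightarrow> ('e \<Rightarrow> real) \<Rightarrow>
    ('e \<Rightarrow> real \<Rightarrow> complex) \<Rightarrow> ('e \<Rightarrow> real \<Rightarrow> complex) \<Rightarrow> complex" where
  "L2_inner G len f g = graph_integral G len (\<lambda>e x. f e x * cnj (g e x))"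

text \<open>
  Continuous functions are continuous on each closed edge, and their end-point values agree at the
  common vertices.  They are normalised to vanish off the closed edges, so that equality of such
  functions on the graph is equality in HOL.
\<close>

definition C_graph ::
  "('v, 'e) pre_digraph \<Rightarrow> ('e \<Rightarrow> real) \<Rightarrow> ('e \<Rightarrow> real \<Rightarrow> complex) set" where
  "C_graph G len = {f.
     (\<forall>e\<in>arcs G. continuous_on {0..len e} (f e)) \<and>
     (\<exists>u. \<forall>e\<in>arcs G. f e 0 = u (tail G e) \<and> f e (len e) = u (head G e)) \<and>
     (\<forall>e x. e \<notin> arcs G \<or> x \<notin> {0..len e} \<longrightarrow> f e x = 0)}"

definition vertex_value ::
  "('v, 'e) pre_digraph \<Rightarrow> ('e \<Rightarrow> real) \<Rightarrow> ('e \<Rightarrow> real \<Rightarrow> complex) \<Rightarrow> 'v \<Rightarrow> complex" where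
  "vertex_value G len f v = (THE z. \<forall>e\<in>arcs G.
     (tail G e = v \<longrightarrow> f e 0 = z) \<and> (head G e = v \<longrightarrow> f e (len e) = z))"

text \<open>Elements of \<open>H\<^sup>1\<close> are represented by their unique continuous representatives.\<close>

definition H1_graph ::
  "('v, 'e) pre_digraph \<Rightarrow> ('e \<Rightarrow> real) \<Rightarrow> ('e \<Rightarrow> real \<Rightarrow> complex) set" where
  "H1_graph G len = {f \<in> C_graph G len. \<forall>e\<in>arcs G. f e \<in> H1_interval (len e)}"

definition admissible_potential ::
  "('v, 'e) pre_digraph \<Rightarrow> ('e \<Rightarrow> real) \<Rightarrow> ('e \<Rightarrow> real \<Rightarrow> real) \<Rightarrow> bool" where
  "admissible_potential G len q \<longleftrightarrow> (\<forall>e\<in>arcs G.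
     smooth_on {0<..<len e} (q e) \<and>
     q e \<in> borel_measurable (lebesgue_on {0<..<len e}) \<and>
     (\<exists>C. AE x in lebesgue_on {0<..<len e}. \<bar>q e x\<bar> \<le> C))"


section \<open>The Schroedinger operator and its eigenvalues\<close>

definition quadratic_form ::
  "('v, 'e) pre_digraph \<Rightarrow> ('e \<Rightarrow> real) \<Rightarrow> ('e \<Rightarrow> real \<Rightarrow> real) \<Rightarrow> ('v \<Rightarrow> real) \<Rightarrow>
    ('e \<Rightarrow> real \<Rightarrow> complex) \<Rightarrow> real" where
  "quadratic_form G len q \<sigma> f =
     graph_integral G len (\<lambda>e x. (cmod (weak_deriv (len e) (f e) x))\<^sup>2)
     + graph_integral G len (\<lambda>e x. q e x * (cmod (f e x))\<^sup>2)
     + (\<Sum>v\<in>verts G. \<sigma> v * (cmod (vertex_value G len f v))\<^sup>2)"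

definition sesquilinear_form ::
  "('v, 'e) pre_digraph \<Rightarrow> ('e \<Rightarrow> real) \<Rightarrow> ('e \<Rightarrow> real \<Rightarrow> real) \<Rightarrow> ('v \<Rightarrow> real) \<Rightarrow>
    ('e \<Rightarrow> real \<Rightarrow> complex) \<Rightarrow> ('e \<Rightarrow> real \<Rightarrow> complex) \<Rightarrow> complex" where
  "sesquilinear_form G len q \<sigma> f g =
     graph_integral G len (\<lambda>e x. weak_deriv (len e) (f e) x * cnj (weak_deriv (len e) (g e) x))
     + graph_integral G len (\<lambda>e x. of_real (q e x) * f e x * cnj (g e x))
     + (\<Sum>v\<in>verts G. of_real (\<sigma> v) * vertex_value G len f v * cnj (vertex_value G len g v))"

lemma sesquilinear_form_diagonal:
  "sesquilinear_form G len q \<sigma> f f = of_real (quadratic_form G len q \<sigma> f)"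
proof -
  have sq: "z * cnj z = of_real ((cmod z)\<^sup>2)" for z
    by (rule complex_norm_square[symmetric])
  have "graph_integral G len (\<lambda>e x. of_real (r e x)) = complex_of_real (graph_integral G len r)" for r
    by (simp add: graph_integral_def)
  then show ?thesis
    unfolding sesquilinear_form_def quadratic_form_def
    by (simp only: sq mult.assoc flip: of_real_mult of_real_sum of_real_add)
qed

text \<open>
  The graph of the operator associated with the form: \<open>f\<close> lies in its domain and is mapped to \<open>g\<close>.
  Here \<open>g\<close> matters only up to null sets.
\<close>

definition schroedinger_operator ::
  "('v, 'e) pre_digraph \<Rightarrow> ('e \<Rightarrow> real) \<Rightarrow> ('e \<Rightarrow> real \<Rightarrow> real) \<Rightarrow> ('v \<Rightarrow> real) \<Rightarrow>
    ('e \<Rightarrow> real \<Rightarrow> complex) \<Rightarrow> ('e \<Rightarrow> real \<Rightarrow> complex) \<Rightarrow> bool" where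
  "schroedinger_operator G len q \<sigma> f g \<longleftrightarrow>
     f \<in> H1_graph G len \<and> g \<in> L2_graph G len \<and>
     (\<forall>h\<in>H1_graph G len. sesquilinear_form G len q \<sigma> f h = L2_inner G len g h)"

definition scale_fun :: "complex \<Rightarrow> ('e \<Rightarrow> real \<Rightarrow> complex) \<Rightarrow> 'e \<Rightarrow> real \<Rightarrow> complex" where
  "scale_fun c f = (\<lambda>e x. c * f e x)"

global_interpretation graph_fun: vector_space scale_fun
  by unfold_locales (auto simp: scale_fun_def fun_eq_iff algebra_simps)

definition eigenspace ::
  "('v, 'e) pre_digraph \<Rightarrow> ('e \<Rightarrow> real) \<Rightarrow> ('e \<Rightarrow> real \<Rightarrow> real) \<Rightarrow> ('v \<Rightarrow> real) \<Rightarrow>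
    real \<Rightarrow> ('e \<Rightarrow> real \<Rightarrow> complex) set" where
  "eigenspace G len q \<sigma> \<mu> = {f. schroedinger_operator G len q \<sigma> f (scale_fun (of_real \<mu>) f)}"

definition is_eigenvalue ::
  "('v, 'e) pre_digraph \<Rightarrow> ('e \<Rightarrow> real) \<Rightarrow> ('e \<Rightarrow> real \<Rightarrow> real) \<Rightarrow> ('v \<Rightarrow> real) \<Rightarrow> real \<Rightarrow> bool" where
  "is_eigenvalue G len q \<sigma> \<mu> \<longleftrightarrow> (\<exists>f\<in>eigenspace G len q \<sigma> \<mu>. f \<noteq> 0)"

text \<open>
  \<open>lam\<close> lists the eigenvalues in nondecreasing order, each one repeated according to its
  multiplicity.  As the dimension of an infinite-dimensional space is \<open>0\<close> by convention, the
  conditions also say that the multiplicities are finite.  There is at most one such sequence.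
\<close>

definition eigenvalue_sequence ::
  "('v, 'e) pre_digraph \<Rightarrow> ('e \<Rightarrow> real) \<Rightarrow> ('e \<Rightarrow> real \<Rightarrow> real) \<Rightarrow> ('v \<Rightarrow> real) \<Rightarrow>
    (nat \<Rightarrow> real) \<Rightarrow> bool" where
  "eigenvalue_sequence G len q \<sigma> lam \<longleftrightarrow>
     mono lam \<and>
     range lam = {\<mu>. is_eigenvalue G len q \<sigma> \<mu>} \<and>
     (\<forall>\<mu>. finite {n. lam n = \<mu>} \<and>
          card {n. lam n = \<mu>} = graph_fun.dim (eigenspace G len q \<sigma> \<mu>))"

lemma mono_determined_by_fibres:
  fixes a b :: "nat \<Rightarrow> real"
  assumes "mono a" "mono b"
    and fin: "\<And>\<mu>. finite {n. a n = \<mu>}" "\<And>\<mu>. finite {n. b n = \<mu>}"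
    and card: "\<And>\<mu>. card {n. a n = \<mu>} = card {n. b n = \<mu>}"
  shows "a = b"
proof
  have step: "\<not> c n < d n"
    if "mono d" "\<And>\<mu>. finite {n. c n = \<mu>}" "\<And>\<mu>. card {n. c n = \<mu>} = card {n. d n = \<mu>}"
      "\<And>i. i < n \<Longrightarrow> c i = d i" for c d :: "nat \<Rightarrow> real" and n
  proof
    assume less: "c n < d n"
    have "i < n" if "d i = c n" for i
      using less that monoD[OF \<open>mono d\<close>, of n i] by (cases "i < n") auto
    then have "{i. d i = c n} \<subset> {i. c i = c n}"
      using less that(4) by auto
    then show False
      using psubset_card_mono[OF that(2)] that(3)[of "c n"] by (metis less_irrefl)
  qed
  show "a n = b n" for n
  proof (induction n rule: less_induct)
    case (less n)
    have "\<not> a n < b n"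
      by (rule step) (use assms less in auto)
    moreover have "\<not> b n < a n"
      by (rule step) (use assms less in auto)
    ultimately show ?case by simp
  qed
qed

lemma eigenvalue_sequence_unique:
  assumes "eigenvalue_sequence G len q \<sigma> a" "eigenvalue_sequence G len q \<sigma> b"
  shows "a = b"
  using assms by (intro mono_determined_by_fibres) (auto simp: eigenvalue_sequence_def)

end

theory Submission
  imports Defs "HOL-Complex_Analysis.Great_Picard"
begin

text \<open>
  Let \<open>f\<^sub>n\<close> be orthonormal eigenfunctions of an operator \<open>H\<close> of this kind, and write
  \<open>v\<^sub>n = \<integral> p \<bar>f\<^sub>n\<bar>\<^sup>2 + \<Sum>\<^sub>v \<tau>\<^sub>v \<bar>f\<^sub>n(v)\<bar>\<^sup>2\<close> for a perturbation \<open>(p, \<tau>)\<close>.  If \<open>H\<close> and its perturbation are isospectral,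
  then Ky Fan's variational principle says that all partial sums of \<open>v\<^sub>n\<close> are nonnegative, hence by
  Abel summation so are those of \<open>v\<^sub>n / (\<lambda>\<^sub>n + k\<^sup>2)\<close>, that is, \<open>\<integral> p g\<^sub>k + \<Sum>\<^sub>v \<tau>\<^sub>v g\<^sub>k(v) \<ge> 0\<close> where
  \<open>g\<^sub>k(x) = \<Sum>\<^sub>n \<bar>f\<^sub>n(x)\<bar>\<^sup>2 / (\<lambda>\<^sub>n + k\<^sup>2)\<close> is the diagonal of the resolvent kernel.  Now \<open>g\<^sub>k(x)\<close> is the squared
  norm of the evaluation at \<open>x\<close> with respect to the form \<open>h + k\<^sup>2\<close>, so hyperbolic test functions yield
  \<open>k g\<^sub>k(x) \<longlonglongrightarrow> 1/2\<close> inside the edges and \<open>k g\<^sub>k(v) \<longlonglongrightarrow> 1/deg v\<close> at the vertices.  Hence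
  \<open>\<integral> p + 2 \<Sum>\<^sub>v \<tau>\<^sub>v / deg v \<ge> 0\<close>.  Perturbing the free operator by \<open>(q, \<sigma>)\<close>, and the operator with potential
  by \<open>(-q, -\<sigma>)\<close>, gives \<open>\<integral> q + 2 \<Sum>\<^sub>v \<sigma>\<^sub>v / deg v = 0\<close>.  By assumption the form is then nonpositive at the
  constant function 1; as it is nonnegative everywhere, 1 lies in its kernel, which forces
  \<open>q = 0\<close> and \<open>\<sigma> = 0\<close>.
\<close>

section \<open>Hermitian forms with compact embedding\<close>

text \<open>Ky Fan applies because the first N eigenfunctions of one operator are orthonormal trial
  vectors for the other: the trace of the other form on them is the sum of their eigenvalues plus
  the sum of their \<open>v n\<close>, and isospectrality cancels the eigenvalues. A single
  \<open>v n\<close> has no sign, so only averages with weights decreasing in n are available.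
  Resolvent weights suit two purposes. They are summable in one dimension, and the resulting
  diagonal is a dual norm: every lower estimate of the energy bounds it from above, every single
  trial function bounds it from below. Hence no Green function or heat kernel is constructed, and a
  merely bounded potential enters only through factors 1 plus or minus \<open>\<epsilon> k\<close>
  with \<open>\<epsilon> k\<close> tending to 0. The upper estimate rests on Bessel's inequality;
  the lower one needs the eigenfunctions to exhaust the form domain. The pointwise limit holds
  inside the edges only, so passing to the integral requires a bound on \<open>k\<close> times the
  diagonal that is uniform up to the vertices. An interior point behaves like a vertex of degree 2,
  which explains the factor 2 in front of the vertex sum.\<close>

locale hermitian_form = vector_space scale
  for scale :: "complex \<Rightarrow> 'a::ab_group_add \<Rightarrow> 'a" (infixr \<open>*\<^sub>C\<close> 75) +
  fixes V :: "'a set" and B :: "'a \<Rightarrow> 'a \<Rightarrow> complex"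
  assumes V: "subspace V"
    and add_left: "\<lbrakk>f \<in> V; g \<in> V; h \<in> V\<rbrakk> \<Longrightarrow> B (f + g) h = B f h + B g h"
    and scale_left: "\<lbrakk>f \<in> V; h \<in> V\<rbrakk> \<Longrightarrow> B (c *\<^sub>C f) h = c * B f h"
    and sym: "\<lbrakk>f \<in> V; g \<in> V\<rbrakk> \<Longrightarrow> B g f = cnj (B f g)"
begin

definition quad :: "'a \<Rightarrow> real" where "quad f = Re (B f f)"

lemma V_closed [simp, intro]:
  "0 \<in> V" "\<lbrakk>f \<in> V; g \<in> V\<rbrakk> \<Longrightarrow> f + g \<in> V" "\<lbrakk>f \<in> V; g \<in> V\<rbrakk> \<Longrightarrow> f - g \<in> V" "f \<in> V \<Longrightarrow> c *\<^sub>C f \<in> V"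
  "(\<And>i. i \<in> I \<Longrightarrow> F i \<in> V) \<Longrightarrow> (\<Sum>i\<in>I. F i) \<in> V"
  using V by (auto simp: subspace_0 subspace_add subspace_diff subspace_scale subspace_sum)

lemma add_right: "\<lbrakk>f \<in> V; g \<in> V; h \<in> V\<rbrakk> \<Longrightarrow> B h (f + g) = B h f + B h g"
  using sym[of "f + g" h] sym[of f h] sym[of g h] by (simp add: add_left)

lemma scale_right: "\<lbrakk>f \<in> V; h \<in> V\<rbrakk> \<Longrightarrow> B h (c *\<^sub>C f) = cnj c * B h f"
  using sym[of "c *\<^sub>C f" h] sym[of f h] by (simp add: scale_left)

lemma diff_left: "\<lbrakk>f \<in> V; g \<in> V; h \<in> V\<rbrakk> \<Longrightarrow> B (f - g) h = B f h - B g h"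
  using add_left[of "f - g" g h] by simp

lemma diff_right: "\<lbrakk>f \<in> V; g \<in> V; h \<in> V\<rbrakk> \<Longrightarrow> B h (f - g) = B h f - B h g"
  using add_right[of "f - g" g h] by simp

lemma zero_left [simp]: "h \<in> V \<Longrightarrow> B 0 h = 0"
  using add_left[of 0 0 h] by simp

lemma zero_right [simp]: "h \<in> V \<Longrightarrow> B h 0 = 0"
  using add_right[of 0 0 h] by simp

lemma sum_left: "\<lbrakk>\<And>i. i \<in> I \<Longrightarrow> F i \<in> V; h \<in> V\<rbrakk> \<Longrightarrow> B (\<Sum>i\<in>I. F i) h = (\<Sum>i\<in>I. B (F i) h)"
  by (induction I rule: infinite_finite_induct) (simp_all add: add_left)

lemma sum_right: "\<lbrakk>\<And>i. i \<in> I \<Longrightarrow> F i \<in> V; h \<in> V\<rbrakk> \<Longrightarrow> B h (\<Sum>i\<in>I. F i) = (\<Sum>i\<in>I. B h (F i))"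
  by (induction I rule: infinite_finite_induct) (simp_all add: add_right)

lemma diagonal: "f \<in> V \<Longrightarrow> B f f = of_real (quad f)"
  using sym[of f f] by (auto simp: quad_def complex_eq_iff)

lemma quad_add: "\<lbrakk>f \<in> V; g \<in> V\<rbrakk> \<Longrightarrow> quad (f + g) = quad f + quad g + 2 * Re (B f g)"
  using sym[of f g] by (simp add: quad_def add_left add_right)

lemma quad_diff: "\<lbrakk>f \<in> V; g \<in> V\<rbrakk> \<Longrightarrow> quad (f - g) = quad f + quad g - 2 * Re (B f g)"
  using sym[of f g] by (simp add: quad_def diff_left diff_right)

lemma parallelogram: "\<lbrakk>f \<in> V; g \<in> V\<rbrakk> \<Longrightarrow> quad (f + g) + quad (f - g) = 2 * quad f + 2 * quad g"
  by (simp add: quad_add quad_diff)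

lemma quad_scale: "f \<in> V \<Longrightarrow> quad (c *\<^sub>C f) = (cmod c)\<^sup>2 * quad f"
proof -
  assume f: "f \<in> V"
  have "B (c *\<^sub>C f) (c *\<^sub>C f) = c * cnj c * B f f" using f by (simp add: scale_left scale_right)
  also have "\<dots> = of_real ((cmod c)\<^sup>2 * quad f)"
    using f by (simp add: diagonal flip: complex_norm_square)
  finally show ?thesis by (simp add: quad_def)
qed

lemma quad_zero [simp]: "quad 0 = 0" by (simp add: quad_def)

text \<open>Positivity is asked for on a subspace and degeneracy is allowed, because the main use is
  for forms that vanish at a minimiser: the inequality then puts the minimiser into the kernel of
  the form.\<close>

lemma Cauchy_Schwarz:
  assumes W: "subspace W" "W \<subseteq> V" and psd: "\<And>f. f \<in> W \<Longrightarrow> 0 \<le> quad f" and f: "f \<in> W" and g: "g \<in> W"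
  shows "(cmod (B f g))\<^sup>2 \<le> quad f * quad g"
proof -
  define b where "b = B f g"
  have fg: "f \<in> V" "g \<in> V" using W f g by auto
  have q: "0 \<le> quad f + 2 * t * (cmod b)\<^sup>2 + t\<^sup>2 * (cmod b)\<^sup>2 * quad g" for t :: real
  proof -
    have "f + (of_real t * b) *\<^sub>C g \<in> W" using W(1) f g by (simp add: subspace_add subspace_scale)
    from psd[OF this] have "0 \<le> quad f + (cmod (of_real t * b))\<^sup>2 * quad g + 2 * Re (B f ((of_real t * b) *\<^sub>C g))"
      using fg by (simp add: quad_add quad_scale)
    also have "B f ((of_real t * b) *\<^sub>C g) = of_real (t * (cmod b)\<^sup>2)"
      using fg by (simp add: scale_right flip: b_def) (simp add: mult.commute flip: complex_norm_square)
    finally show ?thesis by (simp add: norm_mult power_mult_distrib algebra_simps)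
  qed
  consider "cmod b = 0" | "cmod b \<noteq> 0" "quad g = 0" | "cmod b \<noteq> 0" "quad g > 0"
    using psd[OF g] by fastforce
  then show ?thesis
  proof cases
    case 1 then show ?thesis using psd[OF f] psd[OF g] by (simp flip: b_def)
  next
    \<comment> \<open>With \<open>quad g = 0\<close> the bound \<open>q\<close> is affine in t with
      positive slope; this t makes its right-hand side -1, so the case is contradictory.\<close>
    case 2 then show ?thesis using q[of "-(quad f + 1) / (2 * (cmod b)\<^sup>2)"] by (simp add: field_simps)
  next
    case 3 
    have "0 \<le> quad f - (cmod b)\<^sup>2 / quad g"
      using q[of "-1 / quad g"] 3 by (simp add: field_simps power2_eq_square)
    then show ?thesis using 3 by (simp add: field_simps flip: b_def)
  qed
qed

end

text \<open>An abstraction of H1 inside L2. Both forms are used on \<open>V\<close> alone, since the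
  ambient type contains functions on which the integrals mean nothing, and \<open>V\<close> is in
  general not complete for \<open>ip\<close>. Therefore \<open>compactness\<close> yields a
  subsequence that is \<open>ip\<close>-Cauchy but has no limit yet, while
  \<open>completeness\<close> refers to the energy norm of \<open>s + E ip\<close>.\<close>

locale compact_form = ip: hermitian_form scale V ip + s: hermitian_form scale V s
  for scale :: "complex \<Rightarrow> 'a::ab_group_add \<Rightarrow> 'a" (infixr \<open>*\<^sub>C\<close> 75) and V ip s +
  fixes E :: real
  assumes definite: "\<lbrakk>f \<in> V; Re (ip f f) = 0\<rbrakk> \<Longrightarrow> f = 0"
    and nonneg: "f \<in> V \<Longrightarrow> 0 \<le> Re (ip f f)"
    and coercive: "f \<in> V \<Longrightarrow> Re (ip f f) \<le> Re (s f f) + E * Re (ip f f)"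
    and compactness: "\<lbrakk>\<And>n. u n \<in> V; \<And>n. Re (s (u n) (u n)) + E * Re (ip (u n) (u n)) \<le> C\<rbrakk> \<Longrightarrow>
      \<exists>r::nat \<Rightarrow> nat. strict_mono r \<and> (\<forall>e>0. \<exists>N. \<forall>m\<ge>N. \<forall>n\<ge>N.
        Re (ip (u (r m) - u (r n)) (u (r m) - u (r n))) < e)"
    and completeness: "\<lbrakk>\<And>n::nat. u n \<in> V; \<And>e. 0 < e \<Longrightarrow> \<exists>N. \<forall>m\<ge>N. \<forall>n\<ge>N.
        Re (s (u m - u n) (u m - u n)) + E * Re (ip (u m - u n) (u m - u n)) < e\<rbrakk> \<Longrightarrow>
      \<exists>v\<in>V. (\<lambda>n. Re (s (u n - v) (u n - v)) + E * Re (ip (u n - v) (u n - v))) \<longlonglongrightarrow> 0"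
begin

abbreviation N2 where "N2 \<equiv> ip.quad"
abbreviation S2 where "S2 \<equiv> s.quad"

definition a where "a f g = s f g + of_real E * ip f g"

sublocale a: hermitian_form scale V a
  by unfold_locales (auto simp: a_def ip.V ip.add_left s.add_left ip.scale_left s.scale_left ip.sym[symmetric] s.sym[symmetric] algebra_simps)

lemma a_quad: "a.quad f = S2 f + E * N2 f"
  by (simp add: a.quad_def s.quad_def ip.quad_def a_def)

lemma N2_nonneg: "f \<in> V \<Longrightarrow> 0 \<le> N2 f" and N2_le_a: "f \<in> V \<Longrightarrow> N2 f \<le> a.quad f"
  using nonneg coercive by (auto simp: a_quad ip.quad_def s.quad_def)

lemma a_nonneg: "f \<in> V \<Longrightarrow> 0 \<le> a.quad f"
  using N2_nonneg N2_le_a by fastforce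

lemma N2_zero_iff: "f \<in> V \<Longrightarrow> N2 f = 0 \<longleftrightarrow> f = 0"
  using definite by (auto simp: ip.quad_def)

lemma N2_pos: "\<lbrakk>f \<in> V; f \<noteq> 0\<rbrakk> \<Longrightarrow> 0 < N2 f"
  using N2_nonneg[of f] N2_zero_iff[of f] by simp

lemma ip_CS: "\<lbrakk>f \<in> V; g \<in> V\<rbrakk> \<Longrightarrow> (cmod (ip f g))\<^sup>2 \<le> N2 f * N2 g"
  by (rule ip.Cauchy_Schwarz[OF ip.V order_refl N2_nonneg])

lemma a_CS: "\<lbrakk>f \<in> V; g \<in> V\<rbrakk> \<Longrightarrow> (cmod (a f g))\<^sup>2 \<le> a.quad f * a.quad g"
  by (rule a.Cauchy_Schwarz[OF ip.V order_refl a_nonneg])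

text \<open>The form is a parameter because the lemma serves both \<open>ip\<close> and the energy
  form \<open>a\<close>. Cauchy-Schwarz against a fixed vector gives the first limit; expanding the
  square of \<open>(u n - v) + v\<close> gives the second.\<close>

lemma quad_tendsto:
  assumes B: "hermitian_form scale V B"
    and CS: "\<And>f g. \<lbrakk>f \<in> V; g \<in> V\<rbrakk> \<Longrightarrow> (cmod (B f g))\<^sup>2 \<le> Re (B f f) * Re (B g g)"
    and u: "\<And>n::nat. u n \<in> V" "v \<in> V" and lim: "(\<lambda>n. Re (B (u n - v) (u n - v))) \<longlonglongrightarrow> 0" and h: "h \<in> V"
  shows "(\<lambda>n. B (u n) h) \<longlonglongrightarrow> B v h" "(\<lambda>n. Re (B (u n) (u n))) \<longlonglongrightarrow> Re (B v v)"
proof -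
  interpret B: hermitian_form scale V B by (rule B)
  have lim0: "(\<lambda>n. B (u n - v) h) \<longlonglongrightarrow> 0" if h: "h \<in> V" for h
  proof -
    have "(\<lambda>n. (cmod (B (u n - v) h))\<^sup>2) \<longlonglongrightarrow> 0"
    proof (rule tendsto_sandwich[OF _ _ tendsto_const])
      show "(\<lambda>n. Re (B (u n - v) (u n - v)) * Re (B h h)) \<longlonglongrightarrow> 0"
        using tendsto_mult_right[OF lim, of "Re (B h h)"] by simp
    qed (use CS u h in auto)
    from tendsto_real_sqrt[OF this] show ?thesis by (simp add: tendsto_norm_zero_iff)
  qed
  show 1: "(\<lambda>n. B (u n) h) \<longlonglongrightarrow> B v h"
    using lim0[OF h] u h by (simp add: B.diff_left LIM_zero_iff)
  have "(\<lambda>n. Re (B (u n - v) (u n - v)) + Re (B v v) + 2 * Re (B (u n - v) v)) \<longlonglongrightarrow> 0 + Re (B v v) + 2 * Re 0"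
    by (intro tendsto_intros lim lim0 u)
  moreover have "Re (B (u n - v) (u n - v)) + Re (B v v) + 2 * Re (B (u n - v) v) = Re (B (u n) (u n))" for n
    using B.quad_add[of "u n - v" v] u unfolding B.quad_def by simp
  ultimately show "(\<lambda>n. Re (B (u n) (u n))) \<longlonglongrightarrow> Re (B v v)" by simp
qed

text \<open>The direct method for the Rayleigh quotient on the orthogonal complement of the
  \<open>f k\<close>, which \<open>g0\<close> shows to be nonzero. Weak limits are avoided:
  compactness makes a minimising sequence \<open>ip\<close>-Cauchy, the parallelogram law upgrades
  this to Cauchy in the energy norm, and completeness supplies a strong limit.\<close>

lemma minimiser:
  assumes f: "\<And>k. k < (N::nat) \<Longrightarrow> f k \<in> V" and ex: "g0 \<in> V" "g0 \<noteq> 0" "\<And>k. k < N \<Longrightarrow> ip g0 (f k) = 0"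
  obtains u where "u \<in> V" "N2 u = 1" "\<And>k. k < N \<Longrightarrow> ip u (f k) = 0"
    "\<And>g. \<lbrakk>g \<in> V; \<And>k. k < N \<Longrightarrow> ip g (f k) = 0\<rbrakk> \<Longrightarrow> S2 u * N2 g \<le> S2 g"
proof -
  define W where "W = {g \<in> V. \<forall>k<N. ip g (f k) = 0}"
  have WV: "W \<subseteq> V" by (auto simp: W_def)
  have W: "ip.subspace W"
    unfolding W_def ip.subspace_def using f by (auto simp: ip.add_left ip.scale_left)
  define m where "m = Inf (S2 ` {g \<in> W. N2 g = 1})"
  \<comment> \<open>Coercivity at a unit vector reads \<open>1 \<le> S2 g + E\<close>.\<close>
  have bdd: "bdd_below (S2 ` {g \<in> W. N2 g = 1})"
  proof (rule bdd_belowI[of _ "1 - E"])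
    fix x assume "x \<in> S2 ` {g \<in> W. N2 g = 1}"
    then obtain g where g: "x = S2 g" "g \<in> W" "N2 g = 1" by auto
    then have "g \<in> V" using WV by auto
    from N2_le_a[OF this] show "1 - E \<le> x" using g by (simp add: a_quad)
  qed
  have normalise: "\<exists>c. c *\<^sub>C g \<in> W \<and> N2 (c *\<^sub>C g) = 1 \<and> S2 (c *\<^sub>C g) * N2 g = S2 g" if "g \<in> W" "g \<noteq> 0" for g
  proof -
    have p: "0 < N2 g" and gV: "g \<in> V" using that WV N2_pos by auto
    let ?c = "of_real (1 / sqrt (N2 g))"
    have "(cmod ?c)\<^sup>2 = 1 / N2 g" using p by (simp add: norm_divide power_divide)
    then show ?thesis using p gV that(1) W
      by (intro exI[of _ ?c]) (simp add: ip.quad_scale s.quad_scale ip.subspace_scale)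
  qed
  have ne: "{g \<in> W. N2 g = 1} \<noteq> {}" using normalise[of g0] ex by (auto simp: W_def)
  have lower: "m * N2 g \<le> S2 g" if gW: "g \<in> W" for g
  proof (cases "g = 0")
    case False
    obtain c where c: "c *\<^sub>C g \<in> W" "N2 (c *\<^sub>C g) = 1" "S2 (c *\<^sub>C g) * N2 g = S2 g" using normalise[OF gW False] by blast
    have "m \<le> S2 (c *\<^sub>C g)" unfolding m_def by (rule cInf_lower[OF _ bdd]) (use c in auto)
    moreover have "0 \<le> N2 g" using N2_nonneg[of g] WV gW by auto
    ultimately have "m * N2 g \<le> S2 (c *\<^sub>C g) * N2 g" by (rule mult_right_mono)
    then show ?thesis using c(3) by simp
  qed auto
  have "\<exists>u. u \<in> W \<and> N2 u = 1 \<and> S2 u < m + 1 / real (Suc n)" for n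
  proof -
    have "\<exists>x\<in>S2 ` {g \<in> W. N2 g = 1}. x < m + 1 / real (Suc n)"
      by (subst cInf_less_iff[symmetric]) (use ne bdd in \<open>auto simp: m_def\<close>)
    then show ?thesis by auto
  qed
  then obtain u where u: "\<And>n. u n \<in> W" "\<And>n. N2 (u n) = 1" "\<And>n. S2 (u n) < m + 1 / real (Suc n)" by metis
  have uV: "u n \<in> V" for n using u WV by auto
  have "Re (s (u n) (u n)) + E * Re (ip (u n) (u n)) \<le> m + 1 + E" for n
  proof -
    have "1 / real (Suc n) \<le> 1" by simp
    then have "S2 (u n) + E * N2 (u n) \<le> m + 1 + E" using u(2,3)[of n] unfolding u(2) by linarith
    then show ?thesis by (simp add: ip.quad_def s.quad_def)
  qed
  from compactness[of u "m + 1 + E", OF uV this] obtain r :: "nat \<Rightarrow> nat" where r: "strict_mono r" and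
    cauchy: "\<And>e. 0 < e \<Longrightarrow> \<exists>N. \<forall>m\<ge>N. \<forall>n\<ge>N. N2 (u (r m) - u (r n)) < e"
    unfolding ip.quad_def by metis
  define w where "w n = u (r n)" for n :: nat
  have wV: "w n \<in> V" "w n \<in> W" for n using uV u by (auto simp: w_def)
  have Sw: "S2 (w n) < m + 1 / real (Suc n)" for n :: nat
  proof -
    have "1 / real (Suc (r n)) \<le> 1 / real (Suc n)" using seq_suble[OF r, of n] by (simp add: field_simps)
    then show ?thesis using u(3)[of "r n"] by (simp add: w_def)
  qed
  \<comment> \<open>The sum \<open>w i + w j\<close> stays in \<open>W\<close>, so its form is at
    least \<open>m * (4 - N2 (w i - w j))\<close>. In the parallelogram law the \<open>4 * m\<close>
    cancels against the nearly minimal values of \<open>S2 (w i)\<close> and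
    \<open>S2 (w j)\<close>, which leaves only the two errors and a multiple of
    \<open>N2 (w i - w j)\<close>.\<close>
  have diff: "S2 (w i - w j) + E * N2 (w i - w j) \<le> 2 / real (Suc i) + 2 / real (Suc j) + (\<bar>m\<bar> + \<bar>E\<bar>) * N2 (w i - w j)" for i j
  proof -
    have "w i + w j \<in> W" using wV W by (simp add: ip.subspace_add)
    moreover have "N2 (w i + w j) = 4 - N2 (w i - w j)"
      using ip.parallelogram[OF wV(1) wV(1), of i j] u(2) by (simp add: w_def)
    ultimately have "m * (4 - N2 (w i - w j)) \<le> S2 (w i + w j)"
      using lower[of "w i + w j"] by simp
    then have "S2 (w i - w j) \<le> 2 / real (Suc i) + 2 / real (Suc j) + m * N2 (w i - w j)"
      using s.parallelogram[OF wV(1) wV(1), of i j] Sw[of i] Sw[of j] by (simp add: algebra_simps)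
    moreover have "m * N2 (w i - w j) \<le> \<bar>m\<bar> * N2 (w i - w j)" "E * N2 (w i - w j) \<le> \<bar>E\<bar> * N2 (w i - w j)"
      using N2_nonneg wV by (simp_all add: mult_right_mono)
    ultimately show ?thesis by (simp add: algebra_simps)
  qed
  have "\<exists>N. \<forall>i\<ge>N. \<forall>j\<ge>N. Re (s (w i - w j) (w i - w j)) + E * Re (ip (w i - w j) (w i - w j)) < e" if e: "e > 0" for e
  proof -
    have "0 < e / (3 * (\<bar>m\<bar> + \<bar>E\<bar> + 1))" using e by simp
    then obtain N1 where N1: "\<And>i j. \<lbrakk>i \<ge> N1; j \<ge> N1\<rbrakk> \<Longrightarrow> N2 (w i - w j) < e / (3 * (\<bar>m\<bar> + \<bar>E\<bar> + 1))"
      using cauchy unfolding w_def by blast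
    obtain N2' where N2': "6 / e < real N2'" using reals_Archimedean2 by blast
    have "S2 (w i - w j) + E * N2 (w i - w j) < e" if ij: "i \<ge> max N1 N2'" "j \<ge> max N1 N2'" for i j
    proof -
      have *: "2 / real (Suc i) < e / 3" if "i \<ge> N2'" for i
      proof -
        have "6 / e < real (Suc i)" using N2' that by linarith
        then show ?thesis using e by (simp add: field_simps)
      qed
      have "(\<bar>m\<bar> + \<bar>E\<bar>) * N2 (w i - w j) \<le> (\<bar>m\<bar> + \<bar>E\<bar> + 1) * N2 (w i - w j)"
        using N2_nonneg wV by (simp add: mult_right_mono)
      also have "\<dots> < (\<bar>m\<bar> + \<bar>E\<bar> + 1) * (e / (3 * (\<bar>m\<bar> + \<bar>E\<bar> + 1)))"
        using N1 ij by (intro mult_strict_left_mono) auto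
      also have "\<dots> = e / 3"
        by (simp add: field_simps)
      finally have **: "(\<bar>m\<bar> + \<bar>E\<bar>) * N2 (w i - w j) < e / 3" .
      have "2 / real (Suc i) < e / 3" "2 / real (Suc j) < e / 3" using *[of i] *[of j] ij by simp_all
      then show ?thesis using diff[of i j] ** by linarith
    qed
    then show ?thesis unfolding ip.quad_def s.quad_def by (intro exI[of _ "max N1 N2'"] allI impI)
  qed
  from completeness[OF wV(1) this] obtain v where v: "v \<in> V" and
    lim: "(\<lambda>n. a.quad (w n - v)) \<longlonglongrightarrow> 0" by (auto simp: a_quad s.quad_def ip.quad_def)
  have limN: "(\<lambda>n. N2 (w n - v)) \<longlonglongrightarrow> 0"
    by (rule tendsto_sandwich[OF _ _ tendsto_const lim]) (use N2_nonneg N2_le_a wV v in auto)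
  have tN: "(\<lambda>n. ip (w n) h) \<longlonglongrightarrow> ip v h" "(\<lambda>n. N2 (w n)) \<longlonglongrightarrow> N2 v" if "h \<in> V" for h
    using quad_tendsto[OF ip.hermitian_form_axioms ip_CS[unfolded ip.quad_def], of w v h] wV(1) v limN that
    by (simp_all add: ip.quad_def)
  have ta: "(\<lambda>n. a.quad (w n)) \<longlonglongrightarrow> a.quad v"
    using quad_tendsto(2)[OF a.hermitian_form_axioms a_CS[unfolded a.quad_def], of w v v] wV(1) v lim
    by (simp add: a.quad_def)
  have N2v: "N2 v = 1"
    using tN(2)[OF v] u(2) by (simp add: w_def LIMSEQ_const_iff)
  have orth: "ip v (f k) = 0" if "k < N" for k
  proof -
    have "(\<lambda>n. ip (w n) (f k)) = (\<lambda>n. 0)" using wV that by (auto simp: W_def)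
    then show ?thesis using tN(1)[OF f[OF that]] by (simp add: LIMSEQ_const_iff)
  qed
  have "(\<lambda>n. S2 (w n)) \<longlonglongrightarrow> S2 v"
    using tendsto_diff[OF ta tendsto_mult_left[OF tN(2)[OF v], of E]] by (simp add: a_quad)
  moreover have "(\<lambda>n. m + 1 / real (Suc n)) \<longlonglongrightarrow> m + 0"
    by (intro tendsto_add tendsto_const LIMSEQ_Suc[OF lim_1_over_n])
  ultimately have "S2 v \<le> m"
    using LIMSEQ_le[of "\<lambda>n. S2 (w n)" _ "\<lambda>n. m + 1 / real (Suc n)"] less_imp_le[OF Sw] by auto
  then have low: "S2 v * N2 g \<le> S2 g" if "g \<in> V" "\<And>k. k < N \<Longrightarrow> ip g (f k) = 0" for g
    using lower[of g] N2_nonneg[of g] that mult_right_mono[of "S2 v" m "N2 g"] by (simp add: W_def)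
  show ?thesis by (rule that[of v]) (fact v N2v orth low)+
qed

definition eig :: "real \<Rightarrow> 'a set" where
  "eig m = {f \<in> V. \<forall>h\<in>V. s f h = of_real m * ip f h}"

lemma eig_subspace: "ip.subspace (eig m)"
  by (auto simp: eig_def ip.subspace_def ip.add_left s.add_left ip.scale_left s.scale_left algebra_simps)

lemma eig_quad: "f \<in> eig m \<Longrightarrow> S2 f = m * N2 f"
  by (auto simp: eig_def s.quad_def ip.quad_def)

lemma eig_orthogonal:
  assumes "f \<in> eig m" "g \<in> eig m'" "m \<noteq> m'"
  shows "ip f g = 0"
proof -
  have V: "f \<in> V" "g \<in> V" using assms by (auto simp: eig_def)
  have "of_real m * ip f g = cnj (of_real m' * ip g f)"
    using assms V s.sym[of f g] by (simp add: eig_def)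
  also have "\<dots> = of_real m' * ip f g" using ip.sym[of f g] V by simp
  finally show ?thesis using assms(3) by simp
qed

text \<open>The Euler-Lagrange equation without differentiation: \<open>s - S2 u * ip\<close> is
  positive semidefinite on the complement \<open>W\<close> and vanishes at \<open>u\<close>, so
  Cauchy-Schwarz makes \<open>u\<close> orthogonal to \<open>W\<close> for this form.\<close>

lemma minimiser_eig:
  assumes f: "\<And>k. k < (N::nat) \<Longrightarrow> f k \<in> eig (mu k)" "\<And>k. k < N \<Longrightarrow> N2 (f k) = 1"
    and orth: "\<And>k l. \<lbrakk>k < N; l < N; k \<noteq> l\<rbrakk> \<Longrightarrow> ip (f k) (f l) = 0"
    and u: "u \<in> V" "N2 u = 1" "\<And>k. k < N \<Longrightarrow> ip u (f k) = 0"
    and min: "\<And>g. \<lbrakk>g \<in> V; \<And>k. k < N \<Longrightarrow> ip g (f k) = 0\<rbrakk> \<Longrightarrow> S2 u * N2 g \<le> S2 g"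
  shows "u \<in> eig (S2 u)"
proof -
  define W where "W = {g \<in> V. \<forall>k<N. ip g (f k) = 0}"
  have fV: "f k \<in> V" if "k < N" for k using f that by (auto simp: eig_def)
  have W: "ip.subspace W" "W \<subseteq> V"
    unfolding W_def ip.subspace_def using fV by (auto simp: ip.add_left ip.scale_left)
  define B where "B f g = s f g - of_real (S2 u) * ip f g" for f g
  interpret B: hermitian_form scale V B
    by unfold_locales (auto simp: B_def ip.V ip.add_left s.add_left ip.scale_left s.scale_left ip.sym[symmetric] s.sym[symmetric] algebra_simps)
  have Bq: "B.quad g = S2 g - S2 u * N2 g" for g by (simp add: B.quad_def B_def s.quad_def ip.quad_def)
  have uW: "u \<in> W" using u by (auto simp: W_def)
  have BW: "B u g = 0" if "g \<in> W" for g
  proof -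
    have "(cmod (B u g))\<^sup>2 \<le> B.quad u * B.quad g"
      by (rule B.Cauchy_Schwarz[OF W _ uW that]) (use min in \<open>auto simp: Bq W_def\<close>)
    then show ?thesis using u by (simp add: Bq)
  qed
  have "B u h = 0" if h: "h \<in> V" for h
  proof -
    \<comment> \<open>Splitting off the projection \<open>p\<close> leaves a vector of
      \<open>W\<close>. On the span of the \<open>f k\<close> the form vanishes for another reason:
      the \<open>f k\<close> are eigenvectors orthogonal to \<open>u\<close>.\<close>
    define p where "p = (\<Sum>k<N. ip h (f k) *\<^sub>C f k)"
    have pV: "p \<in> V" using fV h unfolding p_def by (intro ip.V_closed) auto
    have "ip p (f l) = ip h (f l)" if "l < N" for l
    proof -
      have "ip p (f l) = (\<Sum>k<N. ip h (f k) * ip (f k) (f l))"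
        unfolding p_def using fV that by (subst ip.sum_left) (auto simp: ip.scale_left)
      also have "\<dots> = (\<Sum>k<N. if k = l then ip h (f l) else 0)"
        using orth f fV that by (intro sum.cong) (auto simp: ip.diagonal)
      finally show ?thesis using that by simp
    qed
    then have "h - p \<in> W" using h pV fV by (auto simp: W_def ip.diff_left)
    then have "B u (h - p) = 0" by (rule BW)
    moreover have "B u p = 0"
    proof -
      have "B u (f k) = 0" if k: "k < N" for k
      proof -
        have "s u (f k) = cnj (of_real (mu k) * ip (f k) u)"
          using f(1)[OF k] u(1) s.sym[of "f k" u] by (auto simp: eig_def)
        also have "\<dots> = 0" using u(1) u(3)[OF k] ip.sym[of u "f k"] fV[OF k] by simp
        finally show ?thesis using u(3)[OF k] by (simp add: B_def)
      qed
      then show ?thesis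
        unfolding p_def using fV u(1) by (subst B.sum_right) (auto simp: B.scale_right)
    qed
    ultimately show ?thesis using B.diff_right[of h p u] h pV u by simp
  qed
  then show ?thesis using u(1) by (auto simp: eig_def B_def)
qed

text \<open>The hypothesis keeps the recursive minimisation going: among infinitely many eigenvalues
  one differs from the finitely many found so far, and its eigenvectors are orthogonal to all
  earlier \<open>f k\<close>, so the complement is nonzero. The conclusions on range, finiteness and
  cardinality are shaped like the clauses of \<open>eigenvalue_sequence\<close>, so that
  \<open>mu\<close> can later be identified with a given sequence.\<close>

theorem spectral_basis:
  assumes inf: "infinite {m. \<exists>f\<in>eig m. f \<noteq> 0}"
  obtains f mu where "\<And>n::nat. f n \<in> eig (mu n)" "\<And>n. N2 (f n) = 1"
    "\<And>k n. k \<noteq> n \<Longrightarrow> ip (f k) (f n) = 0"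
    "\<And>n g. \<lbrakk>g \<in> V; \<And>k. k < n \<Longrightarrow> ip g (f k) = 0\<rbrakk> \<Longrightarrow> mu n * N2 g \<le> S2 g"
    "mono mu" "filterlim mu at_top sequentially"
    "range mu = {m. \<exists>f\<in>eig m. f \<noteq> 0}"
    "\<And>m. finite {n. mu n = m}" "\<And>m. card {n. mu n = m} = ip.dim (eig m)"
proof -
  define P where "P f n u \<longleftrightarrow> u \<in> V \<and> N2 u = 1 \<and> (\<forall>k<n. ip u (f k) = 0) \<and> u \<in> eig (S2 u) \<and>
     (\<forall>g\<in>V. (\<forall>k<n. ip g (f k) = 0) \<longrightarrow> S2 u * N2 g \<le> S2 g)" for f :: "nat \<Rightarrow> 'a" and n u
  have "\<exists>f. \<forall>n. P f n (f n)"
  proof (rule dependent_wellorder_choice[where P = P])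
    show "P f n u = P g n u" if "\<And>y. y < n \<Longrightarrow> f y = g y" for f g n u
      unfolding P_def using that by (simp cong: conj_cong)
    fix n f assume IH: "P f y (f y)" if "y < n" for y
    have fV: "f k \<in> V" if "k < n" for k using IH[OF that] by (auto simp: P_def)
    have orth: "ip (f k) (f l) = 0" if "k < n" "l < n" "k \<noteq> l" for k l
      using that IH[of k] IH[of l] fV[of k] fV[of l] ip.sym[of "f k" "f l"]
      unfolding P_def by (cases k l rule: linorder_cases) simp_all
    have "infinite ({m. \<exists>f\<in>eig m. f \<noteq> 0} - (\<lambda>k. S2 (f k)) ` {..<n})" using inf by simp
    then obtain m g where g: "g \<in> eig m" "g \<noteq> 0" "m \<notin> (\<lambda>k. S2 (f k)) ` {..<n}"
      using infinite_imp_nonempty[of "{m. \<exists>f\<in>eig m. f \<noteq> 0} - (\<lambda>k. S2 (f k)) ` {..<n}"] by auto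
    have gV: "g \<in> V" using g by (auto simp: eig_def)
    have "ip g (f k) = 0" if "k < n" for k
      by (rule eig_orthogonal[OF g(1), of _ "S2 (f k)"]) (use IH[OF that] g that in \<open>auto simp: P_def\<close>)
    then obtain u where u: "u \<in> V" "N2 u = 1" "\<And>k. k < n \<Longrightarrow> ip u (f k) = 0"
      "\<And>g. \<lbrakk>g \<in> V; \<And>k. k < n \<Longrightarrow> ip g (f k) = 0\<rbrakk> \<Longrightarrow> S2 u * N2 g \<le> S2 g"
      using minimiser[of n f g, OF fV gV g(2)] by metis
    have "u \<in> eig (S2 u)"
      by (rule minimiser_eig[of n f "\<lambda>k. S2 (f k)", OF _ _ orth u]) (use IH in \<open>auto simp: P_def\<close>)
    then show "\<exists>u. P f n u" using u unfolding P_def by (intro exI[of _ u]) simp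
  qed
  then obtain f where P: "\<And>n. P f n (f n)" by blast
  define mu where "mu n = S2 (f n)" for n
  have fV: "f n \<in> V" and f1: "N2 (f n) = 1" and fe: "f n \<in> eig (mu n)" for n using P by (auto simp: P_def mu_def)
  have orth: "ip (f k) (f l) = 0" if "k \<noteq> l" for k l
      using that P[of k] P[of l] fV ip.sym[of "f k" "f l"]
      by (cases k l rule: linorder_cases) (auto simp: P_def)
  have min: "mu n * N2 g \<le> S2 g" if "g \<in> V" "\<And>k. k < n \<Longrightarrow> ip g (f k) = 0" for n g
    using P that by (auto simp: P_def mu_def)
  have mono: "mono mu"
  proof (rule monoI)
    fix i j :: nat assume "i \<le> j"
    then have "mu i * N2 (f j) \<le> S2 (f j)" by (intro min[OF fV]) (auto intro: orth)
    then show "mu i \<le> mu j" by (simp add: f1 mu_def)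
  qed
  \<comment> \<open>Otherwise the \<open>f n\<close> have bounded energy and some subsequence is
    \<open>ip\<close>-Cauchy, although orthonormal vectors have squared distance 2.\<close>
  have unbounded: "\<exists>n. Z < mu n" for Z
  proof (rule ccontr)
    assume "\<nexists>n. Z < mu n"
    then have "Re (s (f n) (f n)) + E * Re (ip (f n) (f n)) \<le> Z + E" for n
      using f1 unfolding mu_def by (auto simp: s.quad_def ip.quad_def not_less)
    from compactness[of f "Z + E", OF fV this] obtain r :: "nat \<Rightarrow> nat" where r: "strict_mono r" and
       "\<forall>e>0. \<exists>N. \<forall>m\<ge>N. \<forall>n\<ge>N. N2 (f (r m) - f (r n)) < e"
      unfolding ip.quad_def by blast
    then obtain N where "\<forall>m\<ge>N. \<forall>n\<ge>N. N2 (f (r m) - f (r n)) < 1" using zero_less_one by blast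
    then have "N2 (f (r (Suc N)) - f (r N)) < 1" by simp
    moreover have "r (Suc N) \<noteq> r N" using r by (metis lessI less_irrefl strict_mono_def)
    ultimately show False using fV f1 by (simp add: ip.quad_diff orth)
  qed
  have top: "filterlim mu at_top sequentially"
    unfolding filterlim_at_top eventually_sequentially
  proof
    fix Z :: real
    obtain N where "Z < mu N" using unbounded by blast
    then show "\<exists>N. \<forall>n\<ge>N. Z \<le> mu n" using monoD[OF mono, of N] by (intro exI[of _ N] allI impI) (meson less_imp_le less_le_trans)
  qed
  have below: "{n. mu n = m} \<subseteq> {..<N}" if "m < mu N" for m N
  proof
    fix n assume "n \<in> {n. mu n = m}"
    then show "n \<in> {..<N}" using that monoD[OF mono, of N n] by (cases "N \<le> n") auto
  qed
  have fin: "finite {n. mu n = m}" for m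
  proof -
    obtain N where "m < mu N" using unbounded by blast
    from below[OF this] show ?thesis by (rule finite_subset) simp
  qed
  \<comment> \<open>The remainder \<open>g - p\<close> is still an eigenvector for \<open>m\<close>,
    and it is orthogonal to every \<open>f l\<close> with \<open>l < N\<close>, where
    \<open>mu N > m\<close>. The minimality of \<open>mu N\<close> then forces its norm to be
    0.\<close>
  have expand: "g = (\<Sum>k\<in>{n. mu n = m}. ip g (f k) *\<^sub>C f k)" if g: "g \<in> eig m" for g m
  proof -
    obtain N where N: "m < mu N" using unbounded by blast
    have gV: "g \<in> V" using g by (auto simp: eig_def)
    define p where "p = (\<Sum>k\<in>{n. mu n = m}. ip g (f k) *\<^sub>C f k)"
    have pe: "p \<in> eig m" unfolding p_def
      by (rule ip.subspace_sum[OF eig_subspace], rule ip.subspace_scale[OF eig_subspace]) (use fe in auto)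
    have "ip (g - p) (f l) = 0" if "l < N" for l
    proof (cases "mu l = m")
      case False
      then show ?thesis by (intro eig_orthogonal[OF ip.subspace_diff[OF eig_subspace g pe] fe]) simp
    next
      case True
      have "ip p (f l) = (\<Sum>k\<in>{n. mu n = m}. ip g (f k) * ip (f k) (f l))"
        unfolding p_def using fV by (subst ip.sum_left) (auto simp: ip.scale_left)
      also have "\<dots> = (\<Sum>k\<in>{n. mu n = m}. if k = l then ip g (f l) else 0)"
        using orth f1 fV by (intro sum.cong) (auto simp: ip.diagonal)
      also have "\<dots> = ip g (f l)" using fin True by simp
      finally show ?thesis using gV pe fV by (auto simp: ip.diff_left eig_def)
    qed
    then have "mu N * N2 (g - p) \<le> S2 (g - p)"
      using gV pe by (intro min) (auto simp: eig_def)
    also have "\<dots> = m * N2 (g - p)" by (rule eig_quad) (rule ip.subspace_diff[OF eig_subspace g pe])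
    finally have "(mu N - m) * N2 (g - p) \<le> 0" by (simp add: algebra_simps)
    then have "N2 (g - p) \<le> 0" using N by (simp add: mult_le_0_iff)
    then have "g - p = 0" using N2_nonneg[of "g - p"] N2_zero_iff[of "g - p"] gV pe by (auto simp: eig_def)
    then show ?thesis by (simp add: p_def)
  qed
  have fne: "f n \<noteq> 0" for n using f1[of n] by auto
  have range: "range mu = {m. \<exists>f\<in>eig m. f \<noteq> 0}"
  proof (intro equalityI subsetI)
    fix m assume "m \<in> {m. \<exists>f\<in>eig m. f \<noteq> 0}"
    then obtain g where "g \<in> eig m" "g \<noteq> 0" by blast
    then have "{n. mu n = m} \<noteq> {}" using expand[of g m] by (metis (no_types) sum.empty)
    then show "m \<in> range mu" by auto
  qed (use fe fne in auto)
  have inj: "inj f"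
  proof (rule injI, rule ccontr)
    fix i j assume "f i = f j" "i \<noteq> j"
    then have "ip (f i) (f i) = 0" using orth[of i j] by simp
    then show False using f1[of i] by (simp add: ip.quad_def)
  qed
  have dim: "card {n. mu n = m} = ip.dim (eig m)" for m
  proof -
    let ?b = "f ` {n. mu n = m}"
    have "ip.independent ?b"
    proof (rule ip.independent_if_scalars_zero)
      fix c x assume 0: "(\<Sum>x\<in>?b. c x *\<^sub>C x) = 0" and "x \<in> ?b"
      then obtain l where l: "mu l = m" "x = f l" by auto
      have "0 = ip (\<Sum>x\<in>?b. c x *\<^sub>C x) (f l)" using 0 fV by simp
      also have "\<dots> = ip (\<Sum>n\<in>{n. mu n = m}. c (f n) *\<^sub>C f n) (f l)"
        by (subst sum.reindex) (auto intro: inj_on_subset[OF inj])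
      also have "\<dots> = (\<Sum>n\<in>{n. mu n = m}. c (f n) * ip (f n) (f l))"
        using fV by (subst ip.sum_left) (auto simp: ip.scale_left)
      also have "\<dots> = (\<Sum>n\<in>{n. mu n = m}. if n = l then c (f l) else 0)"
        using orth f1 fV by (intro sum.cong) (auto simp: ip.diagonal)
      also have "\<dots> = c x" using fin l by simp
      finally show "c x = 0" by simp
    qed (use fin in simp)
    moreover have "eig m \<subseteq> ip.span ?b"
    proof
      fix g assume "g \<in> eig m"
      have "(\<Sum>k\<in>{n. mu n = m}. ip g (f k) *\<^sub>C f k) \<in> ip.span ?b"
        by (intro ip.span_sum ip.span_scale ip.span_base) simp
      then show "g \<in> ip.span ?b" using expand[OF \<open>g \<in> eig m\<close>] by simp
    qed
    moreover have "?b \<subseteq> eig m" using fe by auto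
    ultimately have "ip.dim (eig m) = card ?b" using ip.basis_card_eq_dim[of ?b "eig m"] by simp
    also have "\<dots> = card {n. mu n = m}" by (rule card_image) (rule inj_on_subset[OF inj], simp)
    finally show ?thesis by simp
  qed
  show ?thesis by (rule that[of f mu]) (fact fe f1 orth min mono top range fin dim)+
qed

end

section \<open>Orthonormal expansions, the Ky Fan inequality and dual norms of functionals\<close>

context compact_form begin

lemma orthonormal_decomposition:
  assumes g: "\<And>n. n < N \<Longrightarrow> g n \<in> V" "\<And>n. n < N \<Longrightarrow> N2 (g n) = 1"
    and orth: "\<And>k n. \<lbrakk>k < N; n < N; k \<noteq> n\<rbrakk> \<Longrightarrow> ip (g k) (g n) = 0"
    and h: "h \<in> V"
  defines "p \<equiv> (\<Sum>n<(N::nat). ip h (g n) *\<^sub>C g n)"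
  shows "p \<in> V" "\<And>n. n < N \<Longrightarrow> ip (h - p) (g n) = 0" "\<And>n. n < N \<Longrightarrow> ip (g n) (h - p) = 0"
    "\<And>n. n < N \<Longrightarrow> ip (g n) p = cnj (ip h (g n))"
    "N2 h = (\<Sum>n<N. (cmod (ip h (g n)))\<^sup>2) + N2 (h - p)"
proof -
  show pV: "p \<in> V" unfolding p_def using g h by (intro ip.V_closed) auto
  have ipp: "ip p (g l) = ip h (g l)" if "l < N" for l
  proof -
    have "ip p (g l) = (\<Sum>k<N. ip h (g k) * ip (g k) (g l))"
      unfolding p_def using g that by (subst ip.sum_left) (auto simp: ip.scale_left)
    also have "\<dots> = (\<Sum>k<N. if k = l then ip h (g l) else 0)"
      using orth g that by (intro sum.cong) (auto simp: ip.diagonal)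
    finally show ?thesis using that by simp
  qed
  show orth_r: "ip (h - p) (g n) = 0" if "n < N" for n
    using ipp[OF that] h pV g(1)[OF that] by (simp add: ip.diff_left)
  show orth_r': "ip (g n) (h - p) = 0" if "n < N" for n
    using orth_r[OF that] ip.sym[of "h - p" "g n"] h pV g(1)[OF that] by simp
  show ipp': "ip (g n) p = cnj (ip h (g n))" if "n < N" for n
    using ipp[OF that] ip.sym[of p "g n"] pV g(1)[OF that] by simp
  have "ip p (h - p) = 0"
    unfolding p_def using g h orth_r'[unfolded p_def] pV[unfolded p_def]
    by (subst ip.sum_left) (auto simp: ip.scale_left)
  moreover have "ip p p = (\<Sum>n<N. of_real ((cmod (ip h (g n)))\<^sup>2))"
  proof -
    have "ip p p = (\<Sum>n<N. ip h (g n) * ip (g n) p)"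
      by (subst (1) p_def, subst ip.sum_left) (use g pV in \<open>auto simp: ip.scale_left\<close>)
    then show ?thesis using ipp' by (simp add: complex_norm_square[symmetric] del: of_real_power)
  qed
  ultimately show "N2 h = (\<Sum>n<N. (cmod (ip h (g n)))\<^sup>2) + N2 (h - p)"
    using ip.quad_add[of p "h - p"] pV h by (simp add: ip.quad_def[of p] Re_sum)
qed

lemma Bessel:
  assumes "\<And>n. n < N \<Longrightarrow> g n \<in> V" "\<And>n. n < N \<Longrightarrow> N2 (g n) = 1"
    and "\<And>k n. \<lbrakk>k < N; n < N; k \<noteq> n\<rbrakk> \<Longrightarrow> ip (g k) (g n) = 0" and "h \<in> V"
  shows "(\<Sum>n<(N::nat). (cmod (ip h (g n)))\<^sup>2) \<le> N2 h"
  using orthonormal_decomposition(5)[of N g h] orthonormal_decomposition(1)[of N g h] assms N2_nonneg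
  by (metis (no_types, lifting) ip.V_closed(3) le_add_same_cancel1)

end

text \<open>Completeness of the eigenvectors is encoded by \<open>f_min\<close> and
  \<open>mu_top\<close>: what is left of a vector after removing its first N components has a form
  value of at least \<open>mu N\<close> times its squared norm.\<close>

locale spectral_form = compact_form +
  fixes f :: "nat \<Rightarrow> 'a" and mu :: "nat \<Rightarrow> real"
  assumes f_eig: "f n \<in> eig (mu n)" and f_unit: "N2 (f n) = 1"
    and f_orth: "k \<noteq> n \<Longrightarrow> ip (f k) (f n) = 0"
    and f_min: "\<lbrakk>g \<in> V; \<And>k. k < n \<Longrightarrow> ip g (f k) = 0\<rbrakk> \<Longrightarrow> mu n * N2 g \<le> S2 g"
    and mu_mono: "mono mu" and mu_top: "filterlim mu at_top sequentially"
begin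

lemma f_V [simp]: "f n \<in> V" using f_eig by (auto simp: eig_def)

lemma s_f: "h \<in> V \<Longrightarrow> s (f n) h = of_real (mu n) * ip (f n) h"
  using f_eig[of n] by (auto simp: eig_def)

definition rest :: "nat \<Rightarrow> 'a \<Rightarrow> 'a" where "rest N g = g - (\<Sum>n<N. ip g (f n) *\<^sub>C f n)"

text \<open>Projection and remainder are orthogonal for \<open>ip\<close> and, because the
  \<open>f n\<close> are eigenvectors, for \<open>s\<close> too; hence both quadratic forms
  split.\<close>

lemma rest:
  assumes g: "g \<in> V"
  shows "rest N g \<in> V" "N2 g = (\<Sum>n<N. (cmod (ip g (f n)))\<^sup>2) + N2 (rest N g)"
    "S2 g = (\<Sum>n<N. mu n * (cmod (ip g (f n)))\<^sup>2) + S2 (rest N g)"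
    "mu N * N2 (rest N g) \<le> S2 (rest N g)"
proof -
  define p where "p = (\<Sum>n<N. ip g (f n) *\<^sub>C f n)"
  have dec: "p \<in> V" "\<And>n. n < N \<Longrightarrow> ip (g - p) (f n) = 0" "\<And>n. n < N \<Longrightarrow> ip (f n) (g - p) = 0"
    "\<And>n. n < N \<Longrightarrow> ip (f n) p = cnj (ip g (f n))"
    "N2 g = (\<Sum>n<N. (cmod (ip g (f n)))\<^sup>2) + N2 (g - p)"
    unfolding p_def using f_V f_unit f_orth g by (simp_all add: orthonormal_decomposition[of N f g])
  note pV = dec(1)
  then show rV: "rest N g \<in> V" using g by (simp add: rest_def p_def)
  show "N2 g = (\<Sum>n<N. (cmod (ip g (f n)))\<^sup>2) + N2 (rest N g)"
    using dec(5) by (simp add: rest_def p_def)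
  have r: "rest N g = g - p" by (simp add: rest_def p_def)
  have "s p (g - p) = 0"
  proof -
    have "s p (g - p) = (\<Sum>n<N. ip g (f n) * s (f n) (g - p))"
      by (subst (1) p_def, subst s.sum_left) (use g pV in \<open>auto simp: s.scale_left\<close>)
    then show ?thesis using g pV dec(3) by (simp add: s_f)
  qed
  moreover have "s p p = (\<Sum>n<N. of_real (mu n * (cmod (ip g (f n)))\<^sup>2))"
  proof -
    have "s p p = (\<Sum>n<N. ip g (f n) * s (f n) p)"
      by (subst (1) p_def, subst s.sum_left) (use g pV in \<open>auto simp: s.scale_left\<close>)
    also have "\<dots> = (\<Sum>n<N. of_real (mu n * (cmod (ip g (f n)))\<^sup>2))"
      using dec(4) pV by (intro sum.cong) (simp_all add: s_f complex_norm_square del: of_real_power)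
    finally show ?thesis .
  qed
  ultimately show "S2 g = (\<Sum>n<N. mu n * (cmod (ip g (f n)))\<^sup>2) + S2 (rest N g)"
    using s.quad_add[of p "g - p"] pV g by (simp add: s.quad_def[of p] Re_sum r)
  show "mu N * N2 (rest N g) \<le> S2 (rest N g)"
    using dec(2) rV by (intro f_min) (simp_all add: r)
qed

text \<open>The part of each \<open>g n\<close> beyond the first N eigenvectors costs at least
  \<open>mu N\<close> per unit of squared norm. What remains has coefficients
  \<open>mu k - mu N \<le> 0\<close>, multiplied by the weights of \<open>f k\<close> summed over
  all \<open>g n\<close>. By Bessel these sums are at most 1, and replacing them by 1 only lowers
  the total.\<close>

theorem Ky_Fan:
  assumes g: "\<And>n. n < N \<Longrightarrow> g n \<in> V" "\<And>n. n < N \<Longrightarrow> N2 (g n) = 1"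
    and orth: "\<And>k n. \<lbrakk>k < N; n < N; k \<noteq> n\<rbrakk> \<Longrightarrow> ip (g k) (g n) = 0"
  shows "(\<Sum>n<N. mu n) \<le> (\<Sum>n<N. S2 (g n))"
proof -
  have ge: "mu N + (\<Sum>k<N. (mu k - mu N) * (cmod (ip (g n) (f k)))\<^sup>2) \<le> S2 (g n)" if "n < N" for n
  proof -
    have "mu N * (1 - (\<Sum>k<N. (cmod (ip (g n) (f k)))\<^sup>2)) \<le> S2 (g n) - (\<Sum>k<N. mu k * (cmod (ip (g n) (f k)))\<^sup>2)"
    proof -
      have "1 - (\<Sum>k<N. (cmod (ip (g n) (f k)))\<^sup>2) = N2 (rest N (g n))"
        using rest(2)[OF g(1)[OF that], of N] g(2)[OF that] by simp
      then show ?thesis using rest(3,4)[OF g(1)[OF that], of N] by simp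
    qed
    then show ?thesis by (simp add: algebra_simps sum_subtractf sum_distrib_left)
  qed
  have le: "(\<Sum>n<N. (cmod (ip (g n) (f k)))\<^sup>2) \<le> 1" for k
  proof -
    have "cmod (ip (g n) (f k)) = cmod (ip (f k) (g n))" if "n < N" for n
      using ip.sym[of "f k" "g n"] g(1)[OF that] by simp
    then show ?thesis using Bessel[of N g "f k", OF g orth] f_unit by simp
  qed
  have "(\<Sum>n<N. mu n) = (\<Sum>n<N. mu N + (mu n - mu N) * 1)" by simp
  also have "\<dots> \<le> (\<Sum>k<N. mu N + (mu k - mu N) * (\<Sum>n<N. (cmod (ip (g n) (f k)))\<^sup>2))"
    using le monoD[OF mu_mono] by (intro sum_mono add_left_mono mult_left_mono_neg) auto
  also have "\<dots> = (\<Sum>n<N. mu N + (\<Sum>k<N. (mu k - mu N) * (cmod (ip (g n) (f k)))\<^sup>2))"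
    by (simp add: sum.distrib sum_distrib_left) (rule sum.swap)
  also have "\<dots> \<le> (\<Sum>n<N. S2 (g n))" by (intro sum_mono ge) simp
  finally show ?thesis .
qed

lemma mu_pos: "E \<le> t \<Longrightarrow> 1 \<le> mu n + t"
  using N2_le_a[OF f_V, of n] eig_quad[OF f_eig, of n] f_unit[of n] by (simp add: a_quad)

lemma shifted_nonneg: "\<lbrakk>E \<le> t; g \<in> V\<rbrakk> \<Longrightarrow> 0 \<le> S2 g + t * N2 g"
  using a_nonneg[of g] mult_right_mono[of E t "N2 g"] N2_nonneg[of g] by (simp add: a_quad)

context
  fixes L :: "'a \<Rightarrow> complex" and t :: real
  assumes L_add: "\<And>g h. \<lbrakk>g \<in> V; h \<in> V\<rbrakk> \<Longrightarrow> L (g + h) = L g + L h"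
    and L_scale: "\<And>g c. g \<in> V \<Longrightarrow> L (c *\<^sub>C g) = c * L g"
    and t: "E \<le> t"
begin

lemma L_sum: "(\<And>n. n \<in> I \<Longrightarrow> g n \<in> V) \<Longrightarrow> L (\<Sum>n\<in>I. g n) = (\<Sum>n\<in>I. L (g n))"
proof (induction I rule: infinite_finite_induct)
  have "L 0 = 0" using L_scale[of 0 0] by simp
  then show "L (\<Sum>n\<in>I. g n) = (\<Sum>n\<in>I. L (g n))" if "infinite I" for I using that by simp
  show "L (\<Sum>n\<in>{}. g n) = (\<Sum>n\<in>{}. L (g n))" using \<open>L 0 = 0\<close> by simp
qed (simp add: L_add)

text \<open>One half of a Riesz identity: the full series is the squared dual norm of
  \<open>L\<close> with respect to \<open>S2 + t * N2\<close>. Each partial sum is attained on a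
  finite combination of eigenvectors, so any constant that bounds \<open>L\<close> bounds it as
  well.\<close>

lemma functional_Bessel:
  assumes bound: "\<And>g. g \<in> V \<Longrightarrow> (cmod (L g))\<^sup>2 \<le> K * (S2 g + t * N2 g)"
  shows "(\<Sum>n<N. (cmod (L (f n)))\<^sup>2 / (mu n + t)) \<le> K"
proof -
  define w where "w n = mu n + t" for n
  have w: "0 < w n" for n using mu_pos[OF t, of n] by (simp add: w_def)
  define G where "G = (\<Sum>n<N. (cmod (L (f n)))\<^sup>2 / w n)"
  \<comment> \<open>The Riesz representative of \<open>L\<close> for the form
    \<open>S2 + t * N2\<close>, truncated after N terms. Both \<open>L F\<close> and the form value
    at \<open>F\<close> equal \<open>G\<close>, so the bound reads
    \<open>G\<^sup>2 \<le> K * G\<close>.\<close>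
  define F where "F = (\<Sum>n<N. (cnj (L (f n)) / of_real (w n)) *\<^sub>C f n)"
  have FV: "F \<in> V" unfolding F_def by (intro ip.V_closed) simp
  have LF: "L F = of_real G"
    unfolding F_def G_def by (subst L_sum) (simp_all add: L_scale complex_norm_square mult.commute del: of_real_power)
  have ipF: "ip F (f l) = cnj (L (f l)) / of_real (w l)" if "l < N" for l
  proof -
    have "ip F (f l) = (\<Sum>n<N. cnj (L (f n)) / of_real (w n) * ip (f n) (f l))"
      unfolding F_def by (subst ip.sum_left) (auto simp: ip.scale_left)
    also have "\<dots> = (\<Sum>n<N. if n = l then cnj (L (f l)) / of_real (w l) else 0)"
      by (intro sum.cong) (auto simp: f_orth ip.diagonal f_unit)
    finally show ?thesis using that by simp
  qed
  have "F = (\<Sum>n<N. ip F (f n) *\<^sub>C f n)" using ipF by (simp add: F_def)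
  then have "rest N F = 0" by (simp add: rest_def)
  then have "S2 F + t * N2 F = (\<Sum>n<N. w n * (cmod (ip F (f n)))\<^sup>2)"
    using rest(2,3)[OF FV, of N] by (simp add: sum_distrib_left sum.distrib algebra_simps w_def)
  also have "\<dots> = G" unfolding G_def
    using w by (intro sum.cong) (auto simp: ipF norm_divide power_divide power2_eq_square less_imp_neq[THEN not_sym])
  finally have "G\<^sup>2 \<le> K * G" using bound[OF FV] by (simp add: LF)
  moreover have "0 \<le> G" unfolding G_def using w by (intro sum_nonneg) (simp add: less_imp_le)
  moreover have "0 \<le> K"
  proof -
    have "0 \<le> K * (S2 (f 0) + t * N2 (f 0))" using bound[of "f 0"] by (simp add: order_trans[OF zero_le_power2])
    then show ?thesis using mu_pos[OF t, of 0] eig_quad[OF f_eig, of 0] by (simp add: f_unit zero_le_mult_iff)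
  qed
  ultimately show ?thesis unfolding G_def[symmetric, unfolded w_def]
    by (cases "G = 0") (simp_all add: power2_eq_square)
qed

text \<open>The converse half. On the first N components of \<open>h\<close> a weighted
  Cauchy-Schwarz inequality suffices. The remainder has bounded form and vanishing norm, and
  \<open>small\<close>, an infinitesimal form bound for \<open>L\<close>, turns this into
  \<open>L (rest N h)\<close> tending to 0.\<close>

lemma functional_completeness:
  assumes small: "\<And>e. 0 < e \<Longrightarrow> \<exists>C\<ge>0. \<forall>g\<in>V. (cmod (L g))\<^sup>2 \<le> e * (S2 g + t * N2 g) + C * N2 g"
    and bound: "\<And>N. (\<Sum>n<N. (cmod (L (f n)))\<^sup>2 / (mu n + t)) \<le> K" and h: "h \<in> V"
  shows "(cmod (L h))\<^sup>2 \<le> K * (S2 h + t * N2 h)"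
proof -
  define w where "w n = mu n + t" for n
  define Q where "Q g = S2 g + t * N2 g" for g
  have w: "0 < w n" for n using mu_pos[OF t, of n] by (simp add: w_def)
  have Q0: "0 \<le> Q g" if "g \<in> V" for g using shifted_nonneg[OF t that] by (simp add: Q_def)
  have Qh: "Q h = (\<Sum>n<N. w n * (cmod (ip h (f n)))\<^sup>2) + Q (rest N h)" for N
    using rest(2,3)[OF h, of N] by (simp add: Q_def w_def sum_distrib_left sum.distrib algebra_simps)
  have rV: "rest N h \<in> V" for N by (rule rest[OF h])
  have Qr: "Q (rest N h) \<le> Q h" for N
    unfolding Qh[of N] using w by (simp add: sum_nonneg less_imp_le)
  have Nr: "N2 (rest N h) \<le> Q h / w N" for N
  proof -
    have "w N * N2 (rest N h) \<le> Q (rest N h)" using rest(4)[OF h, of N] by (simp add: Q_def w_def algebra_simps)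
    with Qr[of N] w[of N] show ?thesis by (simp add: field_simps)
  qed
  have lim: "(\<lambda>N. cmod (L (rest N h))) \<longlonglongrightarrow> 0"
  proof -
    have "\<exists>N0. \<forall>N\<ge>N0. (cmod (L (rest N h)))\<^sup>2 < e" if e: "0 < e" for e
    proof -
      \<comment> \<open>This share of \<open>e\<close> makes the form part contribute less than
        \<open>e / 2\<close>; the summand 1 covers \<open>Q h = 0\<close>.\<close>
      have "0 < e / (2 * (Q h + 1))" using e Q0[OF h] by simp
      then obtain C where C: "C \<ge> 0" "\<And>g. g \<in> V \<Longrightarrow> (cmod (L g))\<^sup>2 \<le> e / (2 * (Q h + 1)) * Q g + C * N2 g"
        using small[of "e / (2 * (Q h + 1))"] unfolding Q_def[symmetric] by auto
      have "\<forall>\<^sub>F N in sequentially. 2 * C * Q h / e < mu N + t"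
        using filterlim_at_top_dense[THEN iffD1, OF mu_top, rule_format, of "2 * C * Q h / e - t"] by (simp add: diff_less_eq)
      then obtain N0 where N0: "\<And>N. N \<ge> N0 \<Longrightarrow> 2 * C * Q h / e < w N"
        unfolding eventually_sequentially w_def by blast
      have "(cmod (L (rest N h)))\<^sup>2 < e" if N: "N \<ge> N0" for N
      proof -
        have "e / (2 * (Q h + 1)) * Q (rest N h) \<le> e / (2 * (Q h + 1)) * Q h"
          using Qr e Q0[OF h] by (intro mult_left_mono) auto
        also have "\<dots> < e / 2" using e Q0[OF h] by (simp add: field_simps)
        finally have "e / (2 * (Q h + 1)) * Q (rest N h) < e / 2" .
        moreover have "C * N2 (rest N h) \<le> C * (Q h / w N)" using Nr C by (intro mult_left_mono) auto
        moreover have "C * (Q h / w N) \<le> e / 2" using N0[OF N] e w[of N] by (simp add: field_simps)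
        ultimately show ?thesis using C(2)[OF rV, of N] by linarith
      qed
      then show ?thesis by blast
    qed
    then have "(\<lambda>N. (cmod (L (rest N h)))\<^sup>2) \<longlonglongrightarrow> 0" by (simp add: LIMSEQ_iff)
    from tendsto_real_sqrt[OF this] show ?thesis by simp
  qed
  have le: "cmod (L h) \<le> sqrt (K * Q h) + cmod (L (rest N h))" for N
  proof -
    have "L h = L (rest N h + (\<Sum>n<N. ip h (f n) *\<^sub>C f n))" by (simp add: rest_def)
    also have "\<dots> = L (rest N h) + (\<Sum>n<N. ip h (f n) * L (f n))"
      using rV h by (simp add: L_add L_sum L_scale)
    finally have "cmod (L h) \<le> cmod (L (rest N h)) + (\<Sum>n<N. cmod (ip h (f n)) * cmod (L (f n)))"
      using norm_triangle_ineq[of "L (rest N h)" "\<Sum>n<N. ip h (f n) * L (f n)"]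
        norm_sum[of "\<lambda>n. ip h (f n) * L (f n)" "{..<N}"] by (simp add: norm_mult)
    moreover have "(\<Sum>n<N. cmod (ip h (f n)) * cmod (L (f n))) \<le> sqrt (K * Q h)"
    proof (rule real_le_rsqrt)
      \<comment> \<open>Inserting \<open>sqrt (w n)\<close> and its inverse separates the form value
        of \<open>h\<close> from the series of \<open>L\<close>.\<close>
      have "(\<Sum>n<N. cmod (ip h (f n)) * cmod (L (f n)))\<^sup>2 =
          (\<Sum>n<N. (sqrt (w n) * cmod (ip h (f n))) * (cmod (L (f n)) / sqrt (w n)))\<^sup>2"
        using w by (intro arg_cong[where f = "\<lambda>x. x\<^sup>2"] sum.cong) (auto simp: less_imp_neq[THEN not_sym])
      also have "\<dots> \<le> (\<Sum>n<N. (sqrt (w n) * cmod (ip h (f n)))\<^sup>2) * (\<Sum>n<N. (cmod (L (f n)) / sqrt (w n))\<^sup>2)"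
        by (rule Cauchy_Schwarz_ineq_sum)
      also have "\<dots> = (\<Sum>n<N. w n * (cmod (ip h (f n)))\<^sup>2) * (\<Sum>n<N. (cmod (L (f n)))\<^sup>2 / w n)"
        using w by (simp add: power_mult_distrib power_divide less_imp_le)
      also have "\<dots> \<le> Q h * K"
      proof (rule mult_mono)
        show "(\<Sum>n<N. w n * (cmod (ip h (f n)))\<^sup>2) \<le> Q h" using Qh[of N] Q0[OF rV, of N] by simp
        show "(\<Sum>n<N. (cmod (L (f n)))\<^sup>2 / w n) \<le> K" using bound by (simp add: w_def)
      qed (use Q0[OF h] w in \<open>auto intro!: sum_nonneg simp: less_imp_le\<close>)
      finally show "(\<Sum>n<N. cmod (ip h (f n)) * cmod (L (f n)))\<^sup>2 \<le> K * Q h" by (simp add: mult.commute)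
    qed
    ultimately show ?thesis by simp
  qed
  have "cmod (L h) \<le> sqrt (K * Q h) + 0"
    by (rule LIMSEQ_le_const[OF tendsto_add[OF tendsto_const lim]]) (use le in blast)
  moreover have "0 \<le> K" using bound[of 0] by simp
  ultimately show ?thesis using Q0[OF h] power_mono[of "cmod (L h)" "sqrt (K * Q h)" 2]
    by (simp add: Q_def)
qed

end

end

text \<open>The induction runs on a sharper bound: the weighted sum dominates the last weight times
  the plain partial sum. This is what absorbs a negative \<open>v (Suc N)\<close>.\<close>

lemma Abel_sum_nonneg:
  fixes v w :: "nat \<Rightarrow> real"
  assumes w: "\<And>n. 0 \<le> w n" "\<And>n. w (Suc n) \<le> w n" and v: "\<And>N. 0 \<le> (\<Sum>n<N. v n)"
  shows "0 \<le> (\<Sum>n<N. w n * v n)"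
proof -
  have "w N * (\<Sum>n<Suc N. v n) \<le> (\<Sum>n<Suc N. w n * v n)" for N
  proof (induction N)
    case 0
    then show ?case by simp
  next
    case (Suc N)
    have "w (Suc N) * (\<Sum>n<Suc (Suc N). v n) = w (Suc N) * (\<Sum>n<Suc N. v n) + w (Suc N) * v (Suc N)"
      by (simp add: algebra_simps)
    also have "\<dots> \<le> w N * (\<Sum>n<Suc N. v n) + w (Suc N) * v (Suc N)"
      using w(2) v by (intro add_right_mono mult_right_mono)
    also have "\<dots> \<le> (\<Sum>n<Suc N. w n * v n) + w (Suc N) * v (Suc N)" by (rule add_right_mono[OF Suc])
    finally show ?case by simp
  qed
  moreover have "0 \<le> w N * (\<Sum>n<Suc N. v n)" for N by (intro mult_nonneg_nonneg w v)
  ultimately show ?thesis by (cases N) (simp, metis order_trans)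
qed

section \<open>Test functions\<close>

lemma smooth_on_continuous:
  assumes "smooth_on S f" shows "continuous_on S f"
proof (rule continuous_at_imp_continuous_on, rule ballI)
  fix x assume "x \<in> S"
  then have "(deriv ^^ 0) f differentiable (at x)" using assms unfolding smooth_on_def by blast
  then show "isCont f x" by (simp add: differentiable_imp_continuous_within)
qed

text \<open>Iterates of \<open>deriv\<close> are total functions that can be compared on
  \<open>S\<close> only; openness of \<open>S\<close> turns this comparison into one near each of
  its points. It makes \<open>- q\<close> an admissible potential.\<close>

lemma smooth_on_minus:
  assumes h: "smooth_on S h" and S: "open S" shows "smooth_on S (\<lambda>x. - h x)"
proof -
  have D: "((deriv ^^ n) h has_real_derivative (deriv ^^ Suc n) h x) (at x)" if "x \<in> S" for n x
    using h that by (auto simp: smooth_on_def real_differentiable_def dest: DERIV_imp_deriv)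
  have *: "((deriv ^^ n) (\<lambda>x. - h x) has_real_derivative - (deriv ^^ Suc n) h x) (at x)" if "x \<in> S" for n x
    using that
  proof (induction n arbitrary: x)
    case 0
    then show ?case using DERIV_minus[OF D[of x 0]] by simp
  next
    case (Suc n)
    have "(deriv ^^ Suc n) (\<lambda>x. - h x) y = - (deriv ^^ Suc n) h y" if "y \<in> S" for y
      using DERIV_imp_deriv[OF Suc.IH[OF that]] by simp
    then show ?case
      by (intro has_field_derivative_transform_within_open[OF DERIV_minus[OF D[OF Suc.prems]] S Suc.prems]) simp
  qed
  show ?thesis unfolding smooth_on_def real_differentiable_def using * by blast
qed

text \<open>The extra powers make the family closed under differentiation up to linear combinations,
  so smoothness needs no estimates of higher derivatives. For \<open>i = j = 0\<close> the functions
  increase to the indicator of the open interval as \<open>c\<close> tends to 0.\<close>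

definition bump :: "real \<Rightarrow> real \<Rightarrow> real \<Rightarrow> nat \<Rightarrow> nat \<Rightarrow> real \<Rightarrow> real" where
  "bump a b c i j x = (if a < x \<and> x < b
     then exp (- (c * inverse (x - a)) - c * inverse (b - x)) * inverse (x - a) ^ i * inverse (b - x) ^ j
     else 0)"

lemma power_le_exp:
  fixes y :: real assumes "0 \<le> y" shows "y ^ k \<le> fact k * exp y"
proof -
  have "(\<Sum>n\<in>{k}. y ^ n /\<^sub>R fact n) \<le> (\<Sum>n. y ^ n /\<^sub>R fact n)"
    using assms by (intro sum_le_suminf summable_exp_generic) auto
  then have "y ^ k / fact k \<le> exp y" by (simp add: exp_def field_simps)
  then show ?thesis by (simp add: field_simps)
qed

lemma exp_inverse_power_le:
  fixes c d :: real assumes "0 < c" "0 < d"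
  shows "exp (- (c * inverse d)) * inverse d ^ k \<le> fact k / c ^ k"
proof -
  have "(c * inverse d) ^ k \<le> fact k * exp (c * inverse d)" using assms by (intro power_le_exp) simp
  then show ?thesis using assms by (simp add: exp_minus field_simps power_mult_distrib)
qed

lemma bump_swap: "bump a b c i j x = bump (- b) (- a) c j i (- x)"
  by (auto simp: bump_def algebra_simps)

lemma bump_nonneg: "0 \<le> bump a b c i j x"
  by (auto simp: bump_def)

text \<open>The exponential controls two more inverse powers of \<open>x - a\<close> than are
  present, and these are traded for the square. Quadratic decay is just what makes the derivative at
  \<open>a\<close> vanish.\<close>

lemma bump_bound_left:
  assumes "0 < c"
  shows "\<bar>bump a b c i j x\<bar> \<le> (fact (i + 2) / c ^ (i + 2)) * (fact j / c ^ j) * (x - a)\<^sup>2"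
proof (cases "a < x \<and> x < b")
  case True
  have "bump a b c i j x = (exp (- (c * inverse (x - a))) * inverse (x - a) ^ (i + 2)) *
      (exp (- (c * inverse (b - x))) * inverse (b - x) ^ j) * (x - a)\<^sup>2"
  proof -
    have "inverse (x - a) ^ (i + 2) * (x - a)\<^sup>2 = inverse (x - a) ^ i"
    proof -
      have "(inverse (x - a))\<^sup>2 * (x - a)\<^sup>2 = 1" using True by (simp flip: power_mult_distrib)
      then show ?thesis by (simp only: power_add mult.assoc mult_1_right)
    qed
    moreover have "exp (- (c * inverse (x - a)) - c * inverse (b - x)) =
        exp (- (c * inverse (x - a))) * exp (- (c * inverse (b - x)))"
      by (simp flip: exp_add)
    ultimately show ?thesis using True by (simp only: bump_def if_True mult_ac) simp
  qed
  also have "\<dots> \<le> (fact (i + 2) / c ^ (i + 2)) * (fact j / c ^ j) * (x - a)\<^sup>2"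
    using assms True by (intro mult_right_mono mult_mono exp_inverse_power_le) auto
  finally show ?thesis using bump_nonneg[of a b c i j x] by simp
qed (use assms in \<open>auto simp: bump_def\<close>)

lemma DERIV_zero_of_quadratic_bound:
  fixes f :: "real \<Rightarrow> real"
  assumes "\<And>x. \<bar>f x\<bar> \<le> K * (x - a)\<^sup>2"
  shows "(f has_real_derivative 0) (at a)"
proof -
  have "f a = 0" using assms[of a] by simp
  have "(\<lambda>h. f (a + h) / h) \<midarrow>0\<rightarrow> 0"
  proof (rule Lim_null_comparison)
    show "\<forall>\<^sub>F h in at 0. norm (f (a + h) / h) \<le> K * \<bar>h\<bar>"
    proof (rule eventually_mono[OF eventually_neq_at_within])
      fix h :: real assume "h \<noteq> 0"
      then show "norm (f (a + h) / h) \<le> K * \<bar>h\<bar>" using assms[of "a + h"]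
        by (simp add: abs_divide field_simps power2_eq_square)
    qed
    show "(\<lambda>h. K * \<bar>h\<bar>) \<midarrow>0\<rightarrow> 0" by (auto intro!: tendsto_eq_intros)
  qed
  then show ?thesis by (simp add: DERIV_def \<open>f a = 0\<close>)
qed

lemma DERIV_inverse_power:
  assumes "x \<noteq> (a::real)"
  shows "((\<lambda>x. inverse (x - a) ^ i) has_real_derivative - (real i * inverse (x - a) ^ Suc i)) (at x)"
proof -
  have "((\<lambda>x. inverse (x - a)) has_real_derivative - (inverse (x - a) * inverse (x - a))) (at x)"
    using assms by (auto intro!: derivative_eq_intros)
  from DERIV_power[OF this, of i] show ?thesis by (cases i) (auto elim!: DERIV_cong simp: algebra_simps)
qed

lemma DERIV_inverse_power':
  assumes "x \<noteq> (b::real)"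
  shows "((\<lambda>x. inverse (b - x) ^ i) has_real_derivative real i * inverse (b - x) ^ Suc i) (at x)"
proof -
  have "((\<lambda>x. inverse (b - x)) has_real_derivative inverse (b - x) * inverse (b - x)) (at x)"
    using assms by (auto intro!: derivative_eq_intros)
  from DERIV_power[OF this, of i] show ?thesis by (cases i) (auto elim!: DERIV_cong simp: algebra_simps)
qed

text \<open>The formula must hold at the end points too. There the derivative is 0 by quadratic
  decay, and all bumps on the right-hand side vanish; the right end point is reduced to the left one
  by reflection.\<close>

lemma DERIV_bump:
  assumes "0 < c"
  shows "(bump a b c i j has_real_derivative
    c * bump a b c (i + 2) j x - c * bump a b c i (j + 2) x
      - real i * bump a b c (Suc i) j x + real j * bump a b c i (Suc j) x) (at x)"
proof -
  consider "x < a \<or> b < x \<or> b \<le> a" | "x = a" | "x = b" | "a < x" "x < b" by linarith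
  then show ?thesis
  proof cases
    case 1
    have "\<forall>\<^sub>F y in nhds x. 0 = bump a b c i j y"
    proof -
      consider "x \<in> {..<a}" | "x \<in> {b<..}" | "b \<le> a" using 1 by auto
      then show ?thesis
      proof cases
        case 1 then show ?thesis
          by (rule eventually_mono[OF eventually_nhds_in_open[OF open_lessThan]]) (auto simp: bump_def)
      next
        case 2 then show ?thesis
          by (rule eventually_mono[OF eventually_nhds_in_open[OF open_greaterThan]]) (auto simp: bump_def)
      qed (auto simp: bump_def)
    qed
    then have "(bump a b c i j has_real_derivative 0) (at x)"
      by (subst DERIV_cong_ev[symmetric, where f = "\<lambda>_. 0"]) auto
    then show ?thesis using 1 by (auto simp: bump_def)
  next
    case 2
    have "(bump a b c i j has_real_derivative 0) (at a)"
      by (rule DERIV_zero_of_quadratic_bound[OF bump_bound_left[OF assms]])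
    then show ?thesis using 2 by (auto simp: bump_def)
  next
    case 3
    have "(bump a b c i j has_real_derivative 0) (at b)"
    proof (rule DERIV_zero_of_quadratic_bound)
      show "\<bar>bump a b c i j x\<bar> \<le> (fact (j + 2) / c ^ (j + 2)) * (fact i / c ^ i) * (x - b)\<^sup>2" for x
      proof -
        have "(x - b)\<^sup>2 = (- x - - b)\<^sup>2" by (simp add: power2_commute)
        then show ?thesis using bump_bound_left[OF assms, of "-b" "-a" j i "-x"] by (simp only: bump_swap[of a b c i j x])
      qed
    qed
    then show ?thesis using 3 by (auto simp: bump_def)
  next
    case 4
    define e where "e x = exp (- (c * inverse (x - a)) - c * inverse (b - x))" for x
    have "(e has_real_derivative e x * (c * (inverse (x - a))\<^sup>2 - c * (inverse (b - x))\<^sup>2)) (at x)"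
      using 4 unfolding e_def by (auto intro!: derivative_eq_intros simp: power2_eq_square algebra_simps)
    from DERIV_mult[OF DERIV_mult[OF this DERIV_inverse_power[of x a i]] DERIV_inverse_power'[of x b j]] 4
    have "((\<lambda>x. e x * inverse (x - a) ^ i * inverse (b - x) ^ j) has_real_derivative
      c * bump a b c (i + 2) j x - c * bump a b c i (j + 2) x
      - real i * bump a b c (Suc i) j x + real j * bump a b c i (Suc j) x) (at x)"
      by (auto elim!: DERIV_cong simp: bump_def e_def[symmetric] algebra_simps power2_eq_square)
    moreover have "\<forall>\<^sub>F y in nhds x. e y * inverse (y - a) ^ i * inverse (b - y) ^ j = bump a b c i j y"
      by (rule eventually_mono[OF eventually_nhds_in_open[of "{a<..<b}"]]) (use 4 in \<open>auto simp: bump_def e_def\<close>)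
    ultimately show ?thesis by (subst (asm) DERIV_cong_ev) auto
  qed
qed

text \<open>The linear span of the bumps, given inductively so that closure under derivatives
  follows by rule induction; smoothness is then an iteration of this closure.\<close>

inductive bump_comb :: "(real \<Rightarrow> real) \<Rightarrow> bool" where
  bump: "0 < c \<Longrightarrow> bump_comb (bump a b c i j)"
| add: "\<lbrakk>bump_comb f; bump_comb g\<rbrakk> \<Longrightarrow> bump_comb (\<lambda>x. f x + g x)"
| scale: "bump_comb f \<Longrightarrow> bump_comb (\<lambda>x. r * f x)"

lemma bump_comb_diff: "\<lbrakk>bump_comb f; bump_comb g\<rbrakk> \<Longrightarrow> bump_comb (\<lambda>x. f x - g x)"
  using bump_comb.add[OF _ bump_comb.scale[of g "-1"], of f] by simp

lemma bump_comb_deriv: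
  assumes "bump_comb f" shows "\<exists>f'. bump_comb f' \<and> (\<forall>x. (f has_real_derivative f' x) (at x))"
  using assms
proof induction
  case (bump c a b i j)
  let ?f' = "\<lambda>x. c * bump a b c (i + 2) j x - c * bump a b c i (j + 2) x
      - real i * bump a b c (Suc i) j x + real j * bump a b c i (Suc j) x"
  have "bump_comb ?f'"
    by (rule bump_comb.add[OF bump_comb_diff[OF bump_comb_diff]];
      rule bump_comb.scale; rule bump_comb.bump[OF bump])
  then show ?case using DERIV_bump[OF bump] by blast
next
  case (add f g)
  then obtain f' g' where "bump_comb f'" "\<forall>x. (f has_real_derivative f' x) (at x)"
    "bump_comb g'" "\<forall>x. (g has_real_derivative g' x) (at x)" by blast
  then show ?case
    by (intro exI[of _ "\<lambda>x. f' x + g' x"] conjI bump_comb.add allI DERIV_add) auto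
next
  case (scale f r)
  then obtain f' where "bump_comb f'" "\<forall>x. (f has_real_derivative f' x) (at x)" by blast
  then show ?case
    by (intro exI[of _ "\<lambda>x. r * f' x"] conjI bump_comb.scale allI DERIV_cmult) auto
qed

lemma bump_comb_deriv_iterate:
  assumes "bump_comb f" shows "bump_comb ((deriv ^^ n) f)"
proof (induction n)
  case (Suc n)
  then obtain f' where "bump_comb f'" "\<forall>x. ((deriv ^^ n) f has_real_derivative f' x) (at x)"
    using bump_comb_deriv by blast
  then have "deriv ((deriv ^^ n) f) = f'" by (intro ext DERIV_imp_deriv) simp
  with \<open>bump_comb f'\<close> show ?case by simp
qed (simp add: assms)

lemma bump_comb_smooth: "bump_comb f \<Longrightarrow> smooth_on UNIV f"
  unfolding smooth_on_def
proof (intro allI ballI)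
  fix n x assume "bump_comb f"
  then obtain f' where "\<forall>x. ((deriv ^^ n) f has_real_derivative f' x) (at x)"
    using bump_comb_deriv[OF bump_comb_deriv_iterate] by blast
  then show "(deriv ^^ n) f differentiable (at x)" by (auto simp: real_differentiable_def)
qed

lemma bump_comb_continuous: "bump_comb f \<Longrightarrow> continuous_on S f"
proof -
  assume "bump_comb f"
  then obtain f' where f': "\<And>x. (f has_real_derivative f' x) (at x)" using bump_comb_deriv by blast
  show ?thesis by (rule DERIV_continuous_on[of S f f']) (rule has_field_derivative_at_within[OF f'])
qed

lemma smooth_on_UNIV_deriv:
  assumes "smooth_on UNIV f"
  shows "(f has_real_derivative deriv f x) (at x)" "continuous_on S (deriv f)"
proof -
  have d: "(deriv ^^ n) f differentiable (at x)" for n x using assms by (auto simp: smooth_on_def)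
  show "(f has_real_derivative deriv f x) (at x)"
    using d[of 0 x] by (auto simp: real_differentiable_def dest: DERIV_imp_deriv)
  show "continuous_on S (deriv f)"
    using d[of 1] by (intro continuous_at_imp_continuous_on) (simp add: differentiable_imp_continuous_within)
qed

text \<open>Mean value zero is what makes the primitive vanish to the right of \<open>b\<close>.
  Knowing its derivative exactly means that a weak derivative can be tested with every bump
  combination of mean zero supported inside the interval.\<close>

lemma test_functionI_primitive:
  assumes c: "bump_comb \<beta>" and ab: "0 < a" "a \<le> b" "b < l"
    and 0: "\<And>x. x \<notin> {a..b} \<Longrightarrow> \<beta> x = 0" and int: "integral {a..b} \<beta> = 0"
  defines "\<phi> \<equiv> \<lambda>x. if a \<le> x then integral {a..x} \<beta> else 0"
  shows "\<phi> \<in> test_functions l" "deriv \<phi> = \<beta>"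
proof -
  have cont: "continuous_on S \<beta>" for S by (rule bump_comb_continuous[OF c])
  have \<phi>: "\<phi> x = integral {a..x} \<beta>" for x by (cases "a \<le> x") (auto simp: \<phi>_def)
  \<comment> \<open>Since \<open>\<beta>\<close> vanishes left of \<open>a\<close>, the base point
    may be moved left, so that below every \<open>y\<close> lies in the interior of an interval of
    integration.\<close>
  have shift: "\<phi> x = integral {p..x} \<beta>" if "p \<le> a" for x p
  proof (cases "x < a")
    case True
    have "integral {p..x} \<beta> = integral {p..x} (\<lambda>_. 0)"
      by (rule integral_cong) (use True 0 in auto)
    then show ?thesis using True by (simp add: \<phi>_def)
  next
    case False
    have "integral {p..a} \<beta> + integral {a..x} \<beta> = integral {p..x} \<beta>"
      by (rule Henstock_Kurzweil_Integration.integral_combine) (use False that in \<open>auto intro: integrable_continuous_interval cont\<close>)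
    moreover have "integral {p..a} \<beta> = integral {p..a} (\<lambda>_. 0)"
      by (rule integral_spike[of "{a}"]) (use 0 in auto)
    ultimately show ?thesis by (simp add: \<phi>)
  qed
  have D: "(\<phi> has_real_derivative \<beta> y) (at y)" for y
  proof -
    let ?p = "a - 1 - \<bar>y\<bar> - \<bar>a\<bar>" and ?q = "y + 1 + \<bar>a\<bar>"
    have *: "\<phi> x = integral {?p..x} \<beta>" for x by (rule shift) simp
    have "((\<lambda>x. integral {?p..x} \<beta>) has_real_derivative \<beta> y) (at y within {?p..?q})"
      by (rule integral_has_real_derivative[OF cont]) auto
    moreover have "at y within {?p..?q} = at y" by (rule at_within_interior) (auto simp: interior_atLeastAtMost_real)
    moreover have "\<phi> = (\<lambda>x. integral {?p..x} \<beta>)" using * by (rule ext)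
    ultimately show ?thesis by simp
  qed
  then show d: "deriv \<phi> = \<beta>" by (intro ext DERIV_imp_deriv)
  have "smooth_on UNIV \<phi>"
    unfolding smooth_on_def
  proof (intro allI ballI)
    fix n x show "(deriv ^^ n) \<phi> differentiable at x"
    proof (cases n)
      case 0 then show ?thesis using D by (auto simp: real_differentiable_def)
    next
      case (Suc m)
      then have "(deriv ^^ n) \<phi> = (deriv ^^ m) \<beta>" by (simp add: funpow_swap1 d)
      then show ?thesis using bump_comb_smooth[OF c] by (simp add: smooth_on_def)
    qed
  qed
  moreover have "\<phi> x = 0" if "x \<notin> {a..b}" for x
  proof (cases "a \<le> x")
    case True
    then have "b < x" using that by auto
    have "integral {a..b} \<beta> + integral {b..x} \<beta> = integral {a..x} \<beta>"
      by (rule Henstock_Kurzweil_Integration.integral_combine) (use \<open>b < x\<close> ab in \<open>auto intro: integrable_continuous_interval cont\<close>)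
    moreover have "integral {b..x} \<beta> = integral {b..x} (\<lambda>_. 0)"
      by (rule integral_spike[of "{b}"]) (use 0 in auto)
    ultimately show ?thesis by (simp add: \<phi> int)
  qed (simp add: \<phi>_def)
  ultimately show "\<phi> \<in> test_functions l" using ab unfolding test_functions_def by blast
qed

section \<open>Square-integrable functions and weak derivatives on an interval\<close>

abbreviation leb :: "real \<Rightarrow> real measure" where "leb l \<equiv> lebesgue_on {0<..<l}"

text \<open>A bridge between two integrals: the definitions use Lebesgue integrals over open
  intervals, whereas the calculus lemmas speak of gauge integrals over closed ones. The end points
  are negligible.\<close>

lemma integrable_leb_iff:
  fixes f :: "real \<Rightarrow> 'b::euclidean_space"
  shows "integrable (leb l) f \<longleftrightarrow> f absolutely_integrable_on {0..l}"
proof -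
  have "integrable (leb l) f \<longleftrightarrow> f absolutely_integrable_on {0<..<l}"
    by (simp add: integrable_restrict_space set_integrable_def)
  also have "\<dots> \<longleftrightarrow> f absolutely_integrable_on {0..l}"
    by (rule absolutely_integrable_spike_set_eq; rule negligible_subset[of "{0, l}"]) auto
  finally show ?thesis .
qed

lemma integral_leb:
  fixes f :: "real \<Rightarrow> 'b::euclidean_space"
  assumes "integrable (leb l) f"
  shows "integral\<^sup>L (leb l) f = integral {0..l} f"
  using lebesgue_integral_eq_integral[OF assms] by (simp add: integral_open_interval_real)

lemma integrable_on_leb:
  fixes f :: "real \<Rightarrow> 'b::euclidean_space"
  assumes "integrable (leb l) f" "0 \<le> x" "y \<le> l"
  shows "f integrable_on {x..y}" "f absolutely_integrable_on {x..y}"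
proof -
  show "f absolutely_integrable_on {x..y}"
    using assms absolutely_integrable_on_subinterval[where f = f and S = "{0..l}" and a = x and b = y] by (simp add: integrable_leb_iff)
  then show "f integrable_on {x..y}" by (simp add: absolutely_integrable_on_def)
qed

lemma integrable_leb_continuous:
  fixes f :: "real \<Rightarrow> 'b::euclidean_space"
  shows "continuous_on {0..l} f \<Longrightarrow> integrable (leb l) f"
  by (simp add: integrable_leb_iff absolutely_integrable_continuous_real)

lemma measurable_leb_continuous:
  fixes f :: "real \<Rightarrow> 'b::euclidean_space"
  shows "continuous_on {0..l} f \<Longrightarrow> f \<in> borel_measurable (leb l)"
  by (rule borel_measurable_integrable) (rule integrable_leb_continuous)

lemma L2_measurable: "f \<in> L2_interval l \<Longrightarrow> f \<in> borel_measurable (leb l)"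
  and L2_square_integrable: "f \<in> L2_interval l \<Longrightarrow> integrable (leb l) (\<lambda>x. (cmod (f x))\<^sup>2)"
  by (auto simp: L2_interval_def)

lemma L2_continuous: "continuous_on {0..l} f \<Longrightarrow> f \<in> L2_interval l"
  unfolding L2_interval_def
  by (auto intro!: measurable_leb_continuous integrable_leb_continuous continuous_intros)

lemma L2_mult_integrable:
  assumes "f \<in> L2_interval l" "g \<in> L2_interval l"
  shows "integrable (leb l) (\<lambda>x. f x * g x)"
proof (rule Bochner_Integration.integrable_bound)
  show "integrable (leb l) (\<lambda>x. (cmod (f x))\<^sup>2 + (cmod (g x))\<^sup>2)"
    using assms by (intro Bochner_Integration.integrable_add L2_square_integrable)
  show "(\<lambda>x. f x * g x) \<in> borel_measurable (leb l)"
    using assms[THEN L2_measurable] by (intro borel_measurable_times)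
  have "cmod (f x * g x) \<le> (cmod (f x))\<^sup>2 + (cmod (g x))\<^sup>2" for x
  proof -
    have "0 \<le> cmod (f x) * cmod (g x)" by simp
    then show ?thesis using sum_squares_bound[of "cmod (f x)" "cmod (g x)"] unfolding norm_mult by linarith
  qed
  then show "AE x in leb l. norm (f x * g x) \<le> norm ((cmod (f x))\<^sup>2 + (cmod (g x))\<^sup>2)" by simp
qed

lemma L2_cnj: "f \<in> L2_interval l \<Longrightarrow> (\<lambda>x. cnj (f x)) \<in> L2_interval l"
proof -
  assume f: "f \<in> L2_interval l"
  have "cnj \<in> borel_measurable borel" by (intro borel_measurable_continuous_onI continuous_intros)
  from measurable_compose[OF L2_measurable[OF f] this] show ?thesis using f by (simp add: L2_interval_def)
qed

lemma L2_scale: "f \<in> L2_interval l \<Longrightarrow> (\<lambda>x. c * f x) \<in> L2_interval l"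
  by (auto simp: L2_interval_def norm_mult power_mult_distrib)

lemma L2_add:
  assumes "f \<in> L2_interval l" "g \<in> L2_interval l"
  shows "(\<lambda>x. f x + g x) \<in> L2_interval l"
proof -
  have "integrable (leb l) (\<lambda>x. (cmod (f x + g x))\<^sup>2)"
  proof (rule Bochner_Integration.integrable_bound)
    show "integrable (leb l) (\<lambda>x. 2 * (cmod (f x))\<^sup>2 + 2 * (cmod (g x))\<^sup>2)"
      using assms by (intro Bochner_Integration.integrable_add integrable_mult_right L2_square_integrable)
    show "(\<lambda>x. (cmod (f x + g x))\<^sup>2) \<in> borel_measurable (leb l)"
      using assms[THEN L2_measurable] by measurable
    have "(cmod (f x + g x))\<^sup>2 \<le> 2 * (cmod (f x))\<^sup>2 + 2 * (cmod (g x))\<^sup>2" for x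
    proof -
      have "(cmod (f x + g x))\<^sup>2 \<le> (cmod (f x) + cmod (g x))\<^sup>2" by (intro power_mono norm_triangle_ineq) simp
      also have "\<dots> \<le> 2 * (cmod (f x))\<^sup>2 + 2 * (cmod (g x))\<^sup>2"
        using sum_squares_bound[of "cmod (f x)" "cmod (g x)"] by (simp add: power2_sum)
      finally show ?thesis .
    qed
    then show "AE x in leb l. norm ((cmod (f x + g x))\<^sup>2) \<le> norm (2 * (cmod (f x))\<^sup>2 + 2 * (cmod (g x))\<^sup>2)" by simp
  qed
  then show ?thesis using assms[THEN L2_measurable] by (auto simp: L2_interval_def)
qed

lemma L2_diff:
  assumes "f \<in> L2_interval l" "g \<in> L2_interval l" shows "(\<lambda>x. f x - g x) \<in> L2_interval l"
  using L2_add[OF assms(1) L2_scale[OF assms(2), of "-1"]] by simp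

lemma L2_integrable: "f \<in> L2_interval l \<Longrightarrow> integrable (leb l) f"
  using L2_mult_integrable[OF _ L2_continuous[of l "\<lambda>_. 1"], of f] by simp

lemma L2_norm: "f \<in> L2_interval l \<Longrightarrow> (\<lambda>x. complex_of_real (cmod (f x))) \<in> L2_interval l"
  by (auto simp: L2_interval_def)

lemma L2_subinterval:
  assumes "f \<in> L2_interval l" "0 \<le> x" "y \<le> l"
  shows "f integrable_on {x..y}" "(\<lambda>x. cmod (f x)) integrable_on {x..y}" "(\<lambda>x. (cmod (f x))\<^sup>2) integrable_on {x..y}"
  using assms by (auto intro!: integrable_on_leb L2_integrable L2_square_integrable integrable_norm)

text \<open>Nonnegativity of the variance: integrate the squared distance of \<open>g\<close> from
  its mean \<open>c\<close> over the interval.\<close>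

lemma L2_integral_bound:
  assumes g: "g \<in> L2_interval l" and xy: "0 \<le> x" "x \<le> y" "y \<le> l"
  shows "(cmod (integral {x..y} g))\<^sup>2 \<le> (y - x) * integral {x..y} (\<lambda>s. (cmod (g s))\<^sup>2)"
proof (cases "x = y")
  case False
  define d where "d = y - x" 
  have d: "d > 0" using False xy by (simp add: d_def)
  define c where "c = integral {x..y} g / of_real d"
  have eq: "(cmod (g s - c))\<^sup>2 = (cmod (g s))\<^sup>2 - 2 * Re (cnj c * g s) + (cmod c)\<^sup>2" for s
    unfolding cmod_power2 by (simp add: power2_eq_square algebra_simps)
  note gi = L2_subinterval[OF g xy(1,3)]
  have "bounded_linear (\<lambda>z. Re (cnj c * z))"
    by (intro bounded_linear_compose[OF bounded_linear_Re bounded_linear_mult_right])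
  from has_integral_linear[OF integrable_integral[OF gi(1)] this]
  have "((\<lambda>s. 2 * Re (cnj c * g s)) has_integral 2 * Re (cnj c * integral {x..y} g)) {x..y}"
    by (intro has_integral_mult_right) (simp add: o_def)
  from has_integral_add[OF has_integral_diff[OF integrable_integral[OF gi(3)] this] has_integral_const_real[of "(cmod c)\<^sup>2" x y]]
  have "((\<lambda>s. (cmod (g s - c))\<^sup>2) has_integral
      integral {x..y} (\<lambda>s. (cmod (g s))\<^sup>2) - 2 * Re (cnj c * integral {x..y} g) + (cmod c)\<^sup>2 * d) {x..y}"
    using xy by (simp add: eq d_def mult.commute)
  from has_integral_nonneg[OF this]
  have "0 \<le> integral {x..y} (\<lambda>s. (cmod (g s))\<^sup>2) - 2 * Re (cnj c * integral {x..y} g) + (cmod c)\<^sup>2 * d" by simp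
  also have "Re (cnj c * integral {x..y} g) = (cmod c)\<^sup>2 * d"
  proof -
    have "integral {x..y} g = c * of_real d" using d by (simp add: c_def)
    then have "cnj c * integral {x..y} g = of_real ((cmod c)\<^sup>2 * d)" by (simp add: complex_norm_square mult_ac del: of_real_power)
    then show ?thesis by simp
  qed
  finally have le: "(cmod c)\<^sup>2 * d \<le> integral {x..y} (\<lambda>s. (cmod (g s))\<^sup>2)" by (simp add: mult.commute)
  have "(cmod (integral {x..y} g))\<^sup>2 = d * ((cmod c)\<^sup>2 * d)"
    using d by (simp add: c_def norm_divide power_divide power2_eq_square)
  then show ?thesis using mult_left_mono[OF le, of d] d by (simp add: d_def)
qed (use xy in simp)

lemma L2_integral_bound':
  assumes g: "g \<in> L2_interval l" and xy: "0 \<le> x" "x \<le> y" "y \<le> l"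
  shows "cmod (integral {x..y} g) \<le> sqrt (y - x) * sqrt (integral {0..l} (\<lambda>s. (cmod (g s))\<^sup>2))"
    "integral {x..y} (\<lambda>s. cmod (g s)) \<le> sqrt (y - x) * sqrt (integral {0..l} (\<lambda>s. (cmod (g s))\<^sup>2))"
proof -
  have *: "cmod (integral {x..y} h) \<le> sqrt (y - x) * sqrt (integral {0..l} (\<lambda>s. (cmod (h s))\<^sup>2))" if h: "h \<in> L2_interval l" for h
  proof -
    have "integral {x..y} (\<lambda>s. (cmod (h s))\<^sup>2) \<le> integral {0..l} (\<lambda>s. (cmod (h s))\<^sup>2)"
      by (rule integral_subset_le) (use xy L2_subinterval[OF h] in auto)
    then have "(y - x) * integral {x..y} (\<lambda>s. (cmod (h s))\<^sup>2) \<le> (y - x) * integral {0..l} (\<lambda>s. (cmod (h s))\<^sup>2)"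
      using xy by (intro mult_left_mono) auto
    with L2_integral_bound[OF h xy] have "(cmod (integral {x..y} h))\<^sup>2 \<le> (y - x) * integral {0..l} (\<lambda>s. (cmod (h s))\<^sup>2)" by linarith
    then show ?thesis by (simp flip: real_sqrt_mult add: real_le_rsqrt)
  qed
  show "cmod (integral {x..y} g) \<le> sqrt (y - x) * sqrt (integral {0..l} (\<lambda>s. (cmod (g s))\<^sup>2))" by (rule *[OF g])
  have "integral {x..y} (\<lambda>s. complex_of_real (cmod (g s))) = of_real (integral {x..y} (\<lambda>s. cmod (g s)))"
    using integral_linear[OF L2_subinterval(2)[OF g xy(1,3)] bounded_linear_of_real] by (simp add: o_def)
  with *[OF L2_norm[OF g]] show "integral {x..y} (\<lambda>s. cmod (g s)) \<le> sqrt (y - x) * sqrt (integral {0..l} (\<lambda>s. (cmod (g s))\<^sup>2))"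
    by simp
qed

text \<open>For \<open>g\<close> in L2 this says that \<open>f\<close> is absolutely continuous with
  derivative \<open>g\<close>. It is the working substitute for weak derivatives: it holds
  pointwise, passes to limits and restricts to subintervals.\<close>

definition primitive_on :: "real \<Rightarrow> (real \<Rightarrow> complex) \<Rightarrow> (real \<Rightarrow> complex) \<Rightarrow> bool" where
  "primitive_on l f g \<longleftrightarrow> (\<forall>x y. 0 \<le> x \<longrightarrow> x \<le> y \<longrightarrow> y \<le> l \<longrightarrow> f y - f x = integral {x..y} g)"

lemma primitive_onD: "\<lbrakk>primitive_on l f g; 0 \<le> x; x \<le> y; y \<le> l\<rbrakk> \<Longrightarrow> f y - f x = integral {x..y} g"
  by (auto simp: primitive_on_def)

lemma primitive_on_integral:
  assumes "g \<in> L2_interval l" shows "primitive_on l (\<lambda>x. integral {0..x} g) g"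
  unfolding primitive_on_def
proof (intro allI impI)
  fix x y assume "0 \<le> x" "x \<le> y" "y \<le> l"
  then have "integral {0..x} g + integral {x..y} g = integral {0..y} g"
    by (intro Henstock_Kurzweil_Integration.integral_combine L2_subinterval[OF assms]) auto
  then show "integral {0..y} g - integral {0..x} g = integral {x..y} g" by (simp add: algebra_simps)
qed

lemma primitive_on_Holder:
  assumes f: "primitive_on l f g" and g: "g \<in> L2_interval l" and x: "x \<in> {0..l}" and y: "y \<in> {0..l}"
  shows "cmod (f y - f x) \<le> sqrt \<bar>y - x\<bar> * sqrt (integral {0..l} (\<lambda>s. (cmod (g s))\<^sup>2))"
proof (cases "x \<le> y")
  case True then show ?thesis using L2_integral_bound'(1)[OF g, of x y] primitive_onD[OF f, of x y] x y by simp
next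
  case False then show ?thesis using L2_integral_bound'(1)[OF g, of y x] primitive_onD[OF f, of y x] x y
    by (simp add: norm_minus_commute)
qed

lemma primitive_on_continuous:
  assumes f: "primitive_on l f g" and g: "g \<in> L2_interval l"
  shows "continuous_on {0..l} f"
  unfolding continuous_on_def
proof
  fix x assume x: "x \<in> {0..l}"
  have "((\<lambda>y. f y - f x) \<longlongrightarrow> 0) (at x within {0..l})"
  proof (rule Lim_null_comparison)
    show "\<forall>\<^sub>F y in at x within {0..l}. norm (f y - f x) \<le> sqrt \<bar>y - x\<bar> * sqrt (integral {0..l} (\<lambda>s. (cmod (g s))\<^sup>2))"
      using primitive_on_Holder[OF f g x] by (auto simp: eventually_at_filter)
    show "((\<lambda>y. sqrt \<bar>y - x\<bar> * sqrt (integral {0..l} (\<lambda>s. (cmod (g s))\<^sup>2))) \<longlongrightarrow> 0) (at x within {0..l})"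
      by (auto intro!: tendsto_eq_intros)
  qed
  then show "(f \<longlongrightarrow> f x) (at x within {0..l})" by (simp add: LIM_zero_iff)
qed

text \<open>
  As a function of the upper end point, the difference of both sides varies by at most a constant
  times \<open>\<bar>z - y\<bar>\<close> to the power 3/2, and is therefore constant.
\<close>

lemma integration_by_parts_primitive:
  assumes f: "primitive_on l f g" and g: "g \<in> L2_interval l"
    and \<eta>: "\<And>x. x \<in> {0..l} \<Longrightarrow> (\<eta> has_vector_derivative \<eta>' x) (at x within {0..l})"
    and \<eta>': "continuous_on {0..l} \<eta>'" and ab: "0 \<le> a" "a \<le> b" "b \<le> l"
  shows "((\<lambda>x. f x * \<eta>' x + g x * \<eta> x) has_integral f b * \<eta> b - f a * \<eta> a) {a..b}"
proof -
  have fc: "continuous_on {0..l} f" by (rule primitive_on_continuous[OF f g])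
  have \<eta>c: "continuous_on {0..l} \<eta>" by (rule continuous_on_vector_derivative[OF \<eta>])
  have prods: "(\<lambda>x. f x * \<eta>' x) \<in> L2_interval l" "\<eta> \<in> L2_interval l"
    by (auto intro!: L2_continuous continuous_intros fc \<eta>' \<eta>c)
  define h where "h x = f x * \<eta>' x + g x * \<eta> x" for x
  have hi: "integrable (leb l) h"
    unfolding h_def by (intro Bochner_Integration.integrable_add L2_integrable[OF prods(1)] L2_mult_integrable[OF g prods(2)])
  note hi' = integrable_on_leb(1)[OF hi]
  have \<eta>F: "(\<eta>' has_integral \<eta> y - \<eta> x) {x..y}" if "0 \<le> x" "x \<le> y" "y \<le> l" for x y
    by (rule fundamental_theorem_of_calculus) (use that in \<open>auto intro: has_vector_derivative_within_subset[OF \<eta>]\<close>)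
  obtain C where C: "\<And>x. x \<in> {0..l} \<Longrightarrow> cmod (\<eta>' x) \<le> C" "C \<ge> 0"
  proof -
    have "bounded (\<eta>' ` {0..l})" by (intro compact_imp_bounded compact_continuous_image \<eta>' compact_Icc)
    then obtain C where "\<forall>x\<in>{0..l}. cmod (\<eta>' x) \<le> C" by (auto simp: bounded_iff)
    then show ?thesis using that[of "max C 0"] by (simp add: le_max_iff_disj)
  qed
  have \<eta>L: "cmod (\<eta> y - \<eta> x) \<le> C * (y - x)" if "0 \<le> x" "x \<le> y" "y \<le> l" for x y
    using has_integral_bound_real[OF C(2) finite.emptyI \<eta>F[OF that]] C(1) that by auto
  define G where "G = sqrt (integral {0..l} (\<lambda>s. (cmod (g s))\<^sup>2))"
  have G: "0 \<le> G" unfolding G_def by (simp add: integral_nonneg L2_subinterval[OF g])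
  define P where "P z = f z * \<eta> z - integral {0..z} h" for z
  have step: "cmod (P z - P y) \<le> 2 * C * G * ((z - y) * sqrt (z - y))" if yz: "0 \<le> y" "y \<le> z" "z \<le> l" for y z
  proof -
    have hz: "integral {0..z} h = integral {0..y} h + integral {y..z} h"
      by (rule Henstock_Kurzweil_Integration.integral_combine[symmetric]) (use yz hi' in auto)
    \<comment> \<open>Freezing \<open>\<eta>\<close> at \<open>z\<close> and \<open>f\<close> at
      \<open>y\<close> writes the increment of \<open>P\<close> as an integral of differences. The
      first is at most of order \<open>z - y\<close>, the second of order
      \<open>sqrt (z - y)\<close>, which gives the power 3/2.\<close>
    let ?k = "\<lambda>s. g s * (\<eta> z - \<eta> s) + (f y - f s) * \<eta>' s"
    have "((\<lambda>s. g s * \<eta> z + f y * \<eta>' s - h s) has_integral (f z - f y) * \<eta> z + f y * (\<eta> z - \<eta> y) - integral {y..z} h) {y..z}"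
      unfolding primitive_onD[OF f yz]
      by (intro has_integral_add has_integral_diff has_integral_mult_left has_integral_mult_right \<eta>F yz integrable_integral hi' L2_subinterval[OF g])
    then have I: "(?k has_integral P z - P y) {y..z}"
      by (simp add: P_def h_def hz algebra_simps)
    have "cmod (P z - P y) = cmod (integral {y..z} ?k)" by (simp add: integral_unique[OF I])
    also have "\<dots> \<le> integral {y..z} (\<lambda>s. cmod (g s) * (C * (z - y)) + G * sqrt (z - y) * C)"
    proof (rule integral_norm_bound_integral)
      fix s assume s: "s \<in> {y..z}"
      have "cmod (\<eta> z - \<eta> s) \<le> C * (z - s)" using s yz by (intro \<eta>L) auto
      also have "\<dots> \<le> C * (z - y)" using s C by (intro mult_left_mono) auto
      finally have 1: "cmod (g s * (\<eta> z - \<eta> s)) \<le> cmod (g s) * (C * (z - y))" by (simp add: norm_mult mult_left_mono)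
      have "cmod (f y - f s) \<le> sqrt \<bar>y - s\<bar> * G" unfolding G_def
        using s yz by (intro primitive_on_Holder[OF f g]) auto
      also have "\<dots> \<le> sqrt (z - y) * G" using s G by (intro mult_right_mono) auto
      finally have 2: "cmod ((f y - f s) * \<eta>' s) \<le> G * sqrt (z - y) * C"
        using C s yz G unfolding norm_mult by (intro mult_mono) (auto simp: mult.commute)
      show "cmod (g s * (\<eta> z - \<eta> s) + (f y - f s) * \<eta>' s) \<le> cmod (g s) * (C * (z - y)) + G * sqrt (z - y) * C"
        using 1 2 norm_triangle_ineq[of "g s * (\<eta> z - \<eta> s)" "(f y - f s) * \<eta>' s"] by linarith
    next
      show "(\<lambda>s. cmod (g s) * (C * (z - y)) + G * sqrt (z - y) * C) integrable_on {y..z}"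
        using yz by (intro Henstock_Kurzweil_Integration.integrable_add integrable_on_mult_left L2_subinterval[OF g] integrable_const_ivl)
    qed (use I in blast)
    also have "\<dots> = integral {y..z} (\<lambda>s. cmod (g s)) * (C * (z - y)) + G * sqrt (z - y) * C * (z - y)"
      using yz by (subst Henstock_Kurzweil_Integration.integral_add) (auto intro!: integrable_on_mult_left L2_subinterval[OF g])
    also have "\<dots> \<le> sqrt (z - y) * G * (C * (z - y)) + G * sqrt (z - y) * C * (z - y)"
      unfolding G_def using C yz by (intro add_right_mono mult_right_mono L2_integral_bound'(2)[OF g]) auto
    finally show ?thesis by (simp add: algebra_simps)
  qed
  have step': "cmod (P z - P y) \<le> 2 * C * G * (\<bar>z - y\<bar> * sqrt \<bar>z - y\<bar>)" if "y \<in> {0..l}" "z \<in> {0..l}" for y z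
    using step[of y z] step[of z y] that by (cases "y \<le> z") (auto simp: norm_minus_commute)
  have "\<exists>c. \<forall>x\<in>{0..l}. P x = c"
  proof (rule has_derivative_zero_constant)
    fix x assume x: "x \<in> {0..l}"
    have "((\<lambda>y. (P y - P x) /\<^sub>R norm (y - x)) \<longlongrightarrow> 0) (at x within {0..l})"
    proof (rule Lim_null_comparison)
      show "\<forall>\<^sub>F y in at x within {0..l}. norm ((P y - P x) /\<^sub>R norm (y - x)) \<le> 2 * C * G * sqrt \<bar>y - x\<bar>"
        unfolding eventually_at_filter
      proof (intro always_eventually allI impI)
        fix y assume "y \<noteq> x" "y \<in> {0..l}"
        then show "norm ((P y - P x) /\<^sub>R norm (y - x)) \<le> 2 * C * G * sqrt \<bar>y - x\<bar>"
        proof -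
          have "norm ((P y - P x) /\<^sub>R norm (y - x)) = cmod (P y - P x) / \<bar>y - x\<bar>"
            by (simp add: divide_inverse mult.commute)
          also have "\<dots> \<le> (2 * C * G * (\<bar>y - x\<bar> * sqrt \<bar>y - x\<bar>)) / \<bar>y - x\<bar>"
            by (intro divide_right_mono step' x \<open>y \<in> {0..l}\<close>) simp
          also have "\<dots> = 2 * C * G * sqrt \<bar>y - x\<bar>" using \<open>y \<noteq> x\<close> by simp
          finally show ?thesis .
        qed
      qed
      show "((\<lambda>y. 2 * C * G * sqrt \<bar>y - x\<bar>) \<longlongrightarrow> 0) (at x within {0..l})"
        by (auto intro!: tendsto_eq_intros)
    qed
    then show "(P has_derivative (\<lambda>h. 0)) (at x within {0..l})"
      by (simp add: has_derivative_within inverse_eq_divide)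
  qed simp
  then have "P a = P b" using ab by auto
  moreover have hb: "integral {0..b} h = integral {0..a} h + integral {a..b} h"
    by (rule Henstock_Kurzweil_Integration.integral_combine[symmetric]) (use ab hi' in auto)
  ultimately have "f a * \<eta> a = f b * \<eta> b - integral {a..b} h" unfolding P_def hb
    by (metis add_diff_cancel_left' diff_add_cancel diff_diff_eq)
  then have "integral {a..b} h = f b * \<eta> b - f a * \<eta> a" by simp
  with integrable_integral[OF hi'[of a b]] ab show ?thesis by (simp add: h_def[abs_def])
qed

section \<open>Weak derivatives as antiderivatives, and completeness of L2\<close>

lemma test_function_properties:
  assumes "\<phi> \<in> test_functions l"
  shows "\<phi> 0 = 0" "\<phi> l = 0" "(\<phi> has_real_derivative deriv \<phi> x) (at x)" "continuous_on S \<phi>" "continuous_on S (deriv \<phi>)"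
proof -
  obtain a b where ab: "0 < a" "b < l" "\<And>x. x \<notin> {a..b} \<Longrightarrow> \<phi> x = 0" and s: "smooth_on UNIV \<phi>"
    using assms by (auto simp: test_functions_def)
  then show "\<phi> 0 = 0" "\<phi> l = 0" by auto
  show D: "(\<phi> has_real_derivative deriv \<phi> x) (at x)" for x by (rule smooth_on_UNIV_deriv[OF s])
  show "continuous_on S (deriv \<phi>)" by (rule smooth_on_UNIV_deriv[OF s])
  show "continuous_on S \<phi>" by (rule DERIV_continuous_on[OF has_field_derivative_at_within[OF D]])
qed

lemma L2_times_continuous:
  assumes "g \<in> L2_interval l" "continuous_on {0..l} \<phi>"
  shows "integrable (leb l) (\<lambda>x. g x * of_real (\<phi> x))"
  by (rule L2_mult_integrable[OF assms(1)]) (auto intro!: L2_continuous continuous_intros assms(2))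

lemma primitive_on_imp_weak_deriv:
  assumes l: "0 < l" and f: "primitive_on l f g" and g: "g \<in> L2_interval l"
  shows "has_weak_deriv l f g"
  unfolding has_weak_deriv_def
proof
  fix \<phi> assume "\<phi> \<in> test_functions l"
  note \<phi> = test_function_properties[OF this]
  have fL: "f \<in> L2_interval l" by (rule L2_continuous[OF primitive_on_continuous[OF f g]])
  have i: "integrable (leb l) (\<lambda>x. f x * of_real (deriv \<phi> x))" "integrable (leb l) (\<lambda>x. g x * of_real (\<phi> x))"
    by (intro L2_times_continuous fL g \<phi>)+
  have "((\<lambda>x. f x * of_real (deriv \<phi> x) + g x * of_real (\<phi> x)) has_integral f l * of_real (\<phi> l) - f 0 * of_real (\<phi> 0)) {0..l}"
  proof (rule integration_by_parts_primitive[OF f g])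
    show "((\<lambda>x. of_real (\<phi> x)) has_vector_derivative complex_of_real (deriv \<phi> x)) (at x within {0..l})" for x
      by (rule has_vector_derivative_of_real) (use \<phi>(3) in \<open>auto simp: has_real_derivative_iff_has_vector_derivative intro: has_vector_derivative_at_within\<close>)
    show "continuous_on {0..l} (\<lambda>x. complex_of_real (deriv \<phi> x))" by (intro continuous_intros \<phi>)
  qed (use l in auto)
  then have "integral {0..l} (\<lambda>x. f x * of_real (deriv \<phi> x) + g x * of_real (\<phi> x)) = 0"
    by (simp add: \<phi> integral_unique)
  then have "integral\<^sup>L (leb l) (\<lambda>x. f x * of_real (deriv \<phi> x) + g x * of_real (\<phi> x)) = 0"
    by (subst integral_leb) (auto intro!: i)
  then show "(\<integral>x. f x * of_real (deriv \<phi> x) \<partial>leb l) = - (\<integral>x. g x * of_real (\<phi> x) \<partial>leb l)"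
    by (subst (asm) Bochner_Integration.integral_add) (auto intro!: i simp: eq_neg_iff_add_eq_0)
qed

lemma continuous_zero_of_integrals:
  fixes H :: "real \<Rightarrow> complex"
  assumes H: "continuous_on {0<..<l} H" and 0: "\<And>a b. \<lbrakk>0 < a; a < b; b < l\<rbrakk> \<Longrightarrow> integral {a..b} H = 0"
    and y: "y \<in> {0<..<l}"
  shows "H y = 0"
proof -
  let ?a = "y / 2" and ?b = "(y + l) / 2"
  have ab: "0 < ?a" "?a < y" "y < ?b" "?b < l" using y by auto
  have "((\<lambda>u. integral {?a..u} H) has_vector_derivative H y) (at y within {?a..?b})"
    by (rule integral_has_vector_derivative) (use ab in \<open>auto intro: continuous_on_subset[OF H]\<close>)
  moreover have "at y within {?a..?b} = at y" by (rule at_within_interior) (use ab in auto)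
  ultimately have "((\<lambda>u. integral {?a..u} H) has_vector_derivative H y) (at y)" by simp
  then have "((\<lambda>u. 0) has_vector_derivative H y) (at y)"
    by (rule has_vector_derivative_transform_within_open[of _ _ _ "{?a<..<?b}"]) (use ab 0 in auto)
  then show "H y = 0" using vector_derivative_unique_at[of "\<lambda>_. 0" "H y" y 0] by simp
qed

text \<open>The du Bois-Reymond argument. Any bump minus the right multiple of a fixed bump has mean
  zero and so is the derivative of a test function; hence \<open>F\<close> minus a constant
  integrates to 0 against every bump. Letting bumps tend to indicators gives vanishing integrals
  over all intervals.\<close>

lemma weak_deriv_zero_constant:
  fixes F :: "real \<Rightarrow> complex"
  assumes F: "continuous_on {0..l} F" and l: "0 < l" and w: "has_weak_deriv l F (\<lambda>_. 0)"
  shows "\<exists>c. \<forall>x\<in>{0..l}. F x = c"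
proof -
  define b2 where "b2 = bump (l / 4) (3 * l / 4) 1 0 0"
  have b2: "bump_comb b2" unfolding b2_def by (rule bump_comb.bump) simp
  note cont = bump_comb_continuous
  define m where "m = integral {0..l} b2"
  have "b2 (l / 2) \<noteq> 0" using l by (simp add: b2_def bump_def)
  then have "m \<noteq> 0" unfolding m_def
    using integral_eq_0_iff[OF cont[OF b2, of "{0..l}"] l] l bump_nonneg by (fastforce simp: b2_def)
  \<comment> \<open>The candidate constant: the mean of \<open>F\<close> with respect to the fixed
    bump \<open>b2\<close>.\<close>
  define c0 where "c0 = integral {0..l} (\<lambda>x. F x * of_real (b2 x)) / of_real m"
  define H where "H x = F x - c0" for x
  have Hc: "continuous_on {0..l} H" unfolding H_def by (intro continuous_intros F)
  have of_real_int: "integral {0..l} (\<lambda>x. complex_of_real (h x)) = of_real (integral {0..l} h)"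
    if "continuous_on {0..l} h" for h
    using integral_linear[OF integrable_continuous_interval[OF that] bounded_linear_of_real] by (simp add: o_def)
  have key: "integral {0..l} (\<lambda>x. H x * of_real (bump a b c 0 0 x)) = 0" if ab: "0 < a" "a < b" "b < l" and c: "0 < c" for a b c
  proof -
    define b1 where "b1 = bump a b c 0 0"
    have b1: "bump_comb b1" unfolding b1_def by (rule bump_comb.bump[OF c])
    define r where "r = integral {0..l} b1 / m"
    define \<beta> where "\<beta> x = b1 x - r * b2 x" for x
    have \<beta>: "bump_comb \<beta>" unfolding \<beta>_def by (intro bump_comb_diff bump_comb.scale b1 b2)
    \<comment> \<open>The support has to contain that of the given bump and that of
      \<open>b2\<close>, which lies between \<open>l / 4\<close> and
      \<open>3 * l / 4\<close>.\<close>
    define a' where "a' = min a (l / 4)"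
    define b' where "b' = max b (3 * l / 4)"
    have ab': "0 < a'" "a' \<le> b'" "b' < l" using ab l by (auto simp: a'_def b'_def)
    have out: "\<beta> x = 0" if "x \<notin> {a'..b'}" for x
      using that by (auto simp: \<beta>_def b1_def b2_def bump_def a'_def b'_def)
    have "integral {0..l} \<beta> = integral {0..l} b1 - r * integral {0..l} b2"
      unfolding \<beta>_def by (subst Henstock_Kurzweil_Integration.integral_diff)
        (auto intro!: integrable_continuous_interval continuous_intros cont b1 b2 bump_comb.scale)
    then have "integral {0..l} \<beta> = 0" using \<open>m \<noteq> 0\<close> by (simp add: r_def m_def)
    moreover have "integral {a'..b'} \<beta> = integral {0..l} \<beta>"
      by (rule integral_spike_set) (rule negligible_subset[of "{}"], use out ab' in auto)+
    ultimately have int0: "integral {a'..b'} \<beta> = 0" by simp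
    define \<phi> where "\<phi> x = (if a' \<le> x then integral {a'..x} \<beta> else 0)" for x
    have \<phi>: "\<phi> \<in> test_functions l" "deriv \<phi> = \<beta>"
      using test_functionI_primitive[OF \<beta> ab' out int0] by (simp_all add: \<phi>_def[abs_def])
    have "(\<integral>x. F x * of_real (deriv \<phi> x) \<partial>leb l) = 0"
      using w \<phi>(1) by (auto simp: has_weak_deriv_def)
    moreover have "(\<integral>x. F x * of_real (deriv \<phi> x) \<partial>leb l) = integral {0..l} (\<lambda>x. F x * of_real (\<beta> x))"
      unfolding \<phi>(2) by (intro integral_leb integrable_leb_continuous continuous_intros F cont \<beta>)
    ultimately have "0 = integral {0..l} (\<lambda>x. F x * of_real (\<beta> x))" by simp
    also have "\<dots> = integral {0..l} (\<lambda>x. F x * of_real (b1 x) - of_real r * (F x * of_real (b2 x)))"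
      by (simp add: \<beta>_def algebra_simps)
    also have "\<dots> = integral {0..l} (\<lambda>x. F x * of_real (b1 x)) - of_real r * integral {0..l} (\<lambda>x. F x * of_real (b2 x))"
      by (subst Henstock_Kurzweil_Integration.integral_diff)
        (auto intro!: integrable_continuous_interval continuous_intros cont b1 b2 F)
    also have "of_real r * integral {0..l} (\<lambda>x. F x * of_real (b2 x)) = c0 * of_real (integral {0..l} b1)"
      using \<open>m \<noteq> 0\<close> by (simp add: r_def c0_def)
    also have "\<dots> = integral {0..l} (\<lambda>x. c0 * of_real (b1 x))"
      by (simp add: of_real_int cont b1)
    also have "integral {0..l} (\<lambda>x. F x * of_real (b1 x)) - \<dots> = integral {0..l} (\<lambda>x. H x * of_real (b1 x))"
      by (subst Henstock_Kurzweil_Integration.integral_diff[symmetric])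
        (auto intro!: integrable_continuous_interval continuous_intros cont b1 F simp: H_def algebra_simps)
    finally show ?thesis by (simp add: b1_def)
  qed
  have int: "integral {a..b} H = 0" if ab: "0 < a" "a < b" "b < l" for a b
  proof -
    \<comment> \<open>The parameter \<open>c\<close> of the bumps tends to 0; they stay below 1, so
      \<open>cmod (H x)\<close> dominates.\<close>
    have "(\<lambda>k. integral {0..l} (\<lambda>x. H x * of_real (bump a b (1 / real (Suc k)) 0 0 x))) \<longlonglongrightarrow>
        integral {0..l} (\<lambda>x. if x \<in> {a<..<b} then H x else 0)"
    proof (rule dominated_convergence(2))
      show "(\<lambda>x. H x * of_real (bump a b (1 / real (Suc k)) 0 0 x)) integrable_on {0..l}" for k
        by (intro integrable_continuous_interval continuous_intros Hc cont bump_comb.bump) simp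
      show "(\<lambda>x. cmod (H x)) integrable_on {0..l}"
        by (intro integrable_continuous_interval continuous_intros Hc)
      show "cmod (H x * of_real (bump a b (1 / real (Suc k)) 0 0 x)) \<le> cmod (H x)" for k x
      proof -
        have "bump a b (1 / real (Suc k)) 0 0 x \<le> 1" 
        proof -
          have "bump a b c 0 0 x \<le> 1" if "0 < c" for c
          proof (cases "a < x \<and> x < b")
            case True
            then have "0 \<le> c * inverse (x - a)" "0 \<le> c * inverse (b - x)" using that by simp_all
            then have "- (c * inverse (x - a)) - c * inverse (b - x) \<le> 0" by linarith
            then show ?thesis using True by (simp add: bump_def)
          qed (auto simp: bump_def)
          then show ?thesis by simp
        qed
        then show ?thesis using bump_nonneg[of a b "1 / real (Suc k)" 0 0 x] by (simp add: norm_mult mult_left_le)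
      qed
      show "(\<lambda>k. H x * of_real (bump a b (1 / real (Suc k)) 0 0 x)) \<longlonglongrightarrow> (if x \<in> {a<..<b} then H x else 0)" for x
      proof (cases "x \<in> {a<..<b}")
        case True
        have "(\<lambda>k. 1 / real (Suc k)) \<longlonglongrightarrow> 0" by (rule LIMSEQ_Suc[OF lim_1_over_n])
        then have "(\<lambda>k. H x * of_real (exp (- (1 / real (Suc k) * inverse (x - a)) - 1 / real (Suc k) * inverse (b - x))))
            \<longlonglongrightarrow> H x * of_real (exp (- (0 * inverse (x - a)) - 0 * inverse (b - x)))"
          by (intro tendsto_intros)
        then show ?thesis using True by (simp add: bump_def)
      qed (auto simp: bump_def)
    qed
    moreover have "(\<lambda>k. integral {0..l} (\<lambda>x. H x * of_real (bump a b (1 / real (Suc k)) 0 0 x))) = (\<lambda>k. 0)"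
      using key[OF ab] by simp
    ultimately have "integral {0..l} (\<lambda>x. if x \<in> {a<..<b} then H x else 0) = 0"
      by (simp add: LIMSEQ_const_iff)
    moreover have "integral {0..l} (\<lambda>x. if x \<in> {a<..<b} then H x else 0) = integral {a<..<b} H"
    proof -
      have "{a<..<b} \<inter> {0..l} = {a<..<b}" using ab by auto
      then show ?thesis using integral_restrict_Int[of "{0..l}" "{a<..<b}" H] by simp
    qed
    ultimately show ?thesis by (simp add: integral_open_interval_real)
  qed
  have "H x = 0" if "x \<in> {0<..<l}" for x
    by (rule continuous_zero_of_integrals[OF continuous_on_subset[OF Hc] int that]) auto
  then have "F x = c0" if "x \<in> {0..l}" for x
    using continuous_constant_on_closure[of "{0<..<l}" H 0 x] Hc l that by (simp add: H_def)
  then show ?thesis by blast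
qed

text \<open>Subtracting the antiderivative of \<open>g\<close> from \<open>f\<close> leaves a
  continuous function with weak derivative 0, which is constant.\<close>

lemma weak_deriv_iff_primitive:
  assumes l: "0 < l" and f: "continuous_on {0..l} f" and g: "g \<in> L2_interval l"
  shows "has_weak_deriv l f g \<longleftrightarrow> primitive_on l f g"
proof
  assume w: "has_weak_deriv l f g"
  define p where "p x = integral {0..x} g" for x
  have p: "primitive_on l p g" unfolding p_def by (rule primitive_on_integral[OF g])
  have pw: "has_weak_deriv l p g" by (rule primitive_on_imp_weak_deriv[OF l p g])
  have pc: "continuous_on {0..l} p" by (rule primitive_on_continuous[OF p g])
  have "has_weak_deriv l (\<lambda>x. f x - p x) (\<lambda>_. 0)"
    unfolding has_weak_deriv_def
  proof
    fix \<phi> assume \<phi>: "\<phi> \<in> test_functions l"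
    note c = test_function_properties[OF \<phi>]
    have "(\<integral>x. (f x - p x) * of_real (deriv \<phi> x) \<partial>leb l) =
       (\<integral>x. f x * of_real (deriv \<phi> x) - p x * of_real (deriv \<phi> x) \<partial>leb l)"
      by (simp add: algebra_simps)
    also have "\<dots> = (\<integral>x. f x * of_real (deriv \<phi> x) \<partial>leb l) - (\<integral>x. p x * of_real (deriv \<phi> x) \<partial>leb l)"
      by (intro Bochner_Integration.integral_diff L2_times_continuous c L2_continuous f pc)
    also have "\<dots> = 0" using w pw \<phi> by (simp add: has_weak_deriv_def)
    finally show "(\<integral>x. (f x - p x) * of_real (deriv \<phi> x) \<partial>leb l) = - (\<integral>x. 0 * of_real (\<phi> x) \<partial>leb l)" by simp
  qed
  from weak_deriv_zero_constant[OF continuous_on_diff[OF f pc] l this]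
  obtain c where c: "\<And>x. x \<in> {0..l} \<Longrightarrow> f x - p x = c" by blast
  show "primitive_on l f g" unfolding primitive_on_def
  proof (intro allI impI)
    fix x y assume xy: "0 \<le> x" "x \<le> y" "y \<le> l"
    then have "f y - f x = p y - p x" using c[of x] c[of y] by (simp add: algebra_simps)
    then show "f y - f x = integral {x..y} g" using primitive_onD[OF p xy] by simp
  qed
qed (rule primitive_on_imp_weak_deriv[OF l _ g])

text \<open>Lebesgue differentiation: almost every value of \<open>d\<close> is a limit of averages
  over intervals to the right of the point, and these averages are 0.\<close>

lemma AE_zero_of_integrals:
  assumes d: "integrable (leb l) d" and 0: "\<And>x y. \<lbrakk>0 \<le> x; x \<le> y; y \<le> l\<rbrakk> \<Longrightarrow> integral {x..y} d = (0::complex)"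
  shows "AE x in leb l. d x = 0"
proof -
  define d' where "d' x = (if x \<in> {0..l} then d x else 0)" for x
  have "d' absolutely_integrable_on UNIV"
    using d unfolding d'_def integrable_leb_iff by (simp only: absolutely_integrable_restrict_UNIV)
  then have d'i: "d' integrable_on cbox a b" for a b
    by (meson absolutely_integrable_on_def absolutely_integrable_on_subcbox subset_UNIV)
  obtain N where N: "negligible N" "\<And>x e. \<lbrakk>x \<notin> N; 0 < e\<rbrakk> \<Longrightarrow> \<exists>r>0. \<forall>h. 0 < h \<and> h < r \<longrightarrow>
     norm (integral (cbox x (x + h *\<^sub>R One)) d' /\<^sub>R h ^ DIM(real) - d' x) < e"
    using integrable_ccontinuous_explicit[of d', OF d'i] by blast
  have z: "d x = 0" if x: "x \<in> {0<..<l}" "x \<notin> N" for x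
  proof (rule ccontr)
    assume "d x \<noteq> 0"
    then obtain r where r: "r > 0" "\<And>h. 0 < h \<Longrightarrow> h < r \<Longrightarrow> norm (integral {x..x + h} d' /\<^sub>R h - d' x) < cmod (d x)"
      using N(2)[OF x(2), of "cmod (d x)"] by auto
    define h where "h = min (r / 2) (l - x)"
    have h: "0 < h" "h < r" "x + h \<le> l" using r x by (auto simp: h_def)
    have "integral {x..x + h} d' = integral {x..x + h} d"
      by (rule integral_cong) (use x h in \<open>auto simp: d'_def\<close>)
    also have "\<dots> = 0" using x h by (intro 0) auto
    finally show False using r(2)[OF h(1,2)] x by (simp add: d'_def)
  qed
  have "AE x in lebesgue. x \<notin> N" using N(1) by (auto simp: negligible_iff_null_sets intro: AE_not_in)
  then have "AE x in lebesgue. x \<in> {0<..<l} \<longrightarrow> d x = 0" by (rule AE_mp) (use z in auto)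
  then show ?thesis by (simp add: AE_restrict_space_iff)
qed

text \<open>This makes the arbitrary choice in \<open>weak_deriv\<close> immaterial up to null
  sets.\<close>

lemma primitive_on_unique:
  assumes "primitive_on l f g" "primitive_on l f h" and g: "g \<in> L2_interval l" and h: "h \<in> L2_interval l"
  shows "AE x in leb l. g x = h x"
proof -
  have "AE x in leb l. g x - h x = 0"
  proof (rule AE_zero_of_integrals)
    show "integrable (leb l) (\<lambda>x. g x - h x)" by (intro Bochner_Integration.integrable_diff L2_integrable g h)
    show "integral {x..y} (\<lambda>x. g x - h x) = 0" if "0 \<le> x" "x \<le> y" "y \<le> l" for x y
      using that assms(1,2)[THEN primitive_onD, OF that]
      by (subst Henstock_Kurzweil_Integration.integral_diff) (auto intro: L2_subinterval g h)
  qed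
  then show ?thesis by simp
qed

lemma primitive_on_add:
  assumes "primitive_on l f g" "primitive_on l f' g'" "g \<in> L2_interval l" "g' \<in> L2_interval l"
  shows "primitive_on l (\<lambda>x. f x + f' x) (\<lambda>x. g x + g' x)"
  unfolding primitive_on_def
proof (intro allI impI)
  fix x y assume xy: "0 \<le> x" "x \<le> y" "y \<le> l"
  show "f y + f' y - (f x + f' x) = integral {x..y} (\<lambda>x. g x + g' x)"
    unfolding Henstock_Kurzweil_Integration.integral_add[OF L2_subinterval(1)[OF assms(3) xy(1,3)] L2_subinterval(1)[OF assms(4) xy(1,3)]]
      primitive_onD[OF assms(1) xy, symmetric] primitive_onD[OF assms(2) xy, symmetric] by simp
qed

lemma primitive_on_scale:
  assumes "primitive_on l f g" shows "primitive_on l (\<lambda>x. c * f x) (\<lambda>x. c * g x)"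
  using assms unfolding primitive_on_def by (simp flip: right_diff_distrib)

lemma primitive_on_cong:
  assumes "primitive_on l f g" "\<And>x. x \<in> {0..l} \<Longrightarrow> f' x = f x" shows "primitive_on l f' g"
  using assms unfolding primitive_on_def by force

lemma zero_primitive: "(\<lambda>_. 0) \<in> L2_interval l \<and> primitive_on l (\<lambda>_. c) (\<lambda>_. 0)"
  by (auto simp: primitive_on_def intro: L2_continuous)

text \<open>The Riesz-Fischer argument for functions rather than classes. Finite length turns
  L2-Cauchy into L1-Cauchy, which yields a subsequence converging almost everywhere; Fatou's lemma
  then bounds the L2 distance to its limit.\<close>

lemma L2_complete:
  assumes g: "\<And>n::nat. g n \<in> L2_interval l" and l: "0 < l"
    and cauchy: "\<And>e. 0 < e \<Longrightarrow> \<exists>N. \<forall>m\<ge>N. \<forall>n\<ge>N. (\<integral>x. (cmod (g m x - g n x))\<^sup>2 \<partial>leb l) < e"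
  obtains v where "v \<in> L2_interval l" "(\<lambda>n. \<integral>x. (cmod (g n x - v x))\<^sup>2 \<partial>leb l) \<longlonglongrightarrow> 0"
proof -
  have sq: "integrable (leb l) (\<lambda>x. (cmod (g m x - g n x))\<^sup>2)" for m n
    by (rule L2_square_integrable[OF L2_diff[OF g g]])
  have L1: "\<exists>N. \<forall>i\<ge>N. \<forall>j\<ge>N. (LINT x|leb l. cmod (g i x - g j x)) < e" if e: "0 < e" for e
  proof -
    obtain N where N: "\<And>m n. \<lbrakk>m \<ge> N; n \<ge> N\<rbrakk> \<Longrightarrow> (\<integral>x. (cmod (g m x - g n x))\<^sup>2 \<partial>leb l) < e\<^sup>2 / l"
      using cauchy[of "e\<^sup>2 / l"] e l by auto
    have "(LINT x|leb l. cmod (g i x - g j x)) < e" if "i \<ge> N" "j \<ge> N" for i j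
    proof -
      have d: "(\<lambda>x. g i x - g j x) \<in> L2_interval l" by (intro L2_diff g)
      have "(LINT x|leb l. cmod (g i x - g j x)) = integral {0..l} (\<lambda>x. cmod (g i x - g j x))"
        by (intro integral_leb integrable_norm L2_integrable d)
      also have "\<dots> \<le> sqrt l * sqrt (integral {0..l} (\<lambda>x. (cmod (g i x - g j x))\<^sup>2))"
        using L2_integral_bound'(2)[OF d, of 0 l] l by simp
      also have "\<dots> < sqrt l * sqrt (e\<^sup>2 / l)"
        using N[OF that] l by (subst (asm) integral_leb[OF sq]) (simp add: real_sqrt_less_iff)
      also have "\<dots> = e" using e l by (simp add: real_sqrt_divide)
      finally show ?thesis .
    qed
    then show ?thesis by blast
  qed
  obtain r where r: "strict_mono r" and rc: "AE x in leb l. Cauchy (\<lambda>i. g (r i) x)"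
    using cauchy_L1_AE_cauchy_subseq[of "leb l" g, OF L2_integrable[OF g] L1] by blast
  define v where "v x = lim (\<lambda>i. g (r i) x)" for x
  have vm: "v \<in> borel_measurable (leb l)"
    unfolding v_def by (intro borel_measurable_lim_metric L2_measurable g)
  have conv: "AE x in leb l. (\<lambda>i. g (r i) x) \<longlonglongrightarrow> v x"
    using rc by (rule AE_mp) (auto simp: v_def Cauchy_convergent_iff convergent_LIMSEQ_iff)
  have dm: "(\<lambda>x. g n x - v x) \<in> borel_measurable (leb l)" for n
    using L2_measurable[OF g] vm by (intro borel_measurable_diff)
  have bound: "integrable (leb l) (\<lambda>x. (cmod (g n x - v x))\<^sup>2) \<and> (\<integral>x. (cmod (g n x - v x))\<^sup>2 \<partial>leb l) \<le> e"
    if e: "0 < e" and N: "\<And>m n. \<lbrakk>m \<ge> N; n \<ge> N\<rbrakk> \<Longrightarrow> (\<integral>x. (cmod (g m x - g n x))\<^sup>2 \<partial>leb l) < e" and n: "n \<ge> N" for e n N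
  proof -
    have "(\<integral>\<^sup>+x. ennreal ((cmod (g n x - v x))\<^sup>2) \<partial>leb l) =
        (\<integral>\<^sup>+x. liminf (\<lambda>i. ennreal ((cmod (g n x - g (r i) x))\<^sup>2)) \<partial>leb l)"
    proof (rule nn_integral_cong_AE, rule AE_mp[OF conv], rule AE_I2, rule impI)
      fix x assume "(\<lambda>i. g (r i) x) \<longlonglongrightarrow> v x"
      then have "(\<lambda>i. ennreal ((cmod (g n x - g (r i) x))\<^sup>2)) \<longlonglongrightarrow> ennreal ((cmod (g n x - v x))\<^sup>2)"
        by (intro tendsto_ennrealI tendsto_intros)
      from lim_imp_Liminf[OF _ this]
      show "ennreal ((cmod (g n x - v x))\<^sup>2) = liminf (\<lambda>i. ennreal ((cmod (g n x - g (r i) x))\<^sup>2))" by simp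
    qed
    also have "\<dots> \<le> liminf (\<lambda>i. \<integral>\<^sup>+x. ennreal ((cmod (g n x - g (r i) x))\<^sup>2) \<partial>leb l)"
      using sq by (intro nn_integral_liminf measurable_compose[OF borel_measurable_integrable measurable_ennreal])
    also have "\<dots> \<le> ennreal e"
    proof (rule Liminf_le)
      have "\<forall>\<^sub>F i in sequentially. i \<ge> N" by (rule eventually_ge_at_top)
      then show "\<forall>\<^sub>F i in sequentially. (\<integral>\<^sup>+x. ennreal ((cmod (g n x - g (r i) x))\<^sup>2) \<partial>leb l) \<le> ennreal e"
      proof (rule eventually_mono)
        fix i assume "i \<ge> N"
        then have "r i \<ge> N" using seq_suble[OF r, of i] by linarith
        from N[OF n this] show "(\<integral>\<^sup>+x. ennreal ((cmod (g n x - g (r i) x))\<^sup>2) \<partial>leb l) \<le> ennreal e"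
          by (subst nn_integral_eq_integral[OF sq]) (auto intro: ennreal_leI)
      qed
    qed simp
    finally have le: "(\<integral>\<^sup>+x. ennreal ((cmod (g n x - v x))\<^sup>2) \<partial>leb l) \<le> ennreal e" .
    have int: "integrable (leb l) (\<lambda>x. (cmod (g n x - v x))\<^sup>2)"
      using dm[of n] le by (intro integrableI_nonneg) (auto simp: order_le_less_trans[OF le])
    with le e show ?thesis by (subst (asm) nn_integral_eq_integral) (auto simp: ennreal_le_iff)
  qed
  have "v \<in> L2_interval l"
  proof -
    obtain N where N: "\<And>m n. \<lbrakk>m \<ge> N; n \<ge> N\<rbrakk> \<Longrightarrow> (\<integral>x. (cmod (g m x - g n x))\<^sup>2 \<partial>leb l) < 1"
      using cauchy[of 1] by auto
    have "(\<lambda>x. g N x - v x) \<in> L2_interval l"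
      using bound[of 1 N N, OF _ N] dm[of N] by (auto simp: L2_interval_def)
    from L2_diff[OF g[of N] this] show ?thesis by simp
  qed
  moreover have "(\<lambda>n. \<integral>x. (cmod (g n x - v x))\<^sup>2 \<partial>leb l) \<longlonglongrightarrow> 0"
  proof (rule LIMSEQ_I)
    fix e :: real assume e: "0 < e"
    then have e2: "0 < e / 2" by simp
    obtain N where N: "\<And>m n. \<lbrakk>m \<ge> N; n \<ge> N\<rbrakk> \<Longrightarrow> (\<integral>x. (cmod (g m x - g n x))\<^sup>2 \<partial>leb l) < e / 2"
      using cauchy[OF e2] by auto
    have "norm ((\<integral>x. (cmod (g n x - v x))\<^sup>2 \<partial>leb l) - 0) < e" if "n \<ge> N" for n
      using bound[OF e2 N that] e by (simp add: integral_nonneg_AE)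
    then show "\<exists>N. \<forall>n\<ge>N. norm ((\<integral>x. (cmod (g n x - v x))\<^sup>2 \<partial>leb l) - 0) < e" by blast
  qed
  ultimately show ?thesis by (rule that)
qed

section \<open>Sharp energy estimates on an interval by hyperbolic functions\<close>

lemma helmholtz_energy:
  fixes \<eta> \<eta>' :: "real \<Rightarrow> real"
  assumes \<eta>: "\<And>x. (\<eta> has_real_derivative \<eta>' x) (at x)" "\<And>x. (\<eta>' has_real_derivative k\<^sup>2 * \<eta> x) (at x)" and ab: "a \<le> b"
  shows "((\<lambda>x. (\<eta>' x)\<^sup>2 + k\<^sup>2 * (\<eta> x)\<^sup>2) has_integral \<eta> b * \<eta>' b - \<eta> a * \<eta>' a) {a..b}"
proof (rule fundamental_theorem_of_calculus[OF ab])
  fix x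
  have "((\<lambda>x. \<eta> x * \<eta>' x) has_real_derivative (\<eta>' x)\<^sup>2 + k\<^sup>2 * (\<eta> x)\<^sup>2) (at x)"
    using DERIV_mult[OF \<eta>(1)[of x] \<eta>(2)[of x]] by (auto elim!: DERIV_cong simp: power2_eq_square algebra_simps)
  then show "((\<lambda>x. \<eta> x * \<eta>' x) has_vector_derivative (\<eta>' x)\<^sup>2 + k\<^sup>2 * (\<eta> x)\<^sup>2) (at x within {a..b})"
    by (simp add: has_real_derivative_iff_has_vector_derivative has_vector_derivative_at_within)
qed

lemma energy_integrable:
  assumes f: "primitive_on l f g" and g: "g \<in> L2_interval l" and "0 \<le> a" "b \<le> l"
  shows "(\<lambda>x. (cmod (g x))\<^sup>2 + k\<^sup>2 * (cmod (f x))\<^sup>2) integrable_on {a..b}"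
  using assms L2_continuous[OF primitive_on_continuous[OF f g]]
  by (intro Henstock_Kurzweil_Integration.integrable_add integrable_on_mult_right L2_subinterval)

text \<open>Completing the square: the energy of \<open>f - z * \<eta>\<close> is nonnegative. Since
  \<open>\<eta>\<close> solves the Helmholtz equation, both the mixed term and its own energy reduce
  to boundary values, whatever \<open>f\<close> does in between.\<close>

lemma helmholtz_bound:
  fixes \<eta> \<eta>' :: "real \<Rightarrow> real"
  assumes f: "primitive_on l f g" and g: "g \<in> L2_interval l" and ab: "0 \<le> a" "a \<le> b" "b \<le> l"
    and \<eta>: "\<And>x. (\<eta> has_real_derivative \<eta>' x) (at x)" "\<And>x. (\<eta>' has_real_derivative k\<^sup>2 * \<eta> x) (at x)"
  shows "2 * Re (cnj z * (f b * \<eta>' b - f a * \<eta>' a)) - (cmod z)\<^sup>2 * (\<eta> b * \<eta>' b - \<eta> a * \<eta>' a)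
    \<le> integral {a..b} (\<lambda>x. (cmod (g x))\<^sup>2 + k\<^sup>2 * (cmod (f x))\<^sup>2)"
proof -
  have "((\<lambda>x. f x * of_real (k\<^sup>2 * \<eta> x) + g x * of_real (\<eta>' x)) has_integral f b * of_real (\<eta>' b) - f a * of_real (\<eta>' a)) {a..b}"
  proof (rule integration_by_parts_primitive[OF f g _ _ ab])
    show "((\<lambda>x. of_real (\<eta>' x)) has_vector_derivative complex_of_real (k\<^sup>2 * \<eta> x)) (at x within {0..l})" for x
      by (rule has_vector_derivative_of_real)
        (use \<eta>(2) in \<open>auto simp: has_real_derivative_iff_has_vector_derivative intro: has_vector_derivative_at_within\<close>)
    have "continuous_on {0..l} \<eta>" by (rule DERIV_continuous_on[OF has_field_derivative_at_within[OF \<eta>(1)]])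
    then show "continuous_on {0..l} (\<lambda>x. complex_of_real (k\<^sup>2 * \<eta> x))" by (intro continuous_intros)
  qed
  from has_integral_linear[OF this bounded_linear_compose[OF bounded_linear_Re bounded_linear_mult_right[of "cnj z"]]]
  have "((\<lambda>x. 2 * Re (cnj z * (f x * of_real (k\<^sup>2 * \<eta> x) + g x * of_real (\<eta>' x)))) has_integral
      2 * Re (cnj z * (f b * \<eta>' b - f a * \<eta>' a))) {a..b}"
    by (intro has_integral_mult_right) (simp add: o_def)
  from has_integral_add[OF has_integral_diff[OF integrable_integral[OF energy_integrable[OF f g ab(1,3), of k]] this]
    has_integral_mult_right[OF helmholtz_energy[OF \<eta> ab(2)], of "(cmod z)\<^sup>2"]]
  have I: "((\<lambda>x. (cmod (g x))\<^sup>2 + k\<^sup>2 * (cmod (f x))\<^sup>2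
      - 2 * Re (cnj z * (f x * of_real (k\<^sup>2 * \<eta> x) + g x * of_real (\<eta>' x)))
      + (cmod z)\<^sup>2 * ((\<eta>' x)\<^sup>2 + k\<^sup>2 * (\<eta> x)\<^sup>2)) has_integral
    integral {a..b} (\<lambda>x. (cmod (g x))\<^sup>2 + k\<^sup>2 * (cmod (f x))\<^sup>2)
      - 2 * Re (cnj z * (f b * \<eta>' b - f a * \<eta>' a)) + (cmod z)\<^sup>2 * (\<eta> b * \<eta>' b - \<eta> a * \<eta>' a)) {a..b}"
    (is "(?F has_integral _) _") .
  have "?F x = (cmod (g x - z * of_real (\<eta>' x)))\<^sup>2 + k\<^sup>2 * (cmod (f x - z * of_real (\<eta> x)))\<^sup>2" for x
    unfolding cmod_power2 by (simp add: power2_eq_square algebra_simps)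
  then have "0 \<le> ?F x" for x by simp
  from has_integral_nonneg[OF I this] show ?thesis by simp
qed

lemma DERIV_cosh_scaled:
  "((\<lambda>x. cosh (k * (x - a)) / c) has_real_derivative k * sinh (k * (x - a)) / c) (at x)"
  "((\<lambda>x. k * sinh (k * (x - a)) / c) has_real_derivative k\<^sup>2 * (cosh (k * (x - a)) / c)) (at x)"
  "((\<lambda>x. sinh (k * (x - a)) / c) has_real_derivative k * cosh (k * (x - a)) / c) (at x)"
  "((\<lambda>x. k * cosh (k * (x - a)) / c) has_real_derivative k\<^sup>2 * (sinh (k * (x - a)) / c)) (at x)"
  for k a c x :: real
  unfolding divide_inverse by (auto intro!: derivative_eq_intros simp: power2_eq_square)

text \<open>The comparison function is a cosh normalised to 1 at the end in question, with slope 0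
  at the other end. The far end then contributes no boundary term, so \<open>f\<close> may be
  arbitrary there.\<close>

lemma leg_bound:
  assumes f: "primitive_on l f g" and g: "g \<in> L2_interval l" and ab: "0 \<le> a" "a \<le> b" "b \<le> l"
  shows "k * tanh (k * (b - a)) * (cmod (f a))\<^sup>2 \<le> integral {a..b} (\<lambda>x. (cmod (g x))\<^sup>2 + k\<^sup>2 * (cmod (f x))\<^sup>2)"
    "k * tanh (k * (b - a)) * (cmod (f b))\<^sup>2 \<le> integral {a..b} (\<lambda>x. (cmod (g x))\<^sup>2 + k\<^sup>2 * (cmod (f x))\<^sup>2)"
proof -
  define d where "d = k * (b - a)"
  have key: "T * (cmod z)\<^sup>2 \<le> integral {a..b} (\<lambda>x. (cmod (g x))\<^sup>2 + k\<^sup>2 * (cmod (f x))\<^sup>2)"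
    if "\<And>x. (\<eta> has_real_derivative \<eta>' x) (at x)" "\<And>x. (\<eta>' has_real_derivative k\<^sup>2 * \<eta> x) (at x)"
      "\<eta> b * \<eta>' b - \<eta> a * \<eta>' a = T" "f b * \<eta>' b - f a * \<eta>' a = z * of_real T" for \<eta> \<eta>' T z
  proof -
    have "Re (cnj z * (z * of_real T)) = (cmod z)\<^sup>2 * T"
      unfolding cmod_power2 by (simp add: power2_eq_square algebra_simps)
    then show ?thesis using helmholtz_bound[OF f g ab that(1,2), of z] that(3,4) by (simp add: mult.commute)
  qed
  have m: "k * (a - b) = - d" and d: "k * (b - a) = d" by (simp_all add: d_def algebra_simps)
  show "k * tanh (k * (b - a)) * (cmod (f a))\<^sup>2 \<le> integral {a..b} (\<lambda>x. (cmod (g x))\<^sup>2 + k\<^sup>2 * (cmod (f x))\<^sup>2)"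
    by (rule key[OF DERIV_cosh_scaled(1,2)[of k b "cosh d"]]) (simp_all add: m d tanh_def)
  show "k * tanh (k * (b - a)) * (cmod (f b))\<^sup>2 \<le> integral {a..b} (\<lambda>x. (cmod (g x))\<^sup>2 + k\<^sup>2 * (cmod (f x))\<^sup>2)"
    by (rule key[OF DERIV_cosh_scaled(1,2)[of k a "cosh d"]]) (simp_all add: m d tanh_def)
qed

text \<open>Trial functions have a kink, where \<open>g\<close> jumps. The single exceptional point
  affects neither the fundamental theorem nor the energy integral, which is therefore the sum of two
  boundary expressions.\<close>

lemma glued_primitive:
  fixes \<eta>1 \<eta>1' \<eta>2 \<eta>2' :: "real \<Rightarrow> real"
  assumes \<eta>1: "\<And>x. (\<eta>1 has_real_derivative \<eta>1' x) (at x)" "\<And>x. (\<eta>1' has_real_derivative k\<^sup>2 * \<eta>1 x) (at x)"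
    and \<eta>2: "\<And>x. (\<eta>2 has_real_derivative \<eta>2' x) (at x)" "\<And>x. (\<eta>2' has_real_derivative k\<^sup>2 * \<eta>2 x) (at x)"
    and eq: "\<eta>1 x0 = \<eta>2 x0" and x0: "0 \<le> x0" "x0 \<le> l"
  defines "f \<equiv> \<lambda>x. complex_of_real (if x \<le> x0 then \<eta>1 x else \<eta>2 x)"
    and "g \<equiv> \<lambda>x. complex_of_real (if x \<le> x0 then \<eta>1' x else \<eta>2' x)"
  shows "g \<in> L2_interval l" "primitive_on l f g"
    "integral {0..l} (\<lambda>x. (cmod (g x))\<^sup>2 + k\<^sup>2 * (cmod (f x))\<^sup>2) =
      (\<eta>1 x0 * \<eta>1' x0 - \<eta>1 0 * \<eta>1' 0) + (\<eta>2 l * \<eta>2' l - \<eta>2 x0 * \<eta>2' x0)"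
proof -
  have cont: "continuous_on S \<eta>1" "continuous_on S \<eta>2" "continuous_on S \<eta>1'" "continuous_on S \<eta>2'" for S
    by (rule DERIV_continuous_on[OF has_field_derivative_at_within], rule \<eta>1 \<eta>2)+
  have gm: "g \<in> borel_measurable borel"
  proof -
    have [measurable]: "\<eta>1' \<in> borel_measurable borel" "\<eta>2' \<in> borel_measurable borel"
      by (intro borel_measurable_continuous_onI cont)+
    show ?thesis unfolding g_def by measurable
  qed
  then have "g \<in> borel_measurable lborel" by simp
  from measurable_restrict_space1[OF measurable_completion[OF this]]
  have gm': "g \<in> borel_measurable (leb l)" .
  have sq: "integrable (leb l) (\<lambda>x. (cmod (g x))\<^sup>2)"
  proof (rule Bochner_Integration.integrable_bound)
    show "integrable (leb l) (\<lambda>x. (\<eta>1' x)\<^sup>2 + (\<eta>2' x)\<^sup>2)"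
      by (intro integrable_leb_continuous continuous_intros cont)
    show "(\<lambda>x. (cmod (g x))\<^sup>2) \<in> borel_measurable (leb l)" using gm' by measurable
  qed (auto simp: g_def)
  show g: "g \<in> L2_interval l" using gm' sq by (simp add: L2_interval_def)
  have fc: "continuous_on S f" for S
  proof -
    have "continuous_on ({x0..} \<union> {..x0}) (\<lambda>x. if x \<le> x0 then \<eta>1 x else \<eta>2 x)"
      unfolding Un_commute[of "{x0..}"] by (rule continuous_on_If) (auto simp: eq intro: cont)
    moreover have "{x0..} \<union> {..x0} = UNIV" by auto
    ultimately have "continuous_on UNIV f" unfolding f_def by (intro continuous_intros) simp
    then show ?thesis by (rule continuous_on_subset) simp
  qed
  have fd: "(f has_vector_derivative g x) (at x)" if "x \<noteq> x0" for x
  proof (cases "x < x0")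
    case True
    have "((\<lambda>x. complex_of_real (\<eta>1 x)) has_vector_derivative of_real (\<eta>1' x)) (at x)"
      by (intro has_vector_derivative_of_real) (use \<eta>1(1) in \<open>simp add: has_real_derivative_iff_has_vector_derivative\<close>)
    then have "(f has_vector_derivative of_real (\<eta>1' x)) (at x)"
      by (rule has_vector_derivative_transform_within_open[of _ _ _ "{..<x0}"]) (use True in \<open>auto simp: f_def\<close>)
    then show ?thesis using True by (simp add: g_def)
  next
    case False
    have "((\<lambda>x. complex_of_real (\<eta>2 x)) has_vector_derivative of_real (\<eta>2' x)) (at x)"
      by (intro has_vector_derivative_of_real) (use \<eta>2(1) in \<open>simp add: has_real_derivative_iff_has_vector_derivative\<close>)
    then have "(f has_vector_derivative of_real (\<eta>2' x)) (at x)"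
      by (rule has_vector_derivative_transform_within_open[of _ _ _ "{x0<..}"]) (use False that in \<open>auto simp: f_def\<close>)
    then show ?thesis using False that by (simp add: g_def)
  qed
  show "primitive_on l f g"
    unfolding primitive_on_def
  proof (intro allI impI)
    fix x y :: real assume "x \<le> y"
    have "(g has_integral f y - f x) {x..y}"
      by (rule fundamental_theorem_of_calculus_interior_strong[of "{x0}"]) (use \<open>x \<le> y\<close> fc fd in auto)
    then show "f y - f x = integral {x..y} g" by (simp add: integral_unique)
  qed
  have "((\<lambda>x. (cmod (g x))\<^sup>2 + k\<^sup>2 * (cmod (f x))\<^sup>2) has_integral \<eta>1 x0 * \<eta>1' x0 - \<eta>1 0 * \<eta>1' 0) {0..x0}"
    by (rule has_integral_eq[OF _ helmholtz_energy[OF \<eta>1 x0(1)]]) (auto simp: f_def g_def)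
  moreover have "((\<lambda>x. (cmod (g x))\<^sup>2 + k\<^sup>2 * (cmod (f x))\<^sup>2) has_integral \<eta>2 l * \<eta>2' l - \<eta>2 x0 * \<eta>2' x0) {x0..l}"
    by (rule has_integral_spike_finite[OF _ _ helmholtz_energy[OF \<eta>2 x0(2)], of "{x0}"]) (auto simp: f_def g_def)
  ultimately show "integral {0..l} (\<lambda>x. (cmod (g x))\<^sup>2 + k\<^sup>2 * (cmod (f x))\<^sup>2) =
      (\<eta>1 x0 * \<eta>1' x0 - \<eta>1 0 * \<eta>1' 0) + (\<eta>2 l * \<eta>2' l - \<eta>2 x0 * \<eta>2' x0)"
    using has_integral_combine[OF x0] by (intro integral_unique) blast
qed

text \<open>A trial function must vanish at the ends to extend by 0, so sinh replaces the cosh of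
  the lower bounds and 1 / tanh replaces tanh. The two energies agree asymptotically as
  \<open>k\<close> grows.\<close>

lemma hat_exists:
  assumes k: "0 < k" and x0: "0 < x0" "x0 < l"
  obtains f g where "g \<in> L2_interval l" "primitive_on l f g" "f 0 = 0" "f x0 = 1" "f l = 0"
    "integral {0..l} (\<lambda>x. (cmod (g x))\<^sup>2 + k\<^sup>2 * (cmod (f x))\<^sup>2) = k / tanh (k * x0) + k / tanh (k * (l - x0))"
proof -
  have m: "k * (x0 - l) = - (k * (l - x0))" by (simp add: algebra_simps)
  have pos: "sinh (k * x0) \<noteq> 0" "sinh (k * (l - x0)) \<noteq> 0" using k x0 by auto
  note glued = glued_primitive[OF DERIV_cosh_scaled(3,4)[of k 0 "sinh (k * x0)"] DERIV_cosh_scaled(3,4)[of k l "sinh (k * (x0 - l))"]]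
  show ?thesis
    by (rule that[OF glued(1,2)[of x0 l]]; (subst glued(3))?; use k x0 pos in \<open>simp add: m tanh_def\<close>)
qed

text \<open>A degenerate gluing at \<open>x0 = l\<close>: the first branch covers the whole
  interval.\<close>

lemma ramp_exists:
  assumes k: "0 < k" and l: "0 < l"
  obtains f g where "g \<in> L2_interval l" "primitive_on l f g" "f 0 = 1" "f l = 0"
    "integral {0..l} (\<lambda>x. (cmod (g x))\<^sup>2 + k\<^sup>2 * (cmod (f x))\<^sup>2) = k / tanh (k * l)"
proof -
  have m: "k * (0 - l) = - (k * l)" by (simp add: algebra_simps)
  have pos: "sinh (k * l) \<noteq> 0" using k l by auto
  note glued = glued_primitive[OF DERIV_cosh_scaled(3,4)[of k l "sinh (k * (0 - l))"] DERIV_cosh_scaled(3,4)[of k l "sinh (k * (0 - l))"]]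
  show ?thesis
    by (rule that[OF glued(1,2)[of l l]]; (subst glued(3))?; use k l pos in \<open>simp add: m tanh_def\<close>)
qed

lemma ramp_exists':
  assumes k: "0 < k" and l: "0 < l"
  obtains f g where "g \<in> L2_interval l" "primitive_on l f g" "f 0 = 0" "f l = 1"
    "integral {0..l} (\<lambda>x. (cmod (g x))\<^sup>2 + k\<^sup>2 * (cmod (f x))\<^sup>2) = k / tanh (k * l)"
proof -
  have pos: "sinh (k * l) \<noteq> 0" using k l by auto
  note glued = glued_primitive[OF DERIV_cosh_scaled(3,4)[of k 0 "sinh (k * l)"] DERIV_cosh_scaled(3,4)[of k 0 "sinh (k * l)"]]
  show ?thesis
    by (rule that[OF glued(1,2)[of l l]]; (subst glued(3))?; use k l pos in \<open>simp add: tanh_def\<close>)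
qed

lemma scaled_tanh_mono: "\<lbrakk>0 \<le> k; x \<le> y\<rbrakk> \<Longrightarrow> k * tanh (k * x) \<le> k * tanh (k * y)" for k x y :: real
  by (intro mult_left_mono) (auto simp: mult_left_mono)

lemma tanh_scaled_tendsto:
  fixes x :: real
  assumes "0 < x" shows "((\<lambda>k. tanh (k * x)) \<longlongrightarrow> 1) at_top"
proof -
  have "filterlim (\<lambda>k. x * k) at_top at_top"
    by (rule filterlim_tendsto_pos_mult_at_top[OF tendsto_const _ filterlim_ident]) (use assms in simp)
  from filterlim_compose[OF tanh_real_at_top this] show ?thesis by (simp add: mult.commute)
qed

section \<open>Forms on a metric graph\<close>

context metric_graph begin

text \<open>Because some arc exists and the graph is connected, a vertex other than its tail has a
  first step on a path to it. Without an incident arc the description in \<open>vertex_value\<close>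
  would not be unique and the degree would be 0.\<close>

lemma incident_arc:
  assumes v: "v \<in> verts G"
  obtains e where "e \<in> arcs G" "tail G e = v \<or> head G e = v"
proof -
  obtain e where e: "e \<in> arcs G" using arcs_nonempty by blast
  show ?thesis
  proof (cases "v = tail G e")
    case False
    have "v \<rightarrow>\<^sup>*\<^bsub>with_proj (mk_symmetric G)\<^esub> tail G e"
      using connected v e unfolding Digraph_Component.connected_def strongly_connected_def by simp
    then have "(v, tail G e) \<in> (arcs_ends (with_proj (mk_symmetric G)))\<^sup>*"
      unfolding reachable_def by (rule rtrancl_on_rtranclI)
    then obtain w where "(v, w) \<in> arcs_ends (with_proj (mk_symmetric G))"
      using False by (auto elim: converse_rtranclE)
    then have "(v, w) \<in> parcs (mk_symmetric G)" by simp
    then show ?thesis using that by (auto simp: mk_symmetric_def)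
  qed (use e that in auto)
qed

abbreviation "\<V> \<equiv> H1_graph G len"
abbreviation D :: "('e \<Rightarrow> real \<Rightarrow> complex) \<Rightarrow> 'e \<Rightarrow> real \<Rightarrow> complex" where "D f e \<equiv> weak_deriv (len e) (f e)"
abbreviation val where "val \<equiv> vertex_value G len"

lemma val_eqI:
  assumes v: "v \<in> verts G" and u: "\<And>e. e \<in> arcs G \<Longrightarrow> f e 0 = u (tail G e) \<and> f e (len e) = u (head G e)"
  shows "val f v = u v"
  unfolding vertex_value_def
proof (rule the_equality)
  fix z assume z: "\<forall>e\<in>arcs G. (tail G e = v \<longrightarrow> f e 0 = z) \<and> (head G e = v \<longrightarrow> f e (len e) = z)"
  obtain e where "e \<in> arcs G" "tail G e = v \<or> head G e = v" using incident_arc[OF v] .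
  then show "z = u v" using z u by metis
qed (use u in auto)

lemma val_ends:
  assumes f: "f \<in> C_graph G len" and e: "e \<in> arcs G"
  shows "f e 0 = val f (tail G e)" "f e (len e) = val f (head G e)"
proof -
  obtain u where "\<And>e. e \<in> arcs G \<Longrightarrow> f e 0 = u (tail G e) \<and> f e (len e) = u (head G e)"
    using f by (auto simp: C_graph_def)
  then show "f e 0 = val f (tail G e)" "f e (len e) = val f (head G e)"
    using val_eqI[of _ f u] e by auto
qed

lemma H1_C: "f \<in> \<V> \<Longrightarrow> f \<in> C_graph G len" by (simp add: H1_graph_def)

lemma H1_continuous: "\<lbrakk>f \<in> \<V>; e \<in> arcs G\<rbrakk> \<Longrightarrow> continuous_on {0..len e} (f e)"
  by (simp add: H1_graph_def C_graph_def)

text \<open>From here on the choice operator behind \<open>D\<close> is hidden: \<open>D\<close> is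
  an L2 function of which \<open>f\<close> is an antiderivative on each edge.\<close>

lemma H1_D:
  assumes f: "f \<in> \<V>" and e: "e \<in> arcs G"
  shows "D f e \<in> L2_interval (len e)" "primitive_on (len e) (f e) (D f e)"
proof -
  have "\<exists>g. g \<in> L2_interval (len e) \<and> has_weak_deriv (len e) (f e) g"
    using f e by (auto simp: H1_graph_def H1_interval_def)
  from someI_ex[OF this] have *: "D f e \<in> L2_interval (len e)" "has_weak_deriv (len e) (f e) (D f e)"
    by (auto simp: weak_deriv_def)
  then show "D f e \<in> L2_interval (len e)" "primitive_on (len e) (f e) (D f e)"
    using weak_deriv_iff_primitive[OF length_pos[OF e] H1_continuous[OF f e]] by auto
qed

lemma H1_L2: "\<lbrakk>f \<in> \<V>; e \<in> arcs G\<rbrakk> \<Longrightarrow> f e \<in> L2_interval (len e)"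
  by (rule L2_continuous[OF H1_continuous])

lemma H1I:
  assumes f: "f \<in> C_graph G len" and g: "\<And>e. e \<in> arcs G \<Longrightarrow> g e \<in> L2_interval (len e) \<and> primitive_on (len e) (f e) (g e)"
  shows "f \<in> \<V>"
proof -
  have "f e \<in> H1_interval (len e)" if e: "e \<in> arcs G" for e
  proof -
    have "has_weak_deriv (len e) (f e) (g e)"
      using g[OF e] primitive_on_imp_weak_deriv[OF length_pos[OF e]] by blast
    moreover have "f e \<in> L2_interval (len e)"
      using f e by (intro L2_continuous) (simp add: C_graph_def)
    ultimately show ?thesis using g[OF e] by (auto simp: H1_interval_def)
  qed
  then show ?thesis using f by (simp add: H1_graph_def)
qed

lemma D_unique:
  assumes "f \<in> \<V>" "e \<in> arcs G" "g \<in> L2_interval (len e)" "primitive_on (len e) (f e) g"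
  shows "AE x in leb (len e). D f e x = g x"
  by (rule primitive_on_unique[OF H1_D(2)[OF assms(1,2)] assms(4) H1_D(1)[OF assms(1,2)] assms(3)])

lemma C_graph_add:
  assumes "f \<in> C_graph G len" "g \<in> C_graph G len" shows "f + g \<in> C_graph G len"
  unfolding C_graph_def
proof (intro CollectI conjI ballI allI impI exI[of _ "\<lambda>v. val f v + val g v"])
  show "continuous_on {0..len e} ((f + g) e)" if "e \<in> arcs G" for e
    using assms that unfolding plus_fun_def by (intro continuous_on_add) (auto simp: C_graph_def)
qed (use assms val_ends in \<open>auto simp: C_graph_def\<close>)

lemma C_graph_scale:
  assumes "f \<in> C_graph G len" shows "scale_fun c f \<in> C_graph G len"
  unfolding C_graph_def
proof (intro CollectI conjI ballI allI impI exI[of _ "\<lambda>v. c * val f v"])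
  show "continuous_on {0..len e} (scale_fun c f e)" if "e \<in> arcs G" for e
    using assms that unfolding scale_fun_def by (intro continuous_intros) (auto simp: C_graph_def)
qed (use assms val_ends in \<open>auto simp: C_graph_def scale_fun_def\<close>)

lemma H1_add:
  assumes "f \<in> \<V>" "g \<in> \<V>" shows "f + g \<in> \<V>"
proof (rule H1I[where g = "\<lambda>e x. D f e x + D g e x"])
  show "f + g \<in> C_graph G len" using assms by (intro C_graph_add H1_C)
  fix e assume e: "e \<in> arcs G"
  show "(\<lambda>x. D f e x + D g e x) \<in> L2_interval (len e) \<and> primitive_on (len e) ((f + g) e) (\<lambda>x. D f e x + D g e x)"
    using assms e primitive_on_add[of "len e" "f e" "D f e" "g e" "D g e"] by (simp add: L2_add H1_D plus_fun_def)
qed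

lemma H1_scale:
  assumes "f \<in> \<V>" shows "scale_fun c f \<in> \<V>"
proof (rule H1I[where g = "\<lambda>e x. c * D f e x"])
  show "scale_fun c f \<in> C_graph G len" using assms by (intro C_graph_scale H1_C)
  fix e assume e: "e \<in> arcs G"
  show "(\<lambda>x. c * D f e x) \<in> L2_interval (len e) \<and> primitive_on (len e) (scale_fun c f e) (\<lambda>x. c * D f e x)"
    using assms e primitive_on_scale by (simp add: L2_scale H1_D scale_fun_def)
qed

lemma H1_zero: "0 \<in> \<V>"
proof (rule H1I[where g = "\<lambda>e x. 0"])
  show "0 \<in> C_graph G len" by (auto simp: C_graph_def zero_fun_def)
  show "(\<lambda>x. 0) \<in> L2_interval (len e) \<and> primitive_on (len e) (0 e) (\<lambda>x. 0)" for e
    by (auto simp: primitive_on_def intro: L2_continuous)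
qed

lemma H1_subspace: "graph_fun.subspace \<V>"
  unfolding graph_fun.subspace_def using H1_zero H1_add H1_scale by blast

lemma D_add:
  assumes "f \<in> \<V>" "g \<in> \<V>" "e \<in> arcs G"
  shows "AE x in leb (len e). D (f + g) e x = D f e x + D g e x"
  using D_unique[OF H1_add[OF assms(1,2)] assms(3), of "\<lambda>x. D f e x + D g e x"]
    primitive_on_add[of "len e" "f e" "D f e" "g e" "D g e"] H1_D assms
  by (simp add: L2_add plus_fun_def)

lemma D_scale:
  assumes "f \<in> \<V>" "e \<in> arcs G"
  shows "AE x in leb (len e). D (scale_fun c f) e x = c * D f e x"
  using D_unique[OF H1_scale[OF assms(1)] assms(2), of "\<lambda>x. c * D f e x" c]
    primitive_on_scale[of "len e" "f e" "D f e" c] H1_D assms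
  by (simp add: L2_scale scale_fun_def)

lemma val_add: "\<lbrakk>f \<in> \<V>; g \<in> \<V>; v \<in> verts G\<rbrakk> \<Longrightarrow> val (f + g) v = val f v + val g v"
  by (rule val_eqI) (auto simp: val_ends H1_C)

lemma val_scale: "\<lbrakk>f \<in> \<V>; v \<in> verts G\<rbrakk> \<Longrightarrow> val (scale_fun c f) v = c * val f v"
  by (rule val_eqI) (auto simp: val_ends H1_C scale_fun_def)

lemma inner_integrable:
  "\<lbrakk>f \<in> \<V>; g \<in> \<V>; e \<in> arcs G\<rbrakk> \<Longrightarrow> integrable (leb (len e)) (\<lambda>x. f e x * cnj (g e x))"
  by (intro L2_mult_integrable L2_cnj H1_L2)

lemma D_integrable:
  "\<lbrakk>f \<in> \<V>; g \<in> \<V>; e \<in> arcs G\<rbrakk> \<Longrightarrow> integrable (leb (len e)) (\<lambda>x. D f e x * cnj (D g e x))"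
  by (intro L2_mult_integrable L2_cnj H1_D)

text \<open>The pointwise identity is required almost everywhere only, since the weak derivative of
  a sum is chosen independently of those of the summands.\<close>

lemma graph_integral_add:
  assumes "\<And>e. e \<in> arcs G \<Longrightarrow> integrable (leb (len e)) (F e)" "\<And>e. e \<in> arcs G \<Longrightarrow> integrable (leb (len e)) (H e)"
    and "\<And>e. e \<in> arcs G \<Longrightarrow> K e \<in> borel_measurable (leb (len e))"
    and "\<And>e. e \<in> arcs G \<Longrightarrow> AE x in leb (len e). K e x = F e x + H e x"
  shows "graph_integral G len K = graph_integral G len F + graph_integral G len H"
  unfolding graph_integral_def sum.distrib[symmetric]
proof (rule sum.cong[OF refl])
  fix e assume e: "e \<in> arcs G"
  have "integral\<^sup>L (leb (len e)) (K e) = (\<integral>x. F e x + H e x \<partial>leb (len e))"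
    using assms(4)[OF e] by (intro integral_cong_AE assms(3)[OF e] borel_measurable_integrable Bochner_Integration.integrable_add assms(1,2)[OF e])
  then show "integral\<^sup>L (leb (len e)) (K e) = integral\<^sup>L (leb (len e)) (F e) + integral\<^sup>L (leb (len e)) (H e)"
    using assms(1,2)[OF e] by simp
qed

lemma graph_integral_scale:
  fixes F :: "'e \<Rightarrow> real \<Rightarrow> complex"
  assumes "\<And>e. e \<in> arcs G \<Longrightarrow> F e \<in> borel_measurable (leb (len e))"
    and "\<And>e. e \<in> arcs G \<Longrightarrow> K e \<in> borel_measurable (leb (len e))"
    and "\<And>e. e \<in> arcs G \<Longrightarrow> AE x in leb (len e). K e x = c * F e x"
  shows "graph_integral G len K = c * graph_integral G len F"
  unfolding graph_integral_def sum_distrib_left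
proof (rule sum.cong[OF refl])
  fix e assume e: "e \<in> arcs G"
  have "(\<lambda>x. c * F e x) \<in> borel_measurable (leb (len e))"
    using assms(1)[OF e] by (intro borel_measurable_times borel_measurable_const)
  then have "integral\<^sup>L (leb (len e)) (K e) = (\<integral>x. c * F e x \<partial>leb (len e))"
    using assms(3)[OF e] by (intro integral_cong_AE assms(2)[OF e])
  then show "integral\<^sup>L (leb (len e)) (K e) = c * integral\<^sup>L (leb (len e)) (F e)" by simp
qed

lemma graph_integral_cnj:
  "graph_integral G len (\<lambda>e x. cnj (F e x)) = cnj (graph_integral G len F)"
  by (simp add: graph_integral_def)

lemma inner_form: "hermitian_form scale_fun \<V> (L2_inner G len)"
proof unfold_locales
  show "graph_fun.subspace \<V>" by (rule H1_subspace)
next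
  fix f g h assume *: "f \<in> \<V>" "g \<in> \<V>" "h \<in> \<V>"
  show "L2_inner G len (f + g) h = L2_inner G len f h + L2_inner G len g h"
    unfolding L2_inner_def
  proof (rule graph_integral_add)
    fix e assume e: "e \<in> arcs G"
    show "(\<lambda>x. (f + g) e x * cnj (h e x)) \<in> borel_measurable (leb (len e))"
      by (intro borel_measurable_integrable inner_integrable H1_add * e)
  qed (use * in \<open>auto intro!: inner_integrable simp: distrib_right\<close>)
next
  fix f h c assume *: "f \<in> \<V>" "h \<in> \<V>"
  show "L2_inner G len (scale_fun c f) h = c * L2_inner G len f h"
    unfolding L2_inner_def
  proof (rule graph_integral_scale)
    fix e assume e: "e \<in> arcs G"
    show "(\<lambda>x. scale_fun c f e x * cnj (h e x)) \<in> borel_measurable (leb (len e))"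
      "(\<lambda>x. f e x * cnj (h e x)) \<in> borel_measurable (leb (len e))"
      by (intro borel_measurable_integrable inner_integrable H1_scale * e)+
  qed (simp add: scale_fun_def)
next
  fix f g
  show "L2_inner G len g f = cnj (L2_inner G len f g)"
    unfolding L2_inner_def graph_integral_cnj[symmetric] by (simp add: mult.commute)
qed

end

locale schroedinger_graph = metric_graph G len for G :: "('v, 'e) pre_digraph" and len +
  fixes q :: "'e \<Rightarrow> real \<Rightarrow> real" and \<sigma> :: "'v \<Rightarrow> real"
  assumes admissible: "admissible_potential G len q"
begin

lemma potential_bound:
  obtains C where "C \<ge> 0" "\<And>e. e \<in> arcs G \<Longrightarrow> AE x in leb (len e). \<bar>q e x\<bar> \<le> C"
proof -
  have "\<forall>e\<in>arcs G. \<exists>C. AE x in leb (len e). \<bar>q e x\<bar> \<le> C"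
    using admissible by (auto simp: admissible_potential_def)
  then obtain C where C: "\<And>e. e \<in> arcs G \<Longrightarrow> AE x in leb (len e). \<bar>q e x\<bar> \<le> C e" by metis
  show ?thesis
  proof (rule that[of "\<Sum>e\<in>arcs G. \<bar>C e\<bar>"])
    fix e assume e: "e \<in> arcs G"
    have le: "C e \<le> (\<Sum>e\<in>arcs G. \<bar>C e\<bar>)" using member_le_sum[of e "arcs G" "\<lambda>e. \<bar>C e\<bar>"] e by simp
    show "AE x in leb (len e). \<bar>q e x\<bar> \<le> (\<Sum>e\<in>arcs G. \<bar>C e\<bar>)"
      by (rule AE_mp[OF C[OF e]]) (use le in auto)
  qed (simp add: sum_nonneg)
qed

text \<open>One bound for all edges is fixed here so that \<open>\<epsilon>\<close> and
  \<open>k0\<close> can be constants of the locale.\<close>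

definition qC :: real where
  "qC = (SOME C. C \<ge> 0 \<and> (\<forall>e\<in>arcs G. AE x in leb (len e). \<bar>q e x\<bar> \<le> C))"

lemma qC: "qC \<ge> 0" "e \<in> arcs G \<Longrightarrow> AE x in leb (len e). \<bar>q e x\<bar> \<le> qC"
proof -
  have "\<exists>C. C \<ge> 0 \<and> (\<forall>e\<in>arcs G. AE x in leb (len e). \<bar>q e x\<bar> \<le> C)"
    using potential_bound by metis
  from someI_ex[OF this] show "qC \<ge> 0" "e \<in> arcs G \<Longrightarrow> AE x in leb (len e). \<bar>q e x\<bar> \<le> qC"
    unfolding qC_def by auto
qed

lemma q_measurable: "e \<in> arcs G \<Longrightarrow> q e \<in> borel_measurable (leb (len e))"
  using admissible by (auto simp: admissible_potential_def)

lemma q_mult_integrable: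
  fixes h :: "real \<Rightarrow> 'a::{banach, second_countable_topology, real_normed_field}"
  assumes e: "e \<in> arcs G" and h: "integrable (leb (len e)) h"
  shows "integrable (leb (len e)) (\<lambda>x. of_real (q e x) * h x)"
proof (rule Bochner_Integration.integrable_bound)
  show "integrable (leb (len e)) (\<lambda>x. qC * norm (h x))" using h by simp
  show "(\<lambda>x. of_real (q e x) * h x) \<in> borel_measurable (leb (len e))"
    using q_measurable[OF e] borel_measurable_integrable[OF h] by measurable
  show "AE x in leb (len e). norm (of_real (q e x) * h x) \<le> norm (qC * norm (h x))"
    by (rule AE_mp[OF qC(2)[OF e]]) (use qC(1) in \<open>auto simp: norm_mult intro!: mult_right_mono\<close>)
qed

abbreviation "form \<equiv> sesquilinear_form G len q \<sigma>"

lemma q_integrable: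
  "\<lbrakk>f \<in> \<V>; g \<in> \<V>; e \<in> arcs G\<rbrakk> \<Longrightarrow> integrable (leb (len e)) (\<lambda>x. of_real (q e x) * f e x * cnj (g e x))"
  using q_mult_integrable[OF _ inner_integrable] by (simp add: mult.assoc)

lemma form_hermitian: "hermitian_form scale_fun \<V> form"
proof unfold_locales
  show "graph_fun.subspace \<V>" by (rule H1_subspace)
next
  fix f g h assume *: "f \<in> \<V>" "g \<in> \<V>" "h \<in> \<V>"
  note fg = H1_add[OF *(1,2)]
  have "graph_integral G len (\<lambda>e x. D (f + g) e x * cnj (D h e x)) =
    graph_integral G len (\<lambda>e x. D f e x * cnj (D h e x)) + graph_integral G len (\<lambda>e x. D g e x * cnj (D h e x))"
  proof (rule graph_integral_add)
    fix e assume e: "e \<in> arcs G"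
    show "AE x in leb (len e). D (f + g) e x * cnj (D h e x) = D f e x * cnj (D h e x) + D g e x * cnj (D h e x)"
      by (rule AE_mp[OF D_add[OF *(1,2) e]]) (simp add: distrib_right)
    show "(\<lambda>x. D (f + g) e x * cnj (D h e x)) \<in> borel_measurable (leb (len e))"
      by (rule borel_measurable_integrable) (rule D_integrable[OF fg *(3) e])
    show "integrable (leb (len e)) (\<lambda>x. D f e x * cnj (D h e x))" "integrable (leb (len e)) (\<lambda>x. D g e x * cnj (D h e x))"
      by (rule D_integrable[OF *(1,3) e], rule D_integrable[OF *(2,3) e])
  qed
  moreover have "graph_integral G len (\<lambda>e x. of_real (q e x) * (f + g) e x * cnj (h e x)) =
    graph_integral G len (\<lambda>e x. of_real (q e x) * f e x * cnj (h e x)) + graph_integral G len (\<lambda>e x. of_real (q e x) * g e x * cnj (h e x))"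
  proof (rule graph_integral_add)
    fix e assume e: "e \<in> arcs G"
    show "(\<lambda>x. of_real (q e x) * (f + g) e x * cnj (h e x)) \<in> borel_measurable (leb (len e))"
      by (rule borel_measurable_integrable) (rule q_integrable[OF fg *(3) e])
    show "integrable (leb (len e)) (\<lambda>x. of_real (q e x) * f e x * cnj (h e x))"
      "integrable (leb (len e)) (\<lambda>x. of_real (q e x) * g e x * cnj (h e x))"
      by (rule q_integrable[OF *(1,3) e], rule q_integrable[OF *(2,3) e])
  qed (simp add: algebra_simps)
  moreover have "(\<Sum>v\<in>verts G. of_real (\<sigma> v) * val (f + g) v * cnj (val h v)) =
    (\<Sum>v\<in>verts G. of_real (\<sigma> v) * val f v * cnj (val h v)) + (\<Sum>v\<in>verts G. of_real (\<sigma> v) * val g v * cnj (val h v))"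
    using * by (simp add: val_add algebra_simps sum.distrib)
  ultimately show "form (f + g) h = form f h + form g h"
    unfolding sesquilinear_form_def by (simp add: algebra_simps)
next
  fix f h c assume *: "f \<in> \<V>" "h \<in> \<V>"
  note cf = H1_scale[OF *(1), of c]
  have "graph_integral G len (\<lambda>e x. D (scale_fun c f) e x * cnj (D h e x)) =
    c * graph_integral G len (\<lambda>e x. D f e x * cnj (D h e x))"
  proof (rule graph_integral_scale)
    fix e assume e: "e \<in> arcs G"
    show "AE x in leb (len e). D (scale_fun c f) e x * cnj (D h e x) = c * (D f e x * cnj (D h e x))"
      by (rule AE_mp[OF D_scale[OF *(1) e, of c]]) simp
    show "(\<lambda>x. D (scale_fun c f) e x * cnj (D h e x)) \<in> borel_measurable (leb (len e))"
      by (rule borel_measurable_integrable) (rule D_integrable[OF cf *(2) e])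
    show "(\<lambda>x. D f e x * cnj (D h e x)) \<in> borel_measurable (leb (len e))"
      by (rule borel_measurable_integrable) (rule D_integrable[OF * e])
  qed
  moreover have "graph_integral G len (\<lambda>e x. of_real (q e x) * scale_fun c f e x * cnj (h e x)) =
    c * graph_integral G len (\<lambda>e x. of_real (q e x) * f e x * cnj (h e x))"
  proof (rule graph_integral_scale)
    fix e assume e: "e \<in> arcs G"
    show "(\<lambda>x. of_real (q e x) * scale_fun c f e x * cnj (h e x)) \<in> borel_measurable (leb (len e))"
      "(\<lambda>x. of_real (q e x) * f e x * cnj (h e x)) \<in> borel_measurable (leb (len e))"
      by (intro borel_measurable_integrable q_integrable cf * e)+
  qed (simp add: scale_fun_def)
  moreover have "(\<Sum>v\<in>verts G. of_real (\<sigma> v) * val (scale_fun c f) v * cnj (val h v)) =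
    c * (\<Sum>v\<in>verts G. of_real (\<sigma> v) * val f v * cnj (val h v))"
    using * by (simp add: val_scale sum_distrib_left mult_ac)
  ultimately show "form (scale_fun c f) h = c * form f h"
    unfolding sesquilinear_form_def by (simp add: algebra_simps)
next
  fix f g
  show "form g f = cnj (form f g)"
    unfolding sesquilinear_form_def complex_cnj_add cnj_sum graph_integral_cnj[symmetric]
    by (simp add: mult_ac)
qed

end

section \<open>Energy bounds for evaluations and smallness of the potential\<close>

context metric_graph begin

definition dirichlet :: "('e \<Rightarrow> real \<Rightarrow> complex) \<Rightarrow> real" where
  "dirichlet f = graph_integral G len (\<lambda>e x. (cmod (D f e x))\<^sup>2)"

definition mass :: "('e \<Rightarrow> real \<Rightarrow> complex) \<Rightarrow> real" where
  "mass f = graph_integral G len (\<lambda>e x. (cmod (f e x))\<^sup>2)"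

definition energy :: "real \<Rightarrow> ('e \<Rightarrow> real \<Rightarrow> complex) \<Rightarrow> real" where
  "energy k f = dirichlet f + k\<^sup>2 * mass f"

definition edge_energy :: "real \<Rightarrow> ('e \<Rightarrow> real \<Rightarrow> complex) \<Rightarrow> 'e \<Rightarrow> real" where
  "edge_energy k f e = integral {0..len e} (\<lambda>x. (cmod (D f e x))\<^sup>2 + k\<^sup>2 * (cmod (f e x))\<^sup>2)"

definition min_len :: real where "min_len = Min (len ` arcs G)"

lemma min_len: "0 < min_len" "e \<in> arcs G \<Longrightarrow> min_len \<le> len e"
  unfolding min_len_def using arcs_nonempty length_pos by (auto simp: Min_gr_iff)

lemma dirichlet_nonneg: "0 \<le> dirichlet f" and mass_nonneg: "0 \<le> mass f"
  unfolding dirichlet_def mass_def graph_integral_def by (auto intro!: sum_nonneg)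

lemma energy_nonneg: "0 \<le> energy k f"
  unfolding energy_def using dirichlet_nonneg mass_nonneg by simp

lemma mass_le_energy: "k\<^sup>2 * mass f \<le> energy k f"
  unfolding energy_def using dirichlet_nonneg by simp

lemma edge_energy_nonneg:
  "\<lbrakk>f \<in> \<V>; e \<in> arcs G\<rbrakk> \<Longrightarrow> 0 \<le> edge_energy k f e"
  unfolding edge_energy_def
  by (intro integral_nonneg energy_integrable[OF H1_D(2,1)]) (use length_pos in auto)

lemma energy_eq_sum:
  assumes f: "f \<in> \<V>" shows "energy k f = (\<Sum>e\<in>arcs G. edge_energy k f e)"
proof -
  have "edge_energy k f e = (\<integral>x. (cmod (D f e x))\<^sup>2 \<partial>leb (len e)) + k\<^sup>2 * (\<integral>x. (cmod (f e x))\<^sup>2 \<partial>leb (len e))"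
    if e: "e \<in> arcs G" for e
  proof -
    note i = L2_square_integrable[OF H1_D(1)[OF f e]] integrable_mult_right[OF L2_square_integrable[OF H1_L2[OF f e]], of "k\<^sup>2"]
    have "edge_energy k f e = (\<integral>x. (cmod (D f e x))\<^sup>2 + k\<^sup>2 * (cmod (f e x))\<^sup>2 \<partial>leb (len e))"
      unfolding edge_energy_def by (rule integral_leb[symmetric]) (intro Bochner_Integration.integrable_add i)
    also have "\<dots> = (\<integral>x. (cmod (D f e x))\<^sup>2 \<partial>leb (len e)) + (\<integral>x. k\<^sup>2 * (cmod (f e x))\<^sup>2 \<partial>leb (len e))"
      by (rule Bochner_Integration.integral_add[OF i])
    finally show ?thesis by simp
  qed
  then show ?thesis
    by (simp add: energy_def dirichlet_def mass_def graph_integral_def sum.distrib sum_distrib_left)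
qed

lemma edge_energy_le:
  assumes "f \<in> \<V>" "e \<in> arcs G" shows "edge_energy k f e \<le> energy k f"
  unfolding energy_eq_sum[OF assms(1)]
  by (rule member_le_sum[of e "arcs G" "edge_energy k f"]) (use assms edge_energy_nonneg in auto)

text \<open>The point cuts its edge into two legs whose far ends are left free; the other edges only
  add energy.\<close>

lemma interior_bound:
  assumes f: "f \<in> \<V>" and e: "e \<in> arcs G" and x: "0 \<le> x" "x \<le> len e"
  shows "(k * tanh (k * x) + k * tanh (k * (len e - x))) * (cmod (f e x))\<^sup>2 \<le> energy k f"
proof -
  note D = H1_D(2,1)[OF f e]
  have "(k * tanh (k * x) + k * tanh (k * (len e - x))) * (cmod (f e x))\<^sup>2 \<le>
      integral {0..x} (\<lambda>x. (cmod (D f e x))\<^sup>2 + k\<^sup>2 * (cmod (f e x))\<^sup>2) +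
      integral {x..len e} (\<lambda>x. (cmod (D f e x))\<^sup>2 + k\<^sup>2 * (cmod (f e x))\<^sup>2)"
    using leg_bound(2)[OF D, of 0 x k] leg_bound(1)[OF D, of x "len e" k] x by (simp add: distrib_right)
  also have "\<dots> = edge_energy k f e"
    unfolding edge_energy_def using x
    by (intro Henstock_Kurzweil_Integration.integral_combine energy_integrable[OF D]) auto
  also have "\<dots> \<le> energy k f" by (rule edge_energy_le[OF f e])
  finally show ?thesis .
qed

text \<open>One of the two legs at a point has at least half the length of the edge. The loss of a
  factor compared with \<open>interior_bound\<close> buys uniformity up to the vertices, as needed
  for sup norms and dominated convergence.\<close>

lemma uniform_bound:
  assumes f: "f \<in> \<V>" and e: "e \<in> arcs G" and x: "x \<in> {0..len e}" and k: "0 \<le> k"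
  shows "k * tanh (k * (min_len / 2)) * (cmod (f e x))\<^sup>2 \<le> energy k f"
proof -
  have pos: "0 \<le> k * tanh (k * x)" "0 \<le> k * tanh (k * (len e - x))" using x k by auto
  have "min_len / 2 \<le> x \<or> min_len / 2 \<le> len e - x" using min_len(2)[OF e] by argo
  then have "k * tanh (k * (min_len / 2)) \<le> k * tanh (k * x) + k * tanh (k * (len e - x))"
  proof
    assume "min_len / 2 \<le> x"
    from scaled_tanh_mono[OF k this] pos(2) show ?thesis by linarith
  next
    assume "min_len / 2 \<le> len e - x"
    from scaled_tanh_mono[OF k this] pos(1) show ?thesis by linarith
  qed
  then have "k * tanh (k * (min_len / 2)) * (cmod (f e x))\<^sup>2 \<le> (k * tanh (k * x) + k * tanh (k * (len e - x))) * (cmod (f e x))\<^sup>2"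
    by (intro mult_right_mono) auto
  also have "\<dots> \<le> energy k f" using x by (intro interior_bound[OF f e]) auto
  finally show ?thesis .
qed

text \<open>Each incident edge is one leg starting at the vertex, so the bound grows with the
  degree. Replacing all lengths by the minimal one does not change the limit for large
  \<open>k\<close>.\<close>

lemma vertex_bound:
  assumes f: "f \<in> \<V>" and k: "0 \<le> k"
  shows "real (vertex_degree G v) * (k * tanh (k * min_len)) * (cmod (val f v))\<^sup>2 \<le> energy k f"
proof -
  let ?I = "{e \<in> arcs G. tail G e = v \<or> head G e = v}"
  have fI: "?I \<subseteq> arcs G" by auto
  have "real (vertex_degree G v) * (k * tanh (k * min_len)) * (cmod (val f v))\<^sup>2 =
      (\<Sum>e\<in>?I. k * tanh (k * min_len) * (cmod (val f v))\<^sup>2)"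
    by (simp add: vertex_degree_def)
  also have "\<dots> \<le> (\<Sum>e\<in>?I. edge_energy k f e)"
  proof (rule sum_mono)
    fix e assume "e \<in> ?I"
    then have e: "e \<in> arcs G" and v: "tail G e = v \<or> head G e = v" by auto
    note D = H1_D(2,1)[OF f e] and l = length_pos[OF e]
    have "k * tanh (k * min_len) * (cmod (val f v))\<^sup>2 \<le> k * tanh (k * len e) * (cmod (val f v))\<^sup>2"
      using scaled_tanh_mono[OF k min_len(2)[OF e]] by (intro mult_right_mono) auto
    also have "\<dots> \<le> edge_energy k f e"
      using leg_bound[OF D, of 0 "len e" k] v val_ends[OF H1_C[OF f] e] l by (auto simp: edge_energy_def)
    finally show "k * tanh (k * min_len) * (cmod (val f v))\<^sup>2 \<le> edge_energy k f e" .
  qed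
  also have "\<dots> \<le> energy k f"
    unfolding energy_eq_sum[OF f] using edge_energy_nonneg[OF f] by (intro sum_mono2) auto
  finally show ?thesis .
qed

lemma vertex_uniform_bound:
  assumes f: "f \<in> \<V>" and v: "v \<in> verts G" and k: "0 \<le> k"
  shows "k * tanh (k * (min_len / 2)) * (cmod (val f v))\<^sup>2 \<le> energy k f"
proof -
  obtain e where e: "e \<in> arcs G" "tail G e = v \<or> head G e = v" using incident_arc[OF v] .
  show ?thesis
    using uniform_bound[OF f e(1) _ k, of 0] uniform_bound[OF f e(1) _ k, of "len e"]
      val_ends[OF H1_C[OF f] e(1)] e(2) length_pos[OF e(1)] by auto
qed

lemma tanh_tendsto: "((\<lambda>k. tanh (k * (min_len / 2))) \<longlongrightarrow> 1) at_top"
  by (rule tanh_scaled_tendsto) (use min_len(1) in simp)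

lemma vertex_degree_pos: "v \<in> verts G \<Longrightarrow> 0 < vertex_degree G v"
  unfolding vertex_degree_def by (subst card_gt_0_iff) (auto elim: incident_arc)

end

context schroedinger_graph begin

definition pot :: "('e \<Rightarrow> real \<Rightarrow> complex) \<Rightarrow> real" where
  "pot f = graph_integral G len (\<lambda>e x. q e x * (cmod (f e x))\<^sup>2) + (\<Sum>v\<in>verts G. \<sigma> v * (cmod (val f v))\<^sup>2)"

lemma quadratic_form_eq: "quadratic_form G len q \<sigma> f = dirichlet f + pot f"
  by (simp add: quadratic_form_def dirichlet_def pot_def)

text \<open>The relative form bound of the perturbation against \<open>energy k\<close>. The first
  term comes from mass being at most energy over \<open>k\<^sup>2\<close>; the second from the
  evaluation bound at the vertices. Both tend to 0.\<close>

definition \<epsilon> :: "real \<Rightarrow> real" where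
  "\<epsilon> k = qC / k\<^sup>2 + (\<Sum>v\<in>verts G. \<bar>\<sigma> v\<bar>) / (k * tanh (k * (min_len / 2)))"

lemma pot_bound:
  assumes f: "f \<in> \<V>" and k: "0 < k"
  shows "\<bar>pot f\<bar> \<le> \<epsilon> k * energy k f"
proof -
  have "\<bar>graph_integral G len (\<lambda>e x. q e x * (cmod (f e x))\<^sup>2)\<bar> \<le> qC * mass f"
  proof -
    have "\<bar>\<integral>x. q e x * (cmod (f e x))\<^sup>2 \<partial>leb (len e)\<bar> \<le> qC * (\<integral>x. (cmod (f e x))\<^sup>2 \<partial>leb (len e))" if e: "e \<in> arcs G" for e
    proof -
      note i = L2_square_integrable[OF H1_L2[OF f e]]
      have "\<bar>\<integral>x. q e x * (cmod (f e x))\<^sup>2 \<partial>leb (len e)\<bar> \<le> (\<integral>x. qC * (cmod (f e x))\<^sup>2 \<partial>leb (len e))"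
      proof (rule order_trans[OF integral_abs_bound], rule integral_mono_AE)
        show "integrable (leb (len e)) (\<lambda>x. \<bar>q e x * (cmod (f e x))\<^sup>2\<bar>)"
          using integrable_abs[OF q_mult_integrable[OF e i]] by simp
        show "integrable (leb (len e)) (\<lambda>x. qC * (cmod (f e x))\<^sup>2)" using i by simp
        show "AE x in leb (len e). \<bar>q e x * (cmod (f e x))\<^sup>2\<bar> \<le> qC * (cmod (f e x))\<^sup>2"
          by (rule AE_mp[OF qC(2)[OF e]]) (auto simp: abs_mult intro!: mult_right_mono)
      qed
      then show ?thesis by simp
    qed
    then show ?thesis
      unfolding graph_integral_def mass_def sum_distrib_left
      by (intro order_trans[OF sum_abs] sum_mono) auto
  qed
  also have "qC * mass f \<le> qC / k\<^sup>2 * energy k f"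
    using mult_left_mono[OF mass_le_energy[of k f], of "qC / k\<^sup>2"] qC(1) k by simp
  finally have 1: "\<bar>graph_integral G len (\<lambda>e x. q e x * (cmod (f e x))\<^sup>2)\<bar> \<le> qC / k\<^sup>2 * energy k f" .
  define t where "t = k * tanh (k * (min_len / 2))"
  have t: "0 < t" using k min_len(1) by (simp add: t_def)
  have "\<bar>\<Sum>v\<in>verts G. \<sigma> v * (cmod (val f v))\<^sup>2\<bar> \<le> (\<Sum>v\<in>verts G. \<bar>\<sigma> v\<bar> * (energy k f / t))"
  proof (rule order_trans[OF sum_abs], rule sum_mono)
    fix v assume v: "v \<in> verts G"
    have "(cmod (val f v))\<^sup>2 \<le> energy k f / t"
      using vertex_uniform_bound[OF f v less_imp_le[OF k], folded t_def] t by (simp add: pos_le_divide_eq mult.commute)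
    then show "\<bar>\<sigma> v * (cmod (val f v))\<^sup>2\<bar> \<le> \<bar>\<sigma> v\<bar> * (energy k f / t)"
      unfolding abs_mult by (simp add: mult_left_mono del: times_divide_eq_right)
  qed
  also have "\<dots> = (\<Sum>v\<in>verts G. \<bar>\<sigma> v\<bar>) / t * energy k f"
    by (simp add: sum_distrib_right sum_divide_distrib)
  finally show ?thesis using 1 unfolding pot_def \<epsilon>_def t_def[symmetric] by (simp add: distrib_right)
qed

lemma \<epsilon>_tendsto: "(\<epsilon> \<longlongrightarrow> 0) at_top"
proof -
  have inv: "((\<lambda>k::real. inverse k) \<longlongrightarrow> 0) at_top" by (rule tendsto_inverse_0_at_top[OF filterlim_ident])
  have lim: "((\<lambda>k::real. qC * (inverse k)\<^sup>2 + (\<Sum>v\<in>verts G. \<bar>\<sigma> v\<bar>) * (inverse k * inverse (tanh (k * (min_len / 2))))) \<longlongrightarrow>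
     qC * 0\<^sup>2 + (\<Sum>v\<in>verts G. \<bar>\<sigma> v\<bar>) * (0 * inverse 1)) at_top"
    by (intro tendsto_add tendsto_mult tendsto_power tendsto_const tendsto_inverse tanh_tendsto inv) simp
  have "\<epsilon> k = qC * (inverse k)\<^sup>2 + (\<Sum>v\<in>verts G. \<bar>\<sigma> v\<bar>) * (inverse k * inverse (tanh (k * (min_len / 2))))" for k
    unfolding \<epsilon>_def divide_inverse by (simp only: power_inverse inverse_mult_distrib)
  then have "\<epsilon> = (\<lambda>k. qC * (inverse k)\<^sup>2 + (\<Sum>v\<in>verts G. \<bar>\<sigma> v\<bar>) * (inverse k * inverse (tanh (k * (min_len / 2)))))"
    by (rule ext)
  then show ?thesis using lim by simp
qed

text \<open>Its square is the shift \<open>E\<close> for \<open>compact_form\<close>. The bound 1/2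
  makes the shifted form comparable to the energy. With \<open>2 \<le> k0\<close> the energy is at
  least four times the mass, so half of it still dominates the mass, as coercivity with constant 1
  demands.\<close>

definition k0 :: real where "k0 = (SOME k. 2 \<le> k \<and> \<epsilon> k \<le> 1 / 2)"

lemma k0: "2 \<le> k0" "\<epsilon> k0 \<le> 1 / 2"
proof -
  have "\<forall>\<^sub>F k in at_top. \<epsilon> k < 1 / 2" by (rule order_tendstoD[OF \<epsilon>_tendsto]) simp
  then have "\<forall>\<^sub>F k in at_top. 2 \<le> k \<and> \<epsilon> k \<le> 1 / 2"
    using eventually_ge_at_top[of 2] by eventually_elim auto
  then have "\<exists>k. 2 \<le> k \<and> \<epsilon> k \<le> 1 / 2" by (rule eventually_happens'[rotated]) simp
  from someI_ex[OF this] show "2 \<le> k0" "\<epsilon> k0 \<le> 1 / 2" unfolding k0_def by auto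
qed

lemma form_energy_bounds:
  assumes f: "f \<in> \<V>" and k: "0 < k"
  shows "(1 - \<epsilon> k) * energy k f \<le> quadratic_form G len q \<sigma> f + k\<^sup>2 * mass f"
    "quadratic_form G len q \<sigma> f + k\<^sup>2 * mass f \<le> (1 + \<epsilon> k) * energy k f"
  using pot_bound[OF f k] unfolding quadratic_form_eq by (simp_all add: energy_def algebra_simps abs_le_iff)

end

section \<open>Compact embedding and completeness of H1 on the graph\<close>

context metric_graph begin

lemma H1_diff: "\<lbrakk>f \<in> \<V>; g \<in> \<V>\<rbrakk> \<Longrightarrow> f - g \<in> \<V>"
  using H1_subspace by (rule graph_fun.subspace_diff)

lemma D_diff:
  assumes f: "f \<in> \<V>" and g: "g \<in> \<V>" and e: "e \<in> arcs G" and v: "v \<in> L2_interval (len e)" "primitive_on (len e) (g e) v"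
  shows "AE x in leb (len e). D (f - g) e x = D f e x - v x"
proof (rule D_unique[OF H1_diff[OF f g] e])
  show "(\<lambda>x. D f e x - v x) \<in> L2_interval (len e)" by (intro L2_diff H1_D f e v)
  have "primitive_on (len e) (\<lambda>x. f e x + (-1) * g e x) (\<lambda>x. D f e x + (-1) * v x)"
    by (intro primitive_on_add primitive_on_scale H1_D f e v L2_scale)
  then show "primitive_on (len e) ((f - g) e) (\<lambda>x. D f e x - v x)" by (simp add: fun_diff_def)
qed

lemma dirichlet_diff:
  assumes f: "f \<in> \<V>" and g: "g \<in> \<V>"
    and v: "\<And>e. e \<in> arcs G \<Longrightarrow> v e \<in> L2_interval (len e) \<and> primitive_on (len e) (g e) (v e)"
  shows "dirichlet (f - g) = (\<Sum>e\<in>arcs G. \<integral>x. (cmod (D f e x - v e x))\<^sup>2 \<partial>leb (len e))"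
  unfolding dirichlet_def graph_integral_def
proof (rule sum.cong[OF refl])
  fix e assume e: "e \<in> arcs G"
  show "(\<integral>x. (cmod (D (f - g) e x))\<^sup>2 \<partial>leb (len e)) = (\<integral>x. (cmod (D f e x - v e x))\<^sup>2 \<partial>leb (len e))"
  proof (rule integral_cong_AE)
    show "(\<lambda>x. (cmod (D (f - g) e x))\<^sup>2) \<in> borel_measurable (leb (len e))"
      by (rule borel_measurable_integrable) (rule L2_square_integrable[OF H1_D(1)[OF H1_diff[OF f g] e]])
    show "(\<lambda>x. (cmod (D f e x - v e x))\<^sup>2) \<in> borel_measurable (leb (len e))"
      by (rule borel_measurable_integrable) (rule L2_square_integrable[OF L2_diff[OF H1_D(1)[OF f e]]], use v[OF e] in blast)
    show "AE x in leb (len e). (cmod (D (f - g) e x))\<^sup>2 = (cmod (D f e x - v e x))\<^sup>2"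
      by (rule AE_mp[OF D_diff[OF f g e]]) (use v[OF e] in auto)
  qed
qed

lemma edge_dirichlet_le:
  assumes e: "e \<in> arcs G" shows "(\<integral>x. (cmod (D f e x))\<^sup>2 \<partial>leb (len e)) \<le> dirichlet f"
  unfolding dirichlet_def graph_integral_def
  using member_le_sum[of e "arcs G" "\<lambda>e. \<integral>x. (cmod (D f e x))\<^sup>2 \<partial>leb (len e)"] e by simp

lemma dirichlet_le_energy: "dirichlet f \<le> energy k f"
  by (simp add: energy_def mass_nonneg)

lemma mass_sup_bound:
  assumes f: "f \<in> \<V>" and c: "\<And>e x. \<lbrakk>e \<in> arcs G; x \<in> {0..len e}\<rbrakk> \<Longrightarrow> cmod (f e x) \<le> c"
  shows "mass f \<le> c\<^sup>2 * (\<Sum>e\<in>arcs G. len e)"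
  unfolding mass_def graph_integral_def sum_distrib_left
proof (rule sum_mono)
  fix e assume e: "e \<in> arcs G"
  have "(\<integral>x. (cmod (f e x))\<^sup>2 \<partial>leb (len e)) = integral {0..len e} (\<lambda>x. (cmod (f e x))\<^sup>2)"
    by (rule integral_leb[OF L2_square_integrable[OF H1_L2[OF f e]]])
  also have "\<dots> \<le> integral {0..len e} (\<lambda>x. c\<^sup>2)"
    using c[OF e] by (intro integral_le L2_subinterval(3)[OF H1_L2[OF f e]] integrable_const_ivl power_mono) auto
  also have "\<dots> = c\<^sup>2 * len e" using length_pos[OF e] by simp
  finally show "(\<integral>x. (cmod (f e x))\<^sup>2 \<partial>leb (len e)) \<le> c\<^sup>2 * len e" .
qed

text \<open>The filter is arbitrary so that the lemma covers both convergent sequences and, through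
  a product filter, Cauchy sequences.\<close>

lemma mass_tendsto_zero:
  assumes f: "\<And>n. f n \<in> \<V>"
    and u: "\<And>\<delta>. 0 < \<delta> \<Longrightarrow> \<forall>\<^sub>F n in F. \<forall>e\<in>arcs G. \<forall>x\<in>{0..len e}. cmod (f n e x) \<le> \<delta>"
    and c: "0 < c"
  shows "\<forall>\<^sub>F n in F. mass (f n) < c"
proof -
  define T where "T = (\<Sum>e\<in>arcs G. len e)"
  have T: "0 \<le> T" unfolding T_def using length_pos by (intro sum_nonneg) (auto simp: less_imp_le)
  define \<delta> where "\<delta> = sqrt (c / (T + 1))"
  have \<delta>: "0 < \<delta>" "\<delta>\<^sup>2 = c / (T + 1)" using c T by (auto simp: \<delta>_def)
  show ?thesis
    using u[OF \<delta>(1)]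
  proof eventually_elim
    case (elim n)
    then have "mass (f n) \<le> \<delta>\<^sup>2 * T" unfolding T_def by (intro mass_sup_bound f) auto
    also have "\<dots> < c" using c T by (simp add: \<delta>(2) field_simps)
    finally show ?case .
  qed
qed

text \<open>Definiteness as equality in HOL: continuity handles the closed edges, the normalisation
  in \<open>C_graph\<close> handles everything else.\<close>

lemma mass_zero_imp:
  assumes f: "f \<in> \<V>" and 0: "mass f = 0" shows "f = 0"
proof (intro ext)
  fix e x
  show "f e x = 0 e x"
  proof (cases "e \<in> arcs G \<and> x \<in> {0..len e}")
    case True
    then have e: "e \<in> arcs G" and x: "x \<in> {0..len e}" by auto
    have "(\<integral>x. (cmod (f e x))\<^sup>2 \<partial>leb (len e)) = 0"
      using 0 e unfolding mass_def graph_integral_def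
      by (subst (asm) sum_nonneg_eq_0_iff) auto
    then have "integral {0..len e} (\<lambda>x. (cmod (f e x))\<^sup>2) = 0"
      by (simp add: integral_leb[OF L2_square_integrable[OF H1_L2[OF f e]]])
    then have "\<forall>x\<in>{0..len e}. (cmod (f e x))\<^sup>2 = 0"
      by (subst (asm) integral_eq_0_iff) (auto intro!: continuous_intros H1_continuous[OF f e] length_pos[OF e])
    then show ?thesis using x by (simp add: zero_fun_def)
  next
    case False
    then show ?thesis using H1_C[OF f] by (auto simp: C_graph_def zero_fun_def)
  qed
qed

lemma inner_diag: "Re (L2_inner G len f f) = mass f"
proof -
  have "L2_inner G len f f = graph_integral G len (\<lambda>e x. complex_of_real ((cmod (f e x))\<^sup>2))"
    unfolding L2_inner_def by (simp add: complex_norm_square del: of_real_power)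
  also have "\<dots> = of_real (mass f)" by (simp add: graph_integral_def mass_def del: of_real_power)
  finally show ?thesis by simp
qed

lemma edge_Holder:
  assumes f: "f \<in> \<V>" and e: "e \<in> arcs G" and "x \<in> {0..len e}" "y \<in> {0..len e}"
  shows "cmod (f e y - f e x) \<le> sqrt \<bar>y - x\<bar> * sqrt (dirichlet f)"
proof -
  have "integral {0..len e} (\<lambda>s. (cmod (D f e s))\<^sup>2) \<le> dirichlet f"
    using edge_dirichlet_le[OF e, of f] by (simp add: integral_leb[OF L2_square_integrable[OF H1_D(1)[OF f e]]])
  then have "sqrt \<bar>y - x\<bar> * sqrt (integral {0..len e} (\<lambda>s. (cmod (D f e s))\<^sup>2)) \<le> sqrt \<bar>y - x\<bar> * sqrt (dirichlet f)"
    by (intro mult_left_mono) auto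
  with primitive_on_Holder[OF H1_D(2,1)[OF f e] assms(3,4)] show ?thesis by linarith
qed

text \<open>Bounded Dirichlet energy makes the functions uniformly Hoelder continuous with exponent
  1/2, so Arzela-Ascoli applies on each edge; the induction passes to a further subsequence for
  every edge.\<close>

lemma uniform_subsequence:
  assumes u: "\<And>n::nat. u n \<in> \<V>" and K: "\<And>n e x. \<lbrakk>e \<in> arcs G; x \<in> {0..len e}\<rbrakk> \<Longrightarrow> cmod (u n e x) \<le> K"
    and d: "\<And>n. dirichlet (u n) \<le> K'"
  shows "\<exists>r::nat \<Rightarrow> nat. strict_mono r \<and> (\<forall>\<delta>>0. \<exists>N. \<forall>m\<ge>N. \<forall>n\<ge>N. \<forall>e\<in>arcs G. \<forall>x\<in>{0..len e}. cmod (u (r m) e x - u (r n) e x) < \<delta>)"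
proof -
  have "\<exists>r::nat \<Rightarrow> nat. strict_mono r \<and> (\<forall>\<delta>>0. \<exists>N. \<forall>m\<ge>N. \<forall>n\<ge>N. \<forall>e\<in>A. \<forall>x\<in>{0..len e}. cmod (u (r m) e x - u (r n) e x) < \<delta>)"
    if "finite A" "A \<subseteq> arcs G" for A
    using that
  proof induction
    case empty
    then show ?case by (intro exI[of _ id]) (auto simp: strict_mono_def)
  next
    case (insert e A)
    then obtain r :: "nat \<Rightarrow> nat" where r: "strict_mono r"
      "\<And>\<delta>. 0 < \<delta> \<Longrightarrow> \<exists>N. \<forall>m\<ge>N. \<forall>n\<ge>N. \<forall>e\<in>A. \<forall>x\<in>{0..len e}. cmod (u (r m) e x - u (r n) e x) < \<delta>"
      by auto
    have e: "e \<in> arcs G" using insert by auto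
    have eq: "\<exists>d>0. \<forall>n y. y \<in> {0..len e} \<and> norm (x - y) < d \<longrightarrow> norm (u (r n) e x - u (r n) e y) < \<delta>"
      if x: "x \<in> {0..len e}" and \<delta>: "0 < \<delta>" for x \<delta>
    proof -
      \<comment> \<open>Chosen so that \<open>sqrt d * sqrt \<bar>K'\<bar> < \<delta>\<close>; the
        summand 1 covers \<open>K' = 0\<close>.\<close>
      define d where "d = (\<delta> / (sqrt \<bar>K'\<bar> + 1))\<^sup>2"
      have pos: "0 < sqrt \<bar>K'\<bar> + 1" by (simp add: add_nonneg_pos)
      have d0: "0 < d" "sqrt d = \<delta> / (sqrt \<bar>K'\<bar> + 1)" using \<delta> pos by (auto simp: d_def real_sqrt_abs)
      have "norm (u (r n) e x - u (r n) e y) < \<delta>" if y: "y \<in> {0..len e}" "norm (x - y) < d" for n y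
      proof -
        have "norm (u (r n) e x - u (r n) e y) \<le> sqrt \<bar>x - y\<bar> * sqrt (dirichlet (u (r n)))"
          by (rule edge_Holder[OF u e y(1) x])
        also have "\<dots> \<le> sqrt d * sqrt \<bar>K'\<bar>"
          using y(2) d[of "r n"] dirichlet_nonneg[of "u (r n)"] d0(1) by (intro mult_mono) auto
        also have "\<dots> < \<delta>" using \<delta> pos by (simp add: d0(2) field_simps)
        finally show ?thesis .
      qed
      then show ?thesis using d0(1) by blast
    qed
    obtain g and k :: "nat \<Rightarrow> nat" where k: "strict_mono k"
      "\<And>\<delta>. 0 < \<delta> \<Longrightarrow> \<exists>N. \<forall>n x. n \<ge> N \<and> x \<in> {0..len e} \<longrightarrow> norm (u (r (k n)) e x - g x) < \<delta>"
    proof (rule Arzela_Ascoli[of "{0..len e}" "\<lambda>n. u (r n) e" K])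
      fix g and k :: "nat \<Rightarrow> nat"
      assume "strict_mono k" "\<And>\<delta>. 0 < \<delta> \<Longrightarrow> \<exists>N. \<forall>n x. n \<ge> N \<and> x \<in> {0..len e} \<longrightarrow> norm (u (r (k n)) e x - g x) < \<delta>"
      then show thesis by (rule that)
    qed (use K[OF e] eq in auto)
    show ?case
    proof (intro exI[of _ "r \<circ> k"] conjI allI impI)
      show "strict_mono (r \<circ> k)" using r(1) k(1) by (simp add: strict_mono_o)
      fix \<delta> :: real assume \<delta>: "0 < \<delta>"
      obtain N1 where N1: "\<And>m n e x. \<lbrakk>m \<ge> N1; n \<ge> N1; e \<in> A; x \<in> {0..len e}\<rbrakk> \<Longrightarrow> cmod (u (r m) e x - u (r n) e x) < \<delta>"
        using r(2)[OF \<delta>] by blast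
      obtain N2 where N2: "\<And>n x. \<lbrakk>n \<ge> N2; x \<in> {0..len e}\<rbrakk> \<Longrightarrow> cmod (u (r (k n)) e x - g x) < \<delta> / 2"
        using k(2)[of "\<delta> / 2"] \<delta> by auto
      have "cmod (u ((r \<circ> k) m) e' x - u ((r \<circ> k) n) e' x) < \<delta>"
        if "m \<ge> max N1 N2" "n \<ge> max N1 N2" "e' \<in> insert e A" "x \<in> {0..len e'}" for m n e' x
      proof (cases "e' = e")
        case True
        have "cmod (u (r (k m)) e x - g x) < \<delta> / 2" "cmod (u (r (k n)) e x - g x) < \<delta> / 2"
          using N2 that True by auto
        then show ?thesis using norm_triangle_ineq4[of "u (r (k m)) e x - g x" "u (r (k n)) e x - g x"] True by simp
      next
        case False
        have "k m \<ge> N1" "k n \<ge> N1" using that seq_suble[OF k(1), of m] seq_suble[OF k(1), of n] by auto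
        then show ?thesis using N1 that False by auto
      qed
      then show "\<exists>N. \<forall>m\<ge>N. \<forall>n\<ge>N. \<forall>e\<in>insert e A. \<forall>x\<in>{0..len e}. cmod (u ((r \<circ> k) m) e x - u ((r \<circ> k) n) e x) < \<delta>"
        by blast
    qed
  qed
  from this[OF finite_arcs order_refl] show ?thesis .
qed

lemma sup_le_of_energy:
  assumes f: "f \<in> \<V>" and k: "0 < k" and en: "energy k f \<le> (k * tanh (k * (min_len / 2))) * \<delta>\<^sup>2" and \<delta>: "0 \<le> \<delta>"
    and e: "e \<in> arcs G" "x \<in> {0..len e}"
  shows "cmod (f e x) \<le> \<delta>"
proof -
  define t where "t = k * tanh (k * (min_len / 2))"
  have t: "0 < t" using k min_len(1) by (simp add: t_def)
  have "t * (cmod (f e x))\<^sup>2 \<le> t * \<delta>\<^sup>2"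
    using uniform_bound[OF f e less_imp_le[OF k]] en unfolding t_def by linarith
  then have "(cmod (f e x))\<^sup>2 \<le> \<delta>\<^sup>2" using t by simp
  then show ?thesis using \<delta> by (simp add: power2_le_iff_abs_le)
qed

text \<open>Energy controls the sup norm, so the functions converge uniformly on the edges, while
  their derivatives converge in L2. The antiderivative relation passes to the limit and places it in
  H1; agreement of end values at the vertices survives pointwise limits.\<close>

lemma energy_complete:
  assumes u: "\<And>n::nat. u n \<in> \<V>" and k: "0 < k"
    and cauchy: "\<And>c. 0 < c \<Longrightarrow> \<exists>N. \<forall>m\<ge>N. \<forall>n\<ge>N. energy k (u m - u n) < c"
  shows "\<exists>w\<in>\<V>. (\<lambda>n. energy k (u n - w)) \<longlonglongrightarrow> 0"
proof -
  define t where "t = k * tanh (k * (min_len / 2))"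
  have t: "0 < t" using k min_len(1) by (simp add: t_def)
  have uc: "\<exists>N. \<forall>m\<ge>N. \<forall>n\<ge>N. \<forall>e\<in>arcs G. \<forall>x\<in>{0..len e}. cmod (u m e x - u n e x) \<le> \<delta>" if \<delta>: "0 < \<delta>" for \<delta>
  proof -
    have "0 < t * \<delta>\<^sup>2" using t \<delta> by simp
    then obtain N where N: "\<And>m n. \<lbrakk>m \<ge> N; n \<ge> N\<rbrakk> \<Longrightarrow> energy k (u m - u n) < t * \<delta>\<^sup>2" using cauchy by blast
    have "cmod (u m e x - u n e x) \<le> \<delta>" if "m \<ge> N" "n \<ge> N" "e \<in> arcs G" "x \<in> {0..len e}" for m n e x
      using sup_le_of_energy[OF H1_diff[OF u u] k _ less_imp_le[OF \<delta>] that(3,4), of m n] N[OF that(1,2)]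
      by (simp add: t_def)
    then show ?thesis by blast
  qed
  define w where "w e x = (if e \<in> arcs G \<and> x \<in> {0..len e} then lim (\<lambda>n. u n e x) else 0)" for e x
  have conv: "(\<lambda>n. u n e x) \<longlonglongrightarrow> w e x" if ex: "e \<in> arcs G" "x \<in> {0..len e}" for e x
  proof -
    have "Cauchy (\<lambda>n. u n e x)"
      unfolding Cauchy_def dist_norm
    proof (intro allI impI)
      fix c :: real assume "0 < c"
      then have "0 < c / 2" by simp
      from uc[OF this] obtain N where N: "\<And>m n. \<lbrakk>m \<ge> N; n \<ge> N\<rbrakk> \<Longrightarrow> cmod (u m e x - u n e x) \<le> c / 2"
        using ex by blast
      show "\<exists>M. \<forall>m\<ge>M. \<forall>n\<ge>M. norm (u m e x - u n e x) < c"
      proof (intro exI[of _ N] allI impI)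
        fix m n assume "N \<le> m" "N \<le> n"
        from N[OF this] show "norm (u m e x - u n e x) < c" using \<open>0 < c\<close> by linarith
      qed
    qed
    then show ?thesis using that by (simp add: w_def Cauchy_convergent_iff convergent_LIMSEQ_iff)
  qed
  have uw: "\<exists>N. \<forall>n\<ge>N. \<forall>e\<in>arcs G. \<forall>x\<in>{0..len e}. cmod (u n e x - w e x) \<le> \<delta>" if \<delta>: "0 < \<delta>" for \<delta>
  proof -
    obtain N where N: "\<And>m n e x. \<lbrakk>m \<ge> N; n \<ge> N; e \<in> arcs G; x \<in> {0..len e}\<rbrakk> \<Longrightarrow> cmod (u m e x - u n e x) \<le> \<delta>"
      using uc[OF \<delta>] by blast
    have "cmod (u n e x - w e x) \<le> \<delta>" if "n \<ge> N" "e \<in> arcs G" "x \<in> {0..len e}" for n e x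
    proof (rule LIMSEQ_le_const2)
      show "(\<lambda>m. cmod (u n e x - u m e x)) \<longlonglongrightarrow> cmod (u n e x - w e x)" by (intro tendsto_intros conv that)
      show "\<exists>M. \<forall>m\<ge>M. cmod (u n e x - u m e x) \<le> \<delta>" using N that by blast
    qed
    then show ?thesis by blast
  qed
  have "\<exists>v. v \<in> L2_interval (len e) \<and> (\<lambda>n. \<integral>x. (cmod (D (u n) e x - v x))\<^sup>2 \<partial>leb (len e)) \<longlonglongrightarrow> 0" if e: "e \<in> arcs G" for e
  proof -
    have "\<exists>N. \<forall>m\<ge>N. \<forall>n\<ge>N. (\<integral>x. (cmod (D (u m) e x - D (u n) e x))\<^sup>2 \<partial>leb (len e)) < c" if "0 < c" for c
    proof -
      have "(\<integral>x. (cmod (D (u m) e x - D (u n) e x))\<^sup>2 \<partial>leb (len e)) \<le> energy k (u m - u n)" for m n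
      proof -
        have "(\<integral>x. (cmod (D (u m) e x - D (u n) e x))\<^sup>2 \<partial>leb (len e)) \<le> dirichlet (u m - u n)"
          unfolding dirichlet_diff[OF u u, of "D (u n)" n m, OF conjI[OF H1_D[OF u]], simplified]
          using member_le_sum[of e "arcs G" "\<lambda>e. \<integral>x. (cmod (D (u m) e x - D (u n) e x))\<^sup>2 \<partial>leb (len e)"] e by simp
        then show ?thesis using dirichlet_le_energy[of "u m - u n" k] by linarith
      qed
      then show ?thesis using cauchy[OF that] by (meson le_less_trans)
    qed
    from L2_complete[OF H1_D(1)[OF u e] length_pos[OF e] this] show ?thesis by blast
  qed
  then have "\<exists>v. \<forall>e\<in>arcs G. v e \<in> L2_interval (len e) \<and>
      (\<lambda>n. \<integral>x. (cmod (D (u n) e x - v e x))\<^sup>2 \<partial>leb (len e)) \<longlonglongrightarrow> 0"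
    by (intro bchoice ballI)
  then obtain v where v: "\<And>e. e \<in> arcs G \<Longrightarrow> v e \<in> L2_interval (len e)"
    "\<And>e. e \<in> arcs G \<Longrightarrow> (\<lambda>n. \<integral>x. (cmod (D (u n) e x - v e x))\<^sup>2 \<partial>leb (len e)) \<longlonglongrightarrow> 0" by auto
  have prim: "primitive_on (len e) (w e) (v e)" if e: "e \<in> arcs G" for e
    unfolding primitive_on_def
  proof (intro allI impI)
    fix x y assume xy: "0 \<le> x" "x \<le> y" "y \<le> len e"
    have L: "(\<lambda>s. D (u n) e s - v e s) \<in> L2_interval (len e)" for n by (intro L2_diff H1_D u e v)
    have "(\<lambda>n. integral {x..y} (\<lambda>s. D (u n) e s - v e s)) \<longlonglongrightarrow> 0"
    proof (rule Lim_null_comparison)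
      show "\<forall>\<^sub>F n in sequentially. norm (integral {x..y} (\<lambda>s. D (u n) e s - v e s)) \<le>
          sqrt (y - x) * sqrt (\<integral>x. (cmod (D (u n) e x - v e x))\<^sup>2 \<partial>leb (len e))"
        using L2_integral_bound'(1)[OF L xy] by (simp add: integral_leb[OF L2_square_integrable[OF L]])
      show "(\<lambda>n. sqrt (y - x) * sqrt (\<integral>x. (cmod (D (u n) e x - v e x))\<^sup>2 \<partial>leb (len e))) \<longlonglongrightarrow> 0"
        using tendsto_mult_right_zero[OF tendsto_real_sqrt[OF v(2)[OF e], simplified]] by simp
    qed
    moreover have "integral {x..y} (\<lambda>s. D (u n) e s - v e s) = (u n e y - u n e x) - integral {x..y} (v e)" for n
      using primitive_onD[OF H1_D(2)[OF u e] xy]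
      by (subst Henstock_Kurzweil_Integration.integral_diff) (auto intro: L2_subinterval H1_D u e v xy)
    ultimately have "(\<lambda>n. (u n e y - u n e x) - integral {x..y} (v e)) \<longlonglongrightarrow> 0" by simp
    then have "(\<lambda>n. u n e y - u n e x) \<longlonglongrightarrow> integral {x..y} (v e)" by (simp add: LIM_zero_iff)
    moreover have "(\<lambda>n. u n e y - u n e x) \<longlonglongrightarrow> w e y - w e x" using xy by (intro tendsto_diff conv e) auto
    ultimately show "w e y - w e x = integral {x..y} (v e)" by (rule LIMSEQ_unique[rotated])
  qed
  have wV: "w \<in> \<V>"
  proof (rule H1I)
    show "v e \<in> L2_interval (len e) \<and> primitive_on (len e) (w e) (v e)" if "e \<in> arcs G" for e
      using v(1) prim that by blast
    show "w \<in> C_graph G len"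
      unfolding C_graph_def
    proof (intro CollectI conjI ballI allI impI exI[of _ "\<lambda>a. lim (\<lambda>n. val (u n) a)"])
      show "continuous_on {0..len e} (w e)" if "e \<in> arcs G" for e
        by (rule primitive_on_continuous[OF prim[OF that] v(1)[OF that]])
      show "w e 0 = lim (\<lambda>n. val (u n) (tail G e))" "w e (len e) = lim (\<lambda>n. val (u n) (head G e))" if e: "e \<in> arcs G" for e
        using length_pos[OF e] val_ends[OF H1_C[OF u] e] e by (simp_all add: w_def)
    qed (auto simp: w_def)
  qed
  have dd: "dirichlet (u n - w) = (\<Sum>e\<in>arcs G. \<integral>x. (cmod (D (u n) e x - v e x))\<^sup>2 \<partial>leb (len e))" for n
    by (rule dirichlet_diff[OF u wV]) (use v(1) prim in blast)
  have "(\<lambda>n. dirichlet (u n - w)) \<longlonglongrightarrow> (\<Sum>e\<in>arcs G. 0)"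
    unfolding dd by (intro tendsto_sum v(2))
  moreover have "(\<lambda>n. mass (u n - w)) \<longlonglongrightarrow> 0"
  proof (rule order_tendstoI)
    show "\<forall>\<^sub>F n in sequentially. c < mass (u n - w)" if "c < 0" for c
      by (rule always_eventually) (use less_le_trans[OF that mass_nonneg] in blast)
    show "\<forall>\<^sub>F n in sequentially. mass (u n - w) < c" if c: "0 < c" for c
    proof (rule mass_tendsto_zero[OF _ _ c])
      show "\<forall>\<^sub>F n in sequentially. \<forall>e\<in>arcs G. \<forall>x\<in>{0..len e}. cmod ((u n - w) e x) \<le> \<delta>" if "0 < \<delta>" for \<delta>
        using uw[OF that] by (simp add: eventually_sequentially)
    qed (intro H1_diff u wV)
  qed
  ultimately have "(\<lambda>n. dirichlet (u n - w) + k\<^sup>2 * mass (u n - w)) \<longlonglongrightarrow> 0 + k\<^sup>2 * 0"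
    by (intro tendsto_intros) auto
  then show ?thesis using wV by (auto simp: energy_def)
qed

end

context schroedinger_graph begin

lemma form_diag: "Re (form f f) = quadratic_form G len q \<sigma> f"
  by (simp add: sesquilinear_form_diagonal)

definition shifted_form :: "('e \<Rightarrow> real \<Rightarrow> complex) \<Rightarrow> real" where
  "shifted_form f = Re (form f f) + k0\<^sup>2 * Re (L2_inner G len f f)"

lemma energy_le_form: "f \<in> \<V> \<Longrightarrow> energy k0 f \<le> 2 * shifted_form f"
  and form_le_energy: "f \<in> \<V> \<Longrightarrow> shifted_form f \<le> 2 * energy k0 f"
proof -
  assume f: "f \<in> \<V>"
  have k: "0 < k0" using k0(1) by simp
  have Q: "shifted_form f = quadratic_form G len q \<sigma> f + k0\<^sup>2 * mass f"
    by (simp add: shifted_form_def form_diag inner_diag)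
  have "1 / 2 * energy k0 f \<le> (1 - \<epsilon> k0) * energy k0 f" "(1 + \<epsilon> k0) * energy k0 f \<le> 2 * energy k0 f"
    using k0(2) energy_nonneg by (intro mult_right_mono; simp)+
  then show "energy k0 f \<le> 2 * shifted_form f" "shifted_form f \<le> 2 * energy k0 f"
    using form_energy_bounds[OF f k] unfolding Q by simp_all
qed

text \<open>All axioms about the form are transferred from the free energy \<open>energy k0\<close>,
  to which the shifted form is comparable with constants independent of the function.\<close>

sublocale cf: compact_form scale_fun \<V> "L2_inner G len" form "k0\<^sup>2"
proof -
  interpret ip: hermitian_form scale_fun \<V> "L2_inner G len" by (rule inner_form)
  interpret s: hermitian_form scale_fun \<V> form by (rule form_hermitian)
  have k: "0 < k0" using k0 by linarith
  define t where "t = k0 * tanh (k0 * (min_len / 2))"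
  have t: "0 < t" using k min_len(1) by (simp add: t_def)
  show "compact_form scale_fun \<V> (L2_inner G len) form (k0\<^sup>2)"
  proof unfold_locales
    show "f = 0" if "f \<in> \<V>" "Re (L2_inner G len f f) = 0" for f
      using mass_zero_imp that by (simp add: inner_diag)
    show "0 \<le> Re (L2_inner G len f f)" for f by (simp add: inner_diag mass_nonneg)
    show "Re (L2_inner G len f f) \<le> Re (form f f) + k0\<^sup>2 * Re (L2_inner G len f f)" if f: "f \<in> \<V>" for f
    proof -
      have "2\<^sup>2 * mass f \<le> k0\<^sup>2 * mass f" using k0(1) mass_nonneg by (intro mult_right_mono power_mono) auto
      then have "4 * mass f \<le> energy k0 f" using mass_le_energy[of k0 f] by simp
      then have "mass f \<le> shifted_form f" using energy_le_form[OF f] mass_nonneg[of f] by simp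
      then show ?thesis by (simp add: shifted_form_def inner_diag)
    qed
  next
    fix u :: "nat \<Rightarrow> 'e \<Rightarrow> real \<Rightarrow> complex" and C
    assume u: "\<And>n. u n \<in> \<V>" and C': "\<And>n. Re (form (u n) (u n)) + k0\<^sup>2 * Re (L2_inner G len (u n) (u n)) \<le> C"
    note C = C'[folded shifted_form_def]
    have en: "energy k0 (u n) \<le> 2 * \<bar>C\<bar>" for n using energy_le_form[OF u, of n] C[of n] by linarith
    define K where "K = sqrt (2 * \<bar>C\<bar> / t)"
    have K: "0 \<le> K" "t * K\<^sup>2 = 2 * \<bar>C\<bar>" using t by (auto simp: K_def)
    have "\<exists>r::nat \<Rightarrow> nat. strict_mono r \<and> (\<forall>\<delta>>0. \<exists>N. \<forall>m\<ge>N. \<forall>n\<ge>N. \<forall>e\<in>arcs G. \<forall>x\<in>{0..len e}. cmod (u (r m) e x - u (r n) e x) < \<delta>)"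
    proof (rule uniform_subsequence[OF u])
      show "cmod (u n e x) \<le> K" if "e \<in> arcs G" "x \<in> {0..len e}" for n e x
        by (rule sup_le_of_energy[OF u k _ K(1) that]) (use en K(2) in \<open>simp add: t_def\<close>)
      show "dirichlet (u n) \<le> 2 * \<bar>C\<bar>" for n using en[of n] dirichlet_le_energy[of "u n" k0] by linarith
    qed
    then obtain r :: "nat \<Rightarrow> nat" where r: "strict_mono r"
      "\<And>\<delta>. 0 < \<delta> \<Longrightarrow> \<exists>N. \<forall>m\<ge>N. \<forall>n\<ge>N. \<forall>e\<in>arcs G. \<forall>x\<in>{0..len e}. cmod (u (r m) e x - u (r n) e x) < \<delta>" by blast
    have "\<exists>N. \<forall>m\<ge>N. \<forall>n\<ge>N. Re (L2_inner G len (u (r m) - u (r n)) (u (r m) - u (r n))) < c" if c: "0 < c" for c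
    proof -
      have "\<forall>\<^sub>F p in sequentially \<times>\<^sub>F sequentially. mass (u (r (fst p)) - u (r (snd p))) < c"
      proof (rule mass_tendsto_zero[OF _ _ c])
        fix \<delta> :: real assume "0 < \<delta>"
        from r(2)[OF this] show "\<forall>\<^sub>F p in sequentially \<times>\<^sub>F sequentially. \<forall>e\<in>arcs G. \<forall>x\<in>{0..len e}. cmod ((u (r (fst p)) - u (r (snd p))) e x) \<le> \<delta>"
          unfolding eventually_prod_sequentially by (force simp: less_imp_le)
      qed (intro H1_diff u)
      then show ?thesis unfolding eventually_prod_sequentially inner_diag by auto
    qed
    then show "\<exists>r::nat \<Rightarrow> nat. strict_mono r \<and> (\<forall>c>0. \<exists>N. \<forall>m\<ge>N. \<forall>n\<ge>N. Re (L2_inner G len (u (r m) - u (r n)) (u (r m) - u (r n))) < c)"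
      using r(1) by blast
  next
    fix u :: "nat \<Rightarrow> 'e \<Rightarrow> real \<Rightarrow> complex"
    assume u: "\<And>n. u n \<in> \<V>" and cauchy': "\<And>c. 0 < c \<Longrightarrow> \<exists>N. \<forall>m\<ge>N. \<forall>n\<ge>N.
      Re (form (u m - u n) (u m - u n)) + k0\<^sup>2 * Re (L2_inner G len (u m - u n) (u m - u n)) < c"
    note cauchy = cauchy'[folded shifted_form_def]
    have "\<exists>N. \<forall>m\<ge>N. \<forall>n\<ge>N. energy k0 (u m - u n) < c" if "0 < c" for c
    proof -
      have "0 < c / 2" using that by simp
      from cauchy[OF this] obtain N where N: "\<And>m n. \<lbrakk>m \<ge> N; n \<ge> N\<rbrakk> \<Longrightarrow> shifted_form (u m - u n) < c / 2"
        by blast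
      have "energy k0 (u m - u n) < c" if "m \<ge> N" "n \<ge> N" for m n
        using N[OF that] energy_le_form[OF H1_diff[OF u u], of m n] by linarith
      then show ?thesis by blast
    qed
    from energy_complete[OF u k this] obtain w where w: "w \<in> \<V>" and lim: "(\<lambda>n. energy k0 (u n - w)) \<longlonglongrightarrow> 0" by blast
    have "(\<lambda>n. shifted_form (u n - w)) \<longlonglongrightarrow> 0"
    proof (rule tendsto_sandwich[OF _ _ tendsto_const])
      show "(\<lambda>n. 2 * energy k0 (u n - w)) \<longlonglongrightarrow> 0" using tendsto_mult_right_zero[OF lim] by simp
      show "\<forall>\<^sub>F n in sequentially. 0 \<le> shifted_form (u n - w)"
      proof (rule always_eventually, rule allI)
        fix n show "0 \<le> shifted_form (u n - w)"
          using energy_le_form[OF H1_diff[OF u w], of n] energy_nonneg[of k0 "u n - w"] by linarith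
      qed
      show "\<forall>\<^sub>F n in sequentially. shifted_form (u n - w) \<le> 2 * energy k0 (u n - w)"
        by (rule always_eventually) (use form_le_energy[OF H1_diff[OF u w]] in blast)
    qed
    then show "\<exists>v\<in>\<V>. (\<lambda>n. Re (form (u n - v) (u n - v)) + k0\<^sup>2 * Re (L2_inner G len (u n - v) (u n - v))) \<longlonglongrightarrow> 0"
      using w unfolding shifted_form_def by blast
  qed
qed

end

section \<open>The diagonal of the resolvent kernel\<close>

context metric_graph begin

text \<open>Trial functions come with explicit antiderivative data; this lets their energy be
  computed from these instead of the chosen \<open>D\<close>.\<close>

lemma energy_eqI:
  assumes C: "f \<in> C_graph G len" and g: "\<And>e. e \<in> arcs G \<Longrightarrow> g e \<in> L2_interval (len e) \<and> primitive_on (len e) (f e) (g e)"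
  shows "f \<in> \<V>" "energy k f = (\<Sum>e\<in>arcs G. integral {0..len e} (\<lambda>x. (cmod (g e x))\<^sup>2 + k\<^sup>2 * (cmod (f e x))\<^sup>2))"
proof -
  show f: "f \<in> \<V>" by (rule H1I[OF C g])
  have "edge_energy k f e = integral {0..len e} (\<lambda>x. (cmod (g e x))\<^sup>2 + k\<^sup>2 * (cmod (f e x))\<^sup>2)" if e: "e \<in> arcs G" for e
  proof -
    have i: "integrable (leb (len e)) (\<lambda>x. (cmod (h x))\<^sup>2 + k\<^sup>2 * (cmod (f e x))\<^sup>2)" if "h \<in> L2_interval (len e)" for h
      by (intro Bochner_Integration.integrable_add integrable_mult_right L2_square_integrable that H1_L2[OF f e])
    note gi = i[OF conjunct1[OF g[OF e]]] and Di = i[OF H1_D(1)[OF f e]]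
    have "edge_energy k f e = (\<integral>x. (cmod (D f e x))\<^sup>2 + k\<^sup>2 * (cmod (f e x))\<^sup>2 \<partial>leb (len e))"
      unfolding edge_energy_def by (rule integral_leb[OF Di, symmetric])
    also have "\<dots> = (\<integral>x. (cmod (g e x))\<^sup>2 + k\<^sup>2 * (cmod (f e x))\<^sup>2 \<partial>leb (len e))"
    proof (rule integral_cong_AE)
      have "AE x in leb (len e). D f e x = g e x" by (rule D_unique[OF f e]) (use g[OF e] in auto)
      then show "AE x in leb (len e). (cmod (D f e x))\<^sup>2 + k\<^sup>2 * (cmod (f e x))\<^sup>2 = (cmod (g e x))\<^sup>2 + k\<^sup>2 * (cmod (f e x))\<^sup>2"
        by (rule AE_mp) auto
    qed (rule borel_measurable_integrable, fact gi Di)+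
    also have "\<dots> = integral {0..len e} (\<lambda>x. (cmod (g e x))\<^sup>2 + k\<^sup>2 * (cmod (f e x))\<^sup>2)"
      by (rule integral_leb[OF gi])
    finally show ?thesis .
  qed
  then show "energy k f = (\<Sum>e\<in>arcs G. integral {0..len e} (\<lambda>x. (cmod (g e x))\<^sup>2 + k\<^sup>2 * (cmod (f e x))\<^sup>2))"
    by (simp add: energy_eq_sum[OF f])
qed

text \<open>Enforces the normalisation in \<open>C_graph\<close>, so that edge functions may be
  given by formulas on the whole line.\<close>

definition extend :: "('e \<Rightarrow> real \<Rightarrow> complex) \<Rightarrow> 'e \<Rightarrow> real \<Rightarrow> complex" where
  "extend f e x = (if e \<in> arcs G \<and> x \<in> {0..len e} then f e x else 0)"

lemma extend_H1:
  assumes g: "\<And>e. e \<in> arcs G \<Longrightarrow> g e \<in> L2_interval (len e) \<and> primitive_on (len e) (f e) (g e)"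
    and u: "\<And>e. e \<in> arcs G \<Longrightarrow> f e 0 = u (tail G e) \<and> f e (len e) = u (head G e)"
  shows "extend f \<in> \<V>" "v \<in> verts G \<Longrightarrow> val (extend f) v = u v"
    "energy k (extend f) = (\<Sum>e\<in>arcs G. integral {0..len e} (\<lambda>x. (cmod (g e x))\<^sup>2 + k\<^sup>2 * (cmod (f e x))\<^sup>2))"
proof -
  have p: "g e \<in> L2_interval (len e) \<and> primitive_on (len e) (extend f e) (g e)" if "e \<in> arcs G" for e
    using g[OF that] that by (auto intro: primitive_on_cong simp: extend_def)
  have ends: "extend f e 0 = u (tail G e) \<and> extend f e (len e) = u (head G e)" if "e \<in> arcs G" for e
    using u[OF that] length_pos[OF that] that by (simp add: extend_def)
  have C: "extend f \<in> C_graph G len"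
    unfolding C_graph_def
  proof (intro CollectI conjI ballI allI impI exI[of _ u])
    show "continuous_on {0..len e} (extend f e)" if "e \<in> arcs G" for e
      using p[OF that] primitive_on_continuous by blast
  qed (use ends in \<open>auto simp: extend_def\<close>)
  show "extend f \<in> \<V>" by (rule energy_eqI(1)[OF C p])
  show "val (extend f) v = u v" if "v \<in> verts G" by (rule val_eqI[OF that ends])
  have "integral {0..len e} (\<lambda>x. (cmod (g e x))\<^sup>2 + k\<^sup>2 * (cmod (extend f e x))\<^sup>2) =
      integral {0..len e} (\<lambda>x. (cmod (g e x))\<^sup>2 + k\<^sup>2 * (cmod (f e x))\<^sup>2)" if "e \<in> arcs G" for e
    by (rule integral_cong) (use that in \<open>auto simp: extend_def\<close>)
  then show "energy k (extend f) = (\<Sum>e\<in>arcs G. integral {0..len e} (\<lambda>x. (cmod (g e x))\<^sup>2 + k\<^sup>2 * (cmod (f e x))\<^sup>2))"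
    by (simp add: energy_eqI(2)[OF C p])
qed

lemma interior_hat:
  assumes k: "0 < k" and e: "e \<in> arcs G" and x: "0 < x" "x < len e"
  obtains h where "h \<in> \<V>" "h e x = 1" "energy k h = k / tanh (k * x) + k / tanh (k * (len e - x))"
proof -
  obtain f g where fg: "g \<in> L2_interval (len e)" "primitive_on (len e) f g" "f 0 = 0" "f x = 1" "f (len e) = 0"
    "integral {0..len e} (\<lambda>x. (cmod (g x))\<^sup>2 + k\<^sup>2 * (cmod (f x))\<^sup>2) = k / tanh (k * x) + k / tanh (k * (len e - x))"
    by (rule hat_exists[OF k x])
  let ?f = "\<lambda>e'. if e' = e then f else (\<lambda>_. 0)" and ?g = "\<lambda>e'. if e' = e then g else (\<lambda>_. 0)"
  have 1: "?g e' \<in> L2_interval (len e') \<and> primitive_on (len e') (?f e') (?g e')" for e'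
    using fg(1,2) zero_primitive by auto
  have 2: "?f e' 0 = (\<lambda>_. 0) (tail G e') \<and> ?f e' (len e') = (\<lambda>_. 0) (head G e')" for e'
    using fg by auto
  note ext = extend_H1[OF 1 2]
  show ?thesis
  proof (rule that[OF ext(1)])
    show "extend ?f e x = 1" using e x fg(4) by (simp add: extend_def)
    have "(\<Sum>e'\<in>arcs G. integral {0..len e'} (\<lambda>x. (cmod (?g e' x))\<^sup>2 + k\<^sup>2 * (cmod (?f e' x))\<^sup>2)) =
      (\<Sum>e'\<in>arcs G. if e' = e then k / tanh (k * x) + k / tanh (k * (len e - x)) else 0)"
      by (rule sum.cong) (simp_all add: fg(6))
    then show "energy k (extend ?f) = k / tanh (k * x) + k / tanh (k * (len e - x))"
      unfolding ext(3) using e by simp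
  qed
qed

text \<open>A ramp from 1 to 0 on each incident edge and 0 elsewhere. Since 1 / tanh decreases, the
  shortest edge bounds the energy of every ramp, which matches the shape of
  \<open>vertex_bound\<close>. The vanishing at the other vertices serves later to isolate a single
  \<open>\<sigma> v\<close>.\<close>

lemma vertex_hat:
  assumes k: "0 < k" and v: "v \<in> verts G"
  obtains h where "h \<in> \<V>" "val h v = 1" "\<forall>w\<in>verts G. w \<noteq> v \<longrightarrow> val h w = 0"
    "energy k h \<le> real (vertex_degree G v) * (k / tanh (k * min_len))"
proof -
  define u :: "'v \<Rightarrow> complex" where "u w = (if w = v then 1 else 0)" for w
  define I where "I = {e \<in> arcs G. tail G e = v \<or> head G e = v}"
  define c where "c = k / tanh (k * min_len)"
  have mono: "k / tanh (k * len e) \<le> c" if e: "e \<in> arcs G" for e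
  proof -
    have "0 < tanh (k * min_len)" "tanh (k * min_len) \<le> tanh (k * len e)"
      using k min_len(1) min_len(2)[OF e] by auto
    then show ?thesis unfolding c_def using k length_pos[OF e] by (intro divide_left_mono mult_pos_pos) auto
  qed
  have ex: "\<exists>p. snd p \<in> L2_interval (len e) \<and> primitive_on (len e) (fst p) (snd p) \<and> fst p 0 = u (tail G e) \<and> fst p (len e) = u (head G e) \<and>
      integral {0..len e} (\<lambda>x. (cmod (snd p x))\<^sup>2 + k\<^sup>2 * (cmod (fst p x))\<^sup>2) \<le> (if e \<in> I then c else 0)"
    if e: "e \<in> arcs G" for e
  proof -
    \<comment> \<open>Absence of loops rules out the fourth case, in which an edge would have to
      carry the value 1 at both ends.\<close>
    consider "tail G e = v" "head G e \<noteq> v" | "tail G e \<noteq> v" "head G e = v" | "tail G e \<noteq> v" "head G e \<noteq> v"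
      using no_loops[OF e] by metis
    then show ?thesis
    proof cases
      case 1
      obtain f g where "g \<in> L2_interval (len e)" "primitive_on (len e) f g" "f 0 = 1" "f (len e) = 0"
        "integral {0..len e} (\<lambda>x. (cmod (g x))\<^sup>2 + k\<^sup>2 * (cmod (f x))\<^sup>2) = k / tanh (k * len e)"
        by (rule ramp_exists[OF k length_pos[OF e]])
      then show ?thesis using 1 mono[OF e] e by (intro exI[of _ "(f, g)"]) (simp add: u_def I_def)
    next
      case 2
      obtain f g where "g \<in> L2_interval (len e)" "primitive_on (len e) f g" "f 0 = 0" "f (len e) = 1"
        "integral {0..len e} (\<lambda>x. (cmod (g x))\<^sup>2 + k\<^sup>2 * (cmod (f x))\<^sup>2) = k / tanh (k * len e)"
        by (rule ramp_exists'[OF k length_pos[OF e]])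
      then show ?thesis using 2 mono[OF e] e by (intro exI[of _ "(f, g)"]) (simp add: u_def I_def)
    next
      case 3
      then show ?thesis using zero_primitive[of "len e" 0] by (intro exI[of _ "(\<lambda>_. 0, \<lambda>_. 0)"]) (simp add: u_def I_def)
    qed
  qed
  have "\<exists>p. \<forall>e\<in>arcs G. snd (p e) \<in> L2_interval (len e) \<and> primitive_on (len e) (fst (p e)) (snd (p e)) \<and>
      fst (p e) 0 = u (tail G e) \<and> fst (p e) (len e) = u (head G e) \<and>
      integral {0..len e} (\<lambda>x. (cmod (snd (p e) x))\<^sup>2 + k\<^sup>2 * (cmod (fst (p e) x))\<^sup>2) \<le> (if e \<in> I then c else 0)"
    by (intro bchoice ballI ex)
  then obtain p where p: "\<And>e. e \<in> arcs G \<Longrightarrow> snd (p e) \<in> L2_interval (len e) \<and> primitive_on (len e) (fst (p e)) (snd (p e))"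
    "\<And>e. e \<in> arcs G \<Longrightarrow> fst (p e) 0 = u (tail G e) \<and> fst (p e) (len e) = u (head G e)"
    "\<And>e. e \<in> arcs G \<Longrightarrow> integral {0..len e} (\<lambda>x. (cmod (snd (p e) x))\<^sup>2 + k\<^sup>2 * (cmod (fst (p e) x))\<^sup>2) \<le> (if e \<in> I then c else 0)"
    by auto
  note ext = extend_H1[where f = "\<lambda>e. fst (p e)" and g = "\<lambda>e. snd (p e)" and u = u, OF p(1,2)]
  have "(\<Sum>e\<in>arcs G. integral {0..len e} (\<lambda>x. (cmod (snd (p e) x))\<^sup>2 + k\<^sup>2 * (cmod (fst (p e) x))\<^sup>2)) \<le>
      (\<Sum>e\<in>arcs G. if e \<in> I then c else 0)"
    by (intro sum_mono p(3))
  also have "\<dots> = real (vertex_degree G v) * c"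
  proof -
    have "arcs G \<inter> I = {e \<in> arcs G. tail G e = v \<or> head G e = v}" by (auto simp: I_def)
    then show ?thesis by (simp add: sum.inter_restrict[symmetric] vertex_degree_def)
  qed
  finally have en: "energy k (extend (\<lambda>e. fst (p e))) \<le> real (vertex_degree G v) * (k / tanh (k * min_len))"
    by (subst ext(3)) (auto simp: c_def)
  show ?thesis
  proof (rule that[OF _ _ _ en])
    show "extend (\<lambda>e. fst (p e)) \<in> \<V>" by (rule ext(1)) auto
    show "val (extend (\<lambda>e. fst (p e))) v = 1" using ext(2)[OF _ _ v] by (simp add: u_def)
    show "\<forall>w\<in>verts G. w \<noteq> v \<longrightarrow> val (extend (\<lambda>e. fst (p e))) w = 0"
      using ext(2) by (simp add: u_def)
  qed
qed

end

section \<open>Eigenvalues of the Schroedinger operator in the abstract setting\<close>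

context schroedinger_graph begin

lemma eig_eq_eigenspace: "cf.eig m = eigenspace G len q \<sigma> m"
proof -
  have "scale_fun (of_real m) f \<in> L2_graph G len" if "f \<in> \<V>" for f
    using H1_L2[OF that] by (auto simp: L2_graph_def scale_fun_def intro: L2_scale)
  then show ?thesis
    by (auto simp: cf.eig_def eigenspace_def schroedinger_operator_def cf.ip.scale_left)
qed

lemma N2_eq: "cf.N2 f = mass f" by (simp add: cf.ip.quad_def inner_diag)

lemma S2_eq: "cf.S2 f = dirichlet f + pot f"
  by (simp add: cf.s.quad_def form_diag quadratic_form_eq)

text \<open>A sequence with finite fibres has infinite range, so the given eigenvalue sequence
  itself provides the infinitely many eigenvalues demanded by \<open>spectral_basis\<close>. The
  sequence produced there satisfies the same defining conditions, and uniqueness identifies the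
  two.\<close>

lemma spectral_form_exists:
  assumes lam: "eigenvalue_sequence G len q \<sigma> lam"
  obtains f where "spectral_form scale_fun \<V> (L2_inner G len) form (k0\<^sup>2) f lam"
proof -
  have iff: "{m. \<exists>f\<in>cf.eig m. f \<noteq> 0} = {m. is_eigenvalue G len q \<sigma> m}"
    by (simp add: is_eigenvalue_def eig_eq_eigenspace)
  have "infinite (range lam)"
  proof
    assume "finite (range lam)"
    moreover have "(UNIV :: nat set) = (\<Union>m\<in>range lam. {n. lam n = m})" by auto
    moreover have "finite {n. lam n = m}" for m using lam by (simp add: eigenvalue_sequence_def)
    ultimately have "finite (UNIV :: nat set)" using finite_UN_I[of "range lam" "\<lambda>m. {n. lam n = m}"] by simp
    then show False by simp
  qed
  then have inf: "infinite {m. \<exists>f\<in>cf.eig m. f \<noteq> 0}"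
    using lam unfolding iff by (simp add: eigenvalue_sequence_def)
  show ?thesis
  proof (rule cf.spectral_basis[OF inf])
    fix f and mu :: "nat \<Rightarrow> real"
    assume f: "\<And>n. f n \<in> cf.eig (mu n)" "\<And>n. cf.N2 (f n) = 1"
      "\<And>k n. k \<noteq> n \<Longrightarrow> L2_inner G len (f k) (f n) = 0"
      "\<And>n g. \<lbrakk>g \<in> \<V>; \<And>k. k < n \<Longrightarrow> L2_inner G len g (f k) = 0\<rbrakk> \<Longrightarrow> mu n * cf.N2 g \<le> cf.S2 g"
      and mu: "mono mu" "filterlim mu at_top sequentially"
      "range mu = {m. \<exists>f\<in>cf.eig m. f \<noteq> 0}"
      "\<And>m. finite {n. mu n = m}" "\<And>m. card {n. mu n = m} = cf.ip.dim (cf.eig m)"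
    have "eigenvalue_sequence G len q \<sigma> mu"
      unfolding eigenvalue_sequence_def
      using mu(1,4) mu(3)[unfolded iff] mu(5)[unfolded eig_eq_eigenspace] by simp
    then have "mu = lam" by (rule eigenvalue_sequence_unique[OF _ lam])
    have "spectral_form scale_fun \<V> (L2_inner G len) form (k0\<^sup>2) f mu"
      by unfold_locales (fact f mu(1,2))+
    then show thesis using that \<open>mu = lam\<close> by blast
  qed
qed

text \<open>The factor in front of the squared value grows like \<open>k\<close>, so a large
  \<open>k\<close> makes the energy coefficient as small as desired at the price of a large multiple
  of the mass. The threshold \<open>2 / c\<close> compensates for the factor 2 lost in passing from
  the energy to the perturbed form.\<close>

lemma functional_small:
  assumes L: "\<And>g k. \<lbrakk>g \<in> \<V>; 0 < k\<rbrakk> \<Longrightarrow> k * tanh (k * (min_len / 2)) * (cmod (L g))\<^sup>2 \<le> energy k g" and c: "0 < c"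
  shows "\<exists>C\<ge>0. \<forall>g\<in>\<V>. (cmod (L g))\<^sup>2 \<le> c * (cf.S2 g + t * cf.N2 g) + C * cf.N2 g"
proof -
  have lim: "filterlim (\<lambda>k. tanh (k * (min_len / 2)) * k) at_top at_top"
    by (rule filterlim_tendsto_pos_mult_at_top[OF tanh_tendsto _ filterlim_ident]) simp
  have "\<forall>\<^sub>F k in at_top. \<epsilon> k < 1 / 2" by (rule order_tendstoD[OF \<epsilon>_tendsto]) simp
  moreover have "\<forall>\<^sub>F k in at_top. 2 / c \<le> tanh (k * (min_len / 2)) * k"
    using lim by (simp add: filterlim_at_top)
  ultimately have "\<forall>\<^sub>F k in at_top. 0 < k \<and> \<epsilon> k < 1 / 2 \<and> 2 / c \<le> tanh (k * (min_len / 2)) * k"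
    using eventually_gt_at_top[of 0] by eventually_elim auto
  then have "\<exists>k. 0 < k \<and> \<epsilon> k < 1 / 2 \<and> 2 / c \<le> tanh (k * (min_len / 2)) * k"
    by (rule eventually_happens'[rotated]) simp
  then obtain k where k: "0 < k" "\<epsilon> k < 1 / 2" and kc: "2 / c \<le> tanh (k * (min_len / 2)) * k" by blast
  define \<theta> where "\<theta> = k * tanh (k * (min_len / 2))"
  have \<theta>: "2 \<le> c * \<theta>" using kc c by (simp add: \<theta>_def field_simps)
  show ?thesis
  proof (intro exI[of _ "c * (k\<^sup>2 + \<bar>t\<bar>)"] conjI ballI)
    show "0 \<le> c * (k\<^sup>2 + \<bar>t\<bar>)" using c by simp
    fix g assume g: "g \<in> \<V>"
    have "1 / 2 * energy k g \<le> (1 - \<epsilon> k) * energy k g" using k energy_nonneg by (intro mult_right_mono) auto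
    then have "energy k g \<le> 2 * (cf.S2 g + k\<^sup>2 * cf.N2 g)"
      using form_energy_bounds(1)[OF g k(1)] by (simp add: N2_eq S2_eq quadratic_form_eq)
    with L[OF g k(1)] have 1: "\<theta> * (cmod (L g))\<^sup>2 \<le> 2 * (cf.S2 g + k\<^sup>2 * cf.N2 g)"
      unfolding \<theta>_def by linarith
    have "2 * (cmod (L g))\<^sup>2 \<le> c * \<theta> * (cmod (L g))\<^sup>2" using \<theta> by (intro mult_right_mono) auto
    also have "\<dots> \<le> c * (2 * (cf.S2 g + k\<^sup>2 * cf.N2 g))"
      using mult_left_mono[OF 1, of c] c by (simp add: mult.assoc)
    also have "c * (2 * (cf.S2 g + k\<^sup>2 * cf.N2 g)) = 2 * (c * (cf.S2 g + k\<^sup>2 * cf.N2 g))" by simp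
    finally have "(cmod (L g))\<^sup>2 \<le> c * (cf.S2 g + k\<^sup>2 * cf.N2 g)" by linarith
    also have "\<dots> \<le> c * (cf.S2 g + t * cf.N2 g + (k\<^sup>2 + \<bar>t\<bar>) * cf.N2 g)"
    proof -
      have "0 \<le> (t + \<bar>t\<bar>) * cf.N2 g" using mass_nonneg by (intro mult_nonneg_nonneg) (auto simp: N2_eq)
      then show ?thesis using c by (intro mult_left_mono) (auto simp: algebra_simps)
    qed
    finally show "(cmod (L g))\<^sup>2 \<le> c * (cf.S2 g + t * cf.N2 g) + c * (k\<^sup>2 + \<bar>t\<bar>) * cf.N2 g"
      by (simp add: algebra_simps)
  qed
qed

end

locale schroedinger_spectrum = schroedinger_graph G len q \<sigma>
  for G :: "('v, 'e) pre_digraph" and len q \<sigma> +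
  fixes f :: "nat \<Rightarrow> 'e \<Rightarrow> real \<Rightarrow> complex" and lam :: "nat \<Rightarrow> real"
  assumes spectral: "spectral_form scale_fun \<V> (L2_inner G len) form (k0\<^sup>2) f lam"

sublocale schroedinger_spectrum \<subseteq> sp: spectral_form scale_fun \<V> "L2_inner G len" form "k0\<^sup>2" f lam
  by (rule spectral)

section \<open>Asymptotics of the resolvent diagonal\<close>

context schroedinger_spectrum begin

definition linear_on_H1 :: "(('e \<Rightarrow> real \<Rightarrow> complex) \<Rightarrow> complex) \<Rightarrow> bool" where
  "linear_on_H1 L \<longleftrightarrow> (\<forall>g\<in>\<V>. \<forall>h\<in>\<V>. L (g + h) = L g + L h) \<and> (\<forall>g\<in>\<V>. \<forall>c. L (scale_fun c g) = c * L g)"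

lemma linear_point: "linear_on_H1 (\<lambda>g. g e x)"
  by (simp add: linear_on_H1_def scale_fun_def)

lemma linear_val: "v \<in> verts G \<Longrightarrow> linear_on_H1 (\<lambda>g. val g v)"
  by (simp add: linear_on_H1_def val_add val_scale)

text \<open>The squared dual norm of \<open>L\<close> for the form shifted by
  \<open>k\<^sup>2\<close>. Taking a functional as argument treats interior evaluations and vertex
  values alike.\<close>

definition kernel :: "real \<Rightarrow> (('e \<Rightarrow> real \<Rightarrow> complex) \<Rightarrow> complex) \<Rightarrow> real" where
  "kernel k L = (\<Sum>n. (cmod (L (f n)))\<^sup>2 / (lam n + k\<^sup>2))"

lemma weight_pos: "k0 \<le> k \<Longrightarrow> 0 < lam n + k\<^sup>2"
  using sp.mu_pos[of "k\<^sup>2" n] power_mono[of k0 k 2] k0(1) by simp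

text \<open>A lower estimate of the free energy, weakened by \<open>1 - \<epsilon> k\<close>, is a
  bound for \<open>L\<close> in the perturbed form, and \<open>functional_Bessel\<close> transfers
  it to the series.\<close>

lemma kernel_upper:
  assumes L: "linear_on_H1 L" and k: "k0 \<le> k" "\<epsilon> k < 1" and d: "0 < d"
    and bound: "\<And>g. g \<in> \<V> \<Longrightarrow> d * (cmod (L g))\<^sup>2 \<le> energy k g"
  shows "summable (\<lambda>n. (cmod (L (f n)))\<^sup>2 / (lam n + k\<^sup>2))"
    "(\<Sum>n<N. (cmod (L (f n)))\<^sup>2 / (lam n + k\<^sup>2)) \<le> kernel k L" "kernel k L \<le> 1 / ((1 - \<epsilon> k) * d)"
proof -
  have kp: "0 < k" "k0\<^sup>2 \<le> k\<^sup>2" using k(1) k0(1) power_mono[of k0 k 2] by auto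
  have bound': "(cmod (L g))\<^sup>2 \<le> 1 / ((1 - \<epsilon> k) * d) * (cf.S2 g + k\<^sup>2 * cf.N2 g)" if g: "g \<in> \<V>" for g
  proof -
    have "(1 - \<epsilon> k) * (d * (cmod (L g))\<^sup>2) \<le> (1 - \<epsilon> k) * energy k g"
      using bound[OF g] k(2) by (intro mult_left_mono) auto
    also have "\<dots> \<le> cf.S2 g + k\<^sup>2 * cf.N2 g"
      using form_energy_bounds(1)[OF g kp(1)] by (simp add: N2_eq S2_eq quadratic_form_eq)
    finally show ?thesis using k(2) d by (simp add: field_simps)
  qed
  have le: "(\<Sum>n<N. (cmod (L (f n)))\<^sup>2 / (lam n + k\<^sup>2)) \<le> 1 / ((1 - \<epsilon> k) * d)" for N
    by (rule sp.functional_Bessel[OF _ _ kp(2) bound']) (use L[unfolded linear_on_H1_def] in blast)+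
  have nn: "0 \<le> (cmod (L (f n)))\<^sup>2 / (lam n + k\<^sup>2)" for n using weight_pos[OF k(1), of n] by simp
  show sm: "summable (\<lambda>n. (cmod (L (f n)))\<^sup>2 / (lam n + k\<^sup>2))"
    by (rule summableI_nonneg_bounded[OF nn le])
  show "(\<Sum>n<N. (cmod (L (f n)))\<^sup>2 / (lam n + k\<^sup>2)) \<le> kernel k L"
    unfolding kernel_def by (rule sum_le_suminf[OF sm]) (use nn in auto)
  show "kernel k L \<le> 1 / ((1 - \<epsilon> k) * d)"
    unfolding kernel_def by (rule suminf_le_const[OF sm le])
qed

text \<open>A dual norm is at least its quotient on one trial function;
  \<open>functional_completeness\<close> is what identifies the series with the dual norm. The
  uniform bound over all \<open>k\<close> supplies the infinitesimal form bound required
  there.\<close>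

lemma kernel_lower:
  assumes L: "linear_on_H1 L" and k: "k0 \<le> k" "\<epsilon> k < 1"
    and unif: "\<And>g k. \<lbrakk>g \<in> \<V>; 0 < k\<rbrakk> \<Longrightarrow> k * tanh (k * (min_len / 2)) * (cmod (L g))\<^sup>2 \<le> energy k g"
    and h: "h \<in> \<V>" "L h = 1" "energy k h \<le> c"
  shows "1 / ((1 + \<epsilon> k) * c) \<le> kernel k L"
proof -
  have kp: "0 < k" "k0\<^sup>2 \<le> k\<^sup>2" using k(1) k0(1) power_mono[of k0 k 2] by auto
  have \<epsilon>0: "0 \<le> \<epsilon> k" unfolding \<epsilon>_def using qC(1) kp(1) min_len(1) by (intro add_nonneg_nonneg divide_nonneg_nonneg sum_nonneg mult_nonneg_nonneg) auto
  define d where "d = k * tanh (k * (min_len / 2))"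
  have d: "0 < d" using kp(1) min_len(1) by (simp add: d_def)
  note up = kernel_upper[OF L k d unif[OF _ kp(1), folded d_def]]
  have kn: "0 \<le> kernel k L" using up(2)[of 0] by simp
  have "(cmod (L h))\<^sup>2 \<le> kernel k L * (cf.S2 h + k\<^sup>2 * cf.N2 h)"
    by (rule sp.functional_completeness[OF _ _ kp(2) functional_small[OF unif] up(2) h(1)])
      (use L[unfolded linear_on_H1_def] in blast)+
  also have "\<dots> \<le> kernel k L * ((1 + \<epsilon> k) * c)"
  proof (rule mult_left_mono[OF _ kn])
    have "cf.S2 h + k\<^sup>2 * cf.N2 h \<le> (1 + \<epsilon> k) * energy k h"
      using form_energy_bounds(2)[OF h(1) kp(1)] by (simp add: N2_eq S2_eq quadratic_form_eq)
    also have "\<dots> \<le> (1 + \<epsilon> k) * c" using h(3) \<epsilon>0 by (intro mult_left_mono) auto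
    finally show "cf.S2 h + k\<^sup>2 * cf.N2 h \<le> (1 + \<epsilon> k) * c" .
  qed
  finally have 1: "1 \<le> kernel k L * ((1 + \<epsilon> k) * c)" using h(2) by simp
  then have "0 < (1 + \<epsilon> k) * c" using kn by (metis less_le_trans not_less zero_less_one mult_nonneg_nonpos)
  then show ?thesis using 1 by (simp add: field_simps)
qed

lemma eventually_k: "\<forall>\<^sub>F k in at_top. k0 \<le> k \<and> \<epsilon> k < 1 / 2"
proof -
  have "\<forall>\<^sub>F k in at_top. \<epsilon> k < 1 / 2" by (rule order_tendstoD[OF \<epsilon>_tendsto]) simp
  then show ?thesis using eventually_ge_at_top[of k0] by eventually_elim auto
qed

text \<open>Free legs give the upper estimate with tanh, the hat vanishing at both ends gives the
  lower one with 1 / tanh. Both squeeze to 1/2, the two legs contributing 1 each in the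
  denominator.\<close>

lemma interior_kernel_tendsto:
  assumes e: "e \<in> arcs G" and x: "0 < x" "x < len e"
  shows "((\<lambda>k. k * kernel k (\<lambda>g. g e x)) \<longlongrightarrow> 1 / 2) at_top"
proof (rule tendsto_sandwich)
  have y: "0 < len e - x" using x by simp
  let ?l = "\<lambda>k. 1 / ((1 + \<epsilon> k) * (1 / tanh (k * x) + 1 / tanh (k * (len e - x))))"
  let ?u = "\<lambda>k. 1 / ((1 - \<epsilon> k) * (tanh (k * x) + tanh (k * (len e - x))))"
  have "((\<lambda>k. ?l k) \<longlongrightarrow> 1 / ((1 + 0) * (1 / 1 + 1 / 1))) at_top"
    by (intro tendsto_intros \<epsilon>_tendsto tanh_scaled_tendsto x y) auto
  then show "(?l \<longlongrightarrow> 1 / 2) at_top" by simp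
  have "((\<lambda>k. ?u k) \<longlongrightarrow> 1 / ((1 - 0) * (1 + 1))) at_top"
    by (intro tendsto_intros \<epsilon>_tendsto tanh_scaled_tendsto x y) auto
  then show "(?u \<longlongrightarrow> 1 / 2) at_top" by simp
  show "\<forall>\<^sub>F k in at_top. ?l k \<le> k * kernel k (\<lambda>g. g e x)"
    using eventually_k
  proof eventually_elim
    case (elim k)
    then have k: "k0 \<le> k" "\<epsilon> k < 1" "0 < k" using k0(1) by auto
    obtain h where h: "h \<in> \<V>" "h e x = 1" "energy k h = k / tanh (k * x) + k / tanh (k * (len e - x))"
      by (rule interior_hat[OF k(3) e x])
    have "1 / ((1 + \<epsilon> k) * (k / tanh (k * x) + k / tanh (k * (len e - x)))) \<le> kernel k (\<lambda>g. g e x)"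
      by (rule kernel_lower[OF linear_point k(1,2) uniform_bound h(1,2) eq_refl[OF h(3)]]) (use e x in auto)
    then have "k * (1 / ((1 + \<epsilon> k) * (k * (1 / tanh (k * x) + 1 / tanh (k * (len e - x)))))) \<le> k * kernel k (\<lambda>g. g e x)"
      using k(3) by (intro mult_left_mono) (auto simp: distrib_left)
    moreover have "k * (1 / ((1 + \<epsilon> k) * (k * z))) = 1 / ((1 + \<epsilon> k) * z)" for z using k(3) by simp
    ultimately show ?case by metis
  qed
  show "\<forall>\<^sub>F k in at_top. k * kernel k (\<lambda>g. g e x) \<le> ?u k"
    using eventually_k
  proof eventually_elim
    case (elim k)
    then have k: "k0 \<le> k" "\<epsilon> k < 1" "0 < k" using k0(1) by auto
    have d: "0 < k * (tanh (k * x) + tanh (k * (len e - x)))" using k x by (intro mult_pos_pos add_pos_pos) auto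
    have "kernel k (\<lambda>g. g e x) \<le> 1 / ((1 - \<epsilon> k) * (k * (tanh (k * x) + tanh (k * (len e - x)))))"
      by (rule kernel_upper(3)[OF linear_point k(1,2) d])
        (use interior_bound[OF _ e, of _ x k] x in \<open>auto simp: distrib_left\<close>)
    then have "k * kernel k (\<lambda>g. g e x) \<le> k * (1 / ((1 - \<epsilon> k) * (k * (tanh (k * x) + tanh (k * (len e - x))))))"
      using k(3) by (intro mult_left_mono) auto
    moreover have "k * (1 / ((1 - \<epsilon> k) * (k * z))) = 1 / ((1 - \<epsilon> k) * z)" for z using k(3) by simp
    ultimately show ?case by metis
  qed
qed

text \<open>The same squeeze with as many legs as the degree. Both estimates use the minimal length
  on every leg, which is harmless because \<open>tanh (k * min_len)\<close> tends to 1.\<close>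

lemma vertex_kernel_tendsto:
  assumes v: "v \<in> verts G"
  shows "((\<lambda>k. k * kernel k (\<lambda>g. val g v)) \<longlongrightarrow> 1 / real (vertex_degree G v)) at_top"
proof (rule tendsto_sandwich)
  define n where "n = real (vertex_degree G v)"
  have n: "0 < n" using vertex_degree_pos[OF v] by (simp add: n_def)
  let ?l = "\<lambda>k. 1 / ((1 + \<epsilon> k) * (n * (1 / tanh (k * min_len))))"
  let ?u = "\<lambda>k. 1 / ((1 - \<epsilon> k) * (n * tanh (k * min_len)))"
  have "((\<lambda>k. ?l k) \<longlongrightarrow> 1 / ((1 + 0) * (n * (1 / 1)))) at_top"
    using n by (intro tendsto_intros \<epsilon>_tendsto tanh_scaled_tendsto min_len) auto
  then show "(?l \<longlongrightarrow> 1 / real (vertex_degree G v)) at_top" by (simp add: n_def)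
  have "((\<lambda>k. ?u k) \<longlongrightarrow> 1 / ((1 - 0) * (n * 1))) at_top"
    using n by (intro tendsto_intros \<epsilon>_tendsto tanh_scaled_tendsto min_len) auto
  then show "(?u \<longlongrightarrow> 1 / real (vertex_degree G v)) at_top" by (simp add: n_def)
  show "\<forall>\<^sub>F k in at_top. ?l k \<le> k * kernel k (\<lambda>g. val g v)"
    using eventually_k
  proof eventually_elim
    case (elim k)
    then have k: "k0 \<le> k" "\<epsilon> k < 1" "0 < k" using k0(1) by auto
    obtain h where h: "h \<in> \<V>" "val h v = 1" "energy k h \<le> n * (k / tanh (k * min_len))"
      using vertex_hat[OF k(3) v] unfolding n_def by blast
    have "1 / ((1 + \<epsilon> k) * (n * (k / tanh (k * min_len)))) \<le> kernel k (\<lambda>g. val g v)"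
      by (rule kernel_lower[OF linear_val[OF v] k(1,2) vertex_uniform_bound[OF _ v] h]) auto
    then have "k * (1 / ((1 + \<epsilon> k) * (n * (k / tanh (k * min_len))))) \<le> k * kernel k (\<lambda>g. val g v)"
      using k(3) by (intro mult_left_mono) auto
    moreover have "k * (1 / ((1 + \<epsilon> k) * (n * (k / z)))) = 1 / ((1 + \<epsilon> k) * (n * (1 / z)))" for z using k(3) by simp
    ultimately show ?case by metis
  qed
  show "\<forall>\<^sub>F k in at_top. k * kernel k (\<lambda>g. val g v) \<le> ?u k"
    using eventually_k
  proof eventually_elim
    case (elim k)
    then have k: "k0 \<le> k" "\<epsilon> k < 1" "0 < k" using k0(1) by auto
    have d: "0 < n * (k * tanh (k * min_len))" using k n min_len(1) by (intro mult_pos_pos) auto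
    have "kernel k (\<lambda>g. val g v) \<le> 1 / ((1 - \<epsilon> k) * (n * (k * tanh (k * min_len))))"
      by (rule kernel_upper(3)[OF linear_val[OF v] k(1,2) d]) (use vertex_bound k in \<open>auto simp: n_def\<close>)
    then have "k * kernel k (\<lambda>g. val g v) \<le> k * (1 / ((1 - \<epsilon> k) * (n * (k * tanh (k * min_len)))))"
      using k(3) by (intro mult_left_mono) auto
    moreover have "k * (1 / ((1 - \<epsilon> k) * (n * (k * z)))) = 1 / ((1 - \<epsilon> k) * (n * z))" for z using k(3) by simp
    ultimately show ?case by metis
  qed
qed

end

section \<open>The trace inequality\<close>

context schroedinger_spectrum begin

text \<open>
  By Abel summation, the partial sums weighted with \<open>1 / (lam n + k\<^sup>2)\<close> are nonnegative as well; multiplied by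
  \<open>k\<close>, they tend to half of the asserted quantity as first the number of terms and then \<open>k\<close> goes to infinity.
\<close>

theorem trace_inequality:
  assumes p: "admissible_potential G len p"
    and sums: "\<And>N. 0 \<le> (\<Sum>n<N. schroedinger_graph.pot G len p \<tau> (f n))"
  shows "0 \<le> graph_integral G len p + 2 * (\<Sum>v\<in>verts G. \<tau> v / real (vertex_degree G v))"
proof -
  interpret P: schroedinger_graph G len p \<tau> by unfold_locales (rule p)
  let ?w = "\<lambda>k n. 1 / (lam n + k\<^sup>2)"
  define T where "T k = (\<Sum>e\<in>arcs G. \<integral>x. p e x * (k * kernel k (\<lambda>g. g e x)) \<partial>leb (len e))
      + (\<Sum>v\<in>verts G. \<tau> v * (k * kernel k (\<lambda>g. val g v)))" for k
  have pint: "integrable (leb (len e)) (p e)" if e: "e \<in> arcs G" for e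
    using P.q_mult_integrable[OF e integrable_leb_continuous[of "len e" "\<lambda>_. 1::real"]] by simp
  have facts: "0 < k" "\<epsilon> k < 1" "0 < k * tanh (k * (min_len / 2))" if "k0 \<le> k \<and> \<epsilon> k < 1 / 2" for k
    using that k0(1) min_len(1) by auto
  have up: "summable (\<lambda>n. (cmod (f n e x))\<^sup>2 / (lam n + k\<^sup>2))"
    "(\<Sum>n<N. (cmod (f n e x))\<^sup>2 / (lam n + k\<^sup>2)) \<le> kernel k (\<lambda>g. g e x)"
    "kernel k (\<lambda>g. g e x) \<le> 1 / ((1 - \<epsilon> k) * (k * tanh (k * (min_len / 2))))"
    if k: "k0 \<le> k \<and> \<epsilon> k < 1 / 2" and e: "e \<in> arcs G" and x: "x \<in> {0..len e}" for k e x N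
    by (rule kernel_upper[OF linear_point[of e x] conjunct1[OF k] facts(2,3)[OF k]],
      rule uniform_bound[OF _ e x less_imp_le[OF facts(1)[OF k]]], assumption)+
  have upv: "summable (\<lambda>n. (cmod (val (f n) v))\<^sup>2 / (lam n + k\<^sup>2))"
    if k: "k0 \<le> k \<and> \<epsilon> k < 1 / 2" and v: "v \<in> verts G" for k v
    by (rule kernel_upper(1)[OF linear_val[OF v] conjunct1[OF k] facts(2,3)[OF k]],
      rule vertex_uniform_bound[OF _ v less_imp_le[OF facts(1)[OF k]]])
  have partial_cont: "continuous_on {0..len e} (\<lambda>x. \<Sum>n<N. (cmod (f n e x))\<^sup>2 / (lam n + k\<^sup>2))"
    if k: "k0 \<le> k \<and> \<epsilon> k < 1 / 2" and e: "e \<in> arcs G" for k e N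
    using weight_pos[OF conjunct1[OF k]] by (intro continuous_intros H1_continuous[OF sp.f_V e]) (metis less_irrefl)
  have partial_nonneg: "0 \<le> (\<Sum>n<N. (cmod (f n e x))\<^sup>2 / (lam n + k\<^sup>2))"
    if k: "k0 \<le> k \<and> \<epsilon> k < 1 / 2" for k e x N
    using weight_pos[OF conjunct1[OF k]] by (intro sum_nonneg divide_nonneg_pos) auto
  have conv: "(\<lambda>N. \<Sum>n<N. (cmod (f n e x))\<^sup>2 / (lam n + k\<^sup>2)) \<longlonglongrightarrow> kernel k (\<lambda>g. g e x)"
    if k: "k0 \<le> k \<and> \<epsilon> k < 1 / 2" and e: "e \<in> arcs G" and x: "x \<in> {0..len e}" for k e x
    unfolding kernel_def by (rule summable_LIMSEQ[OF up(1)[OF that]])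
  have kernel_meas: "(\<lambda>x. kernel k (\<lambda>g. g e x)) \<in> borel_measurable (leb (len e))"
    if k: "k0 \<le> k \<and> \<epsilon> k < 1 / 2" and e: "e \<in> arcs G" for k e
    by (rule borel_measurable_LIMSEQ_real[where u = "\<lambda>N x. \<Sum>n<N. (cmod (f n e x))\<^sup>2 / (lam n + k\<^sup>2)"])
      (use conv[OF k e] measurable_leb_continuous[OF partial_cont[OF that]] in auto)
  have T_nonneg: "0 \<le> T k" if k: "k0 \<le> k \<and> \<epsilon> k < 1 / 2" for k
  proof -
    define K where "K = 1 / ((1 - \<epsilon> k) * (k * tanh (k * (min_len / 2))))"
    \<comment> \<open>The partial sums of \<open>T k / k\<close>. Exchanging summation and
      integration turns them into the Abel-weighted sums of \<open>P.pot (f n)\<close>; dominated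
      convergence with the constant \<open>K\<close>, which is uniform on the edge, takes N to
      infinity.\<close>
    define R where "R N = (\<Sum>e\<in>arcs G. \<integral>x. p e x * (\<Sum>n<N. (cmod (f n e x))\<^sup>2 / (lam n + k\<^sup>2)) \<partial>leb (len e))
      + (\<Sum>v\<in>verts G. \<tau> v * (\<Sum>n<N. (cmod (val (f n) v))\<^sup>2 / (lam n + k\<^sup>2)))" for N
    have "R N = (\<Sum>n<N. ?w k n * P.pot (f n))" for N
    proof -
      have "(\<integral>x. p e x * (\<Sum>n<N. (cmod (f n e x))\<^sup>2 / (lam n + k\<^sup>2)) \<partial>leb (len e)) =
          (\<Sum>n<N. ?w k n * (\<integral>x. p e x * (cmod (f n e x))\<^sup>2 \<partial>leb (len e)))" if e: "e \<in> arcs G" for e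
      proof -
        have i: "integrable (leb (len e)) (\<lambda>x. p e x * (cmod (f n e x))\<^sup>2)" for n
          using P.q_mult_integrable[OF e L2_square_integrable[OF H1_L2[OF sp.f_V e]], of n] by simp
        have "(\<lambda>x. p e x * (\<Sum>n<N. (cmod (f n e x))\<^sup>2 / (lam n + k\<^sup>2))) = (\<lambda>x. \<Sum>n<N. ?w k n * (p e x * (cmod (f n e x))\<^sup>2))"
          by (simp add: sum_distrib_left mult_ac)
        then show ?thesis using i by (simp add: Bochner_Integration.integral_sum)
      qed
      then have "R N = (\<Sum>e\<in>arcs G. \<Sum>n<N. ?w k n * (\<integral>x. p e x * (cmod (f n e x))\<^sup>2 \<partial>leb (len e)))
          + (\<Sum>v\<in>verts G. \<Sum>n<N. ?w k n * (\<tau> v * (cmod (val (f n) v))\<^sup>2))"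
        by (simp add: R_def sum_distrib_left mult_ac)
      also have "\<dots> = (\<Sum>n<N. ?w k n * P.pot (f n))"
        unfolding P.pot_def graph_integral_def
        by (subst (1 2) sum.swap) (simp add: sum.distrib sum_distrib_left distrib_left)
      finally show ?thesis .
    qed
    moreover have "0 \<le> (\<Sum>n<N. ?w k n * P.pot (f n))" for N
    proof (rule Abel_sum_nonneg[OF _ _ sums])
      show "0 \<le> ?w k n" for n using weight_pos[OF conjunct1[OF k], of n] by simp
      show "?w k (Suc n) \<le> ?w k n" for n
        using weight_pos[OF conjunct1[OF k], of n] monoD[OF sp.mu_mono, of n "Suc n"] by (intro divide_left_mono mult_pos_pos) auto
    qed
    ultimately have R0: "0 \<le> R N" for N by simp
    have "R \<longlonglongrightarrow> (\<Sum>e\<in>arcs G. \<integral>x. p e x * kernel k (\<lambda>g. g e x) \<partial>leb (len e))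
      + (\<Sum>v\<in>verts G. \<tau> v * kernel k (\<lambda>g. val g v))"
      unfolding R_def
    proof (intro tendsto_add tendsto_sum)
      fix e assume e: "e \<in> arcs G"
      show "(\<lambda>N. \<integral>x. p e x * (\<Sum>n<N. (cmod (f n e x))\<^sup>2 / (lam n + k\<^sup>2)) \<partial>leb (len e)) \<longlonglongrightarrow>
          (\<integral>x. p e x * kernel k (\<lambda>g. g e x) \<partial>leb (len e))"
      proof (rule integral_dominated_convergence[where w = "\<lambda>x. \<bar>p e x\<bar> * K"])
        show "(\<lambda>x. p e x * kernel k (\<lambda>g. g e x)) \<in> borel_measurable (leb (len e))"
          by (intro borel_measurable_times P.q_measurable e kernel_meas k)
        show "(\<lambda>x. p e x * (\<Sum>n<N. (cmod (f n e x))\<^sup>2 / (lam n + k\<^sup>2))) \<in> borel_measurable (leb (len e))" for N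
          by (intro borel_measurable_times P.q_measurable e measurable_leb_continuous[OF partial_cont[OF k]])
        show "integrable (leb (len e)) (\<lambda>x. \<bar>p e x\<bar> * K)" using pint[OF e] by simp
        show "AE x in leb (len e). (\<lambda>N. p e x * (\<Sum>n<N. (cmod (f n e x))\<^sup>2 / (lam n + k\<^sup>2))) \<longlonglongrightarrow> p e x * kernel k (\<lambda>g. g e x)"
          by (rule AE_I2, rule tendsto_mult_left, rule conv[OF k e]) simp
        show "AE x in leb (len e). norm (p e x * (\<Sum>n<N. (cmod (f n e x))\<^sup>2 / (lam n + k\<^sup>2))) \<le> \<bar>p e x\<bar> * K" for N
        proof (rule AE_I2)
          fix x assume "x \<in> space (leb (len e))"
          then have x: "x \<in> {0..len e}" by simp
          have "(\<Sum>n<N. (cmod (f n e x))\<^sup>2 / (lam n + k\<^sup>2)) \<le> K" unfolding K_def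
            using up(2)[OF k e x, of N] up(3)[OF k e x] by linarith
          moreover have "0 \<le> (\<Sum>n<N. (cmod (f n e x))\<^sup>2 / (lam n + k\<^sup>2))" by (rule partial_nonneg[OF k])
          ultimately show "norm (p e x * (\<Sum>n<N. (cmod (f n e x))\<^sup>2 / (lam n + k\<^sup>2))) \<le> \<bar>p e x\<bar> * K"
            by (simp add: abs_mult mult_left_mono)
        qed
      qed
    next
      fix v assume v: "v \<in> verts G"
      show "(\<lambda>N. \<tau> v * (\<Sum>n<N. (cmod (val (f n) v))\<^sup>2 / (lam n + k\<^sup>2))) \<longlonglongrightarrow> \<tau> v * kernel k (\<lambda>g. val g v)"
        unfolding kernel_def by (intro tendsto_mult_left summable_LIMSEQ upv[OF k v])
    qed
    then have "0 \<le> (\<Sum>e\<in>arcs G. \<integral>x. p e x * kernel k (\<lambda>g. g e x) \<partial>leb (len e))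
      + (\<Sum>v\<in>verts G. \<tau> v * kernel k (\<lambda>g. val g v))" (is "0 \<le> ?Z")
      by (rule LIMSEQ_le_const) (use R0 in auto)
    then have "0 \<le> k * ?Z" using facts(1)[OF k] by simp
    also have "k * ?Z = T k" by (simp add: T_def distrib_left sum_distrib_left mult_ac flip: Bochner_Integration.integral_mult_right_zero)
    finally show ?thesis .
  qed
  \<comment> \<open>The second limit runs along natural numbers, as dominated convergence is about
    sequences.\<close>
  have seq: "\<forall>\<^sub>F j in sequentially. k0 \<le> real j \<and> \<epsilon> (real j) < 1 / 2 \<and> 1 / 2 \<le> tanh (real j * (min_len / 2))"
  proof -
    have "\<forall>\<^sub>F k in at_top. 1 / 2 < tanh (k * (min_len / 2))" by (rule order_tendstoD[OF tanh_tendsto]) simp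
    with eventually_k have "\<forall>\<^sub>F k in at_top. k0 \<le> k \<and> \<epsilon> k < 1 / 2 \<and> 1 / 2 \<le> tanh (k * (min_len / 2))"
      by eventually_elim auto
    then show ?thesis by (rule eventually_compose_filterlim[OF _ filterlim_real_sequentially])
  qed
  have "(\<lambda>j. T (real j)) \<longlonglongrightarrow> (\<Sum>e\<in>arcs G. \<integral>x. p e x * (1 / 2) \<partial>leb (len e)) + (\<Sum>v\<in>verts G. \<tau> v * (1 / real (vertex_degree G v)))"
    unfolding T_def
  proof (intro tendsto_add tendsto_sum tendsto_mult_left)
    show "(\<lambda>j. real j * kernel (real j) (\<lambda>g. val g v)) \<longlonglongrightarrow> 1 / real (vertex_degree G v)" if "v \<in> verts G" for v
      by (rule filterlim_compose[OF vertex_kernel_tendsto[OF that] filterlim_real_sequentially])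
  next
    fix e assume e: "e \<in> arcs G"
    \<comment> \<open>The dominating function is valid for large indices only, so the sequence is
      shifted by \<open>J\<close>. Its constant 4 arises because both
      \<open>1 - \<epsilon> k\<close> and the tanh are at least 1/2 from there on.\<close>
    obtain J where J: "\<And>j. j \<ge> J \<Longrightarrow> k0 \<le> real j \<and> \<epsilon> (real j) < 1 / 2 \<and> 1 / 2 \<le> tanh (real j * (min_len / 2))"
      using seq unfolding eventually_sequentially by blast
    show "(\<lambda>j. \<integral>x. p e x * (real j * kernel (real j) (\<lambda>g. g e x)) \<partial>leb (len e)) \<longlonglongrightarrow> (\<integral>x. p e x * (1 / 2) \<partial>leb (len e))"
    proof (rule LIMSEQ_offset[where k = J], rule integral_dominated_convergence[where w = "\<lambda>x. \<bar>p e x\<bar> * 4"])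
      show "(\<lambda>x. p e x * (1 / 2)) \<in> borel_measurable (leb (len e))"
        by (intro borel_measurable_times P.q_measurable e borel_measurable_const)
      show "(\<lambda>x. p e x * (real (j + J) * kernel (real (j + J)) (\<lambda>g. g e x))) \<in> borel_measurable (leb (len e))" for j
        by (intro borel_measurable_times P.q_measurable e borel_measurable_const kernel_meas) (use J[of "j + J"] in auto)
      show "integrable (leb (len e)) (\<lambda>x. \<bar>p e x\<bar> * 4)" using pint[OF e] by simp
      show "AE x in leb (len e). (\<lambda>j. p e x * (real (j + J) * kernel (real (j + J)) (\<lambda>g. g e x))) \<longlonglongrightarrow> p e x * (1 / 2)"
      proof (rule AE_I2, rule tendsto_mult_left)
        fix x assume "x \<in> space (leb (len e))"
        then have "0 < x" "x < len e" by auto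
        from filterlim_compose[OF interior_kernel_tendsto[OF e this] filterlim_real_sequentially]
        show "(\<lambda>j. real (j + J) * kernel (real (j + J)) (\<lambda>g. g e x)) \<longlonglongrightarrow> 1 / 2"
          by (rule LIMSEQ_ignore_initial_segment)
      qed
      show "AE x in leb (len e). norm (p e x * (real (j + J) * kernel (real (j + J)) (\<lambda>g. g e x))) \<le> \<bar>p e x\<bar> * 4" for j
      proof (rule AE_I2)
        fix x assume "x \<in> space (leb (len e))"
        then have x: "x \<in> {0..len e}" by simp
        define k where "k = real (j + J)"
        have Jk: "k0 \<le> k" "\<epsilon> k < 1 / 2" "1 / 2 \<le> tanh (k * (min_len / 2))" using J[of "j + J"] by (auto simp: k_def)
        then have k: "k0 \<le> k \<and> \<epsilon> k < 1 / 2" by simp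
        have kp: "0 < k" using facts(1)[OF k] .
        have "0 \<le> kernel k (\<lambda>g. g e x)" using up(2)[OF k e x, of 0] by simp
        moreover have "k * kernel k (\<lambda>g. g e x) \<le> 4"
        proof -
          have "1 / 2 * (1 / 2) \<le> (1 - \<epsilon> k) * tanh (k * (min_len / 2))"
            using Jk by (intro mult_mono) auto
          then have q: "1 / ((1 - \<epsilon> k) * tanh (k * (min_len / 2))) \<le> 4"
            by (simp add: field_simps)
          have "k * kernel k (\<lambda>g. g e x) \<le> k * (1 / ((1 - \<epsilon> k) * (k * tanh (k * (min_len / 2)))))"
            using up(3)[OF k e x] kp by (intro mult_left_mono) auto
          also have "\<dots> = 1 / ((1 - \<epsilon> k) * tanh (k * (min_len / 2)))" using kp by simp
          finally show ?thesis using q by linarith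
        qed
        ultimately have "\<bar>k * kernel k (\<lambda>g. g e x)\<bar> \<le> 4" using kp by (simp add: abs_mult)
        then show "norm (p e x * (real (j + J) * kernel (real (j + J)) (\<lambda>g. g e x))) \<le> \<bar>p e x\<bar> * 4"
          unfolding k_def[symmetric] real_norm_def abs_mult[of "p e x"] by (intro mult_left_mono) auto
      qed
    qed
  qed
  then have "0 \<le> (\<Sum>e\<in>arcs G. \<integral>x. p e x * (1 / 2) \<partial>leb (len e)) + (\<Sum>v\<in>verts G. \<tau> v * (1 / real (vertex_degree G v)))"
  proof (rule tendsto_lowerbound)
    show "\<forall>\<^sub>F j in sequentially. 0 \<le> T (real j)" using seq by eventually_elim (rule T_nonneg, simp)
  qed simp
  then show ?thesis by (simp add: graph_integral_def sum_divide_distrib[symmetric])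
qed

end

section \<open>The inverse spectral theorem\<close>

context metric_graph begin

definition one :: "'e \<Rightarrow> real \<Rightarrow> complex" where "one = extend (\<lambda>_ _. 1)"

lemma one: "one \<in> \<V>" "v \<in> verts G \<Longrightarrow> val one v = 1" "\<lbrakk>e \<in> arcs G; x \<in> {0..len e}\<rbrakk> \<Longrightarrow> one e x = 1"
  unfolding one_def using extend_H1[of "\<lambda>_ _. 0" "\<lambda>_ _. 1" "\<lambda>_. 1"] zero_primitive by (auto simp: extend_def)

lemma D_one: "e \<in> arcs G \<Longrightarrow> AE x in leb (len e). D one e x = 0"
  by (rule D_unique[OF one(1)])
    (use zero_primitive in \<open>auto intro: primitive_on_cong[of _ "\<lambda>_. 1"] simp: one(3)\<close>)

lemma graph_integral_D_one: "graph_integral G len (\<lambda>e x. D one e x * cnj (h e x)) = 0"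
  unfolding graph_integral_def
proof (rule sum.neutral, rule ballI)
  fix e assume e: "e \<in> arcs G"
  have "AE x in leb (len e). D one e x * cnj (h e x) = 0"
    by (rule AE_mp[OF D_one[OF e]]) simp
  then show "(\<integral>x. D one e x * cnj (h e x) \<partial>leb (len e)) = 0" by (rule integral_eq_zero_AE)
qed

end

context schroedinger_graph begin

lemma form_one:
  assumes h: "h \<in> \<V>"
  shows "form one h = graph_integral G len (\<lambda>e x. of_real (q e x) * cnj (h e x)) + (\<Sum>v\<in>verts G. of_real (\<sigma> v) * cnj (val h v))"
proof -
  have "graph_integral G len (\<lambda>e x. of_real (q e x) * one e x * cnj (h e x)) = graph_integral G len (\<lambda>e x. of_real (q e x) * cnj (h e x))"
    unfolding graph_integral_def by (intro sum.cong refl Bochner_Integration.integral_cong) (simp add: one(3))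
  then show ?thesis by (simp add: sesquilinear_form_def graph_integral_D_one one(2))
qed

lemma S2_one: "cf.S2 one = graph_integral G len q + (\<Sum>v\<in>verts G. \<sigma> v)"
proof -
  have "graph_integral G len (\<lambda>e x. of_real (q e x) * cnj (one e x)) = complex_of_real (graph_integral G len q)"
    unfolding graph_integral_def of_real_sum
  proof (rule sum.cong[OF refl])
    fix e assume "e \<in> arcs G"
    then have "(\<integral>x. of_real (q e x) * cnj (one e x) \<partial>leb (len e)) = (\<integral>x. complex_of_real (q e x) \<partial>leb (len e))"
      by (intro Bochner_Integration.integral_cong refl) (simp add: one(3))
    then show "(\<integral>x. of_real (q e x) * cnj (one e x) \<partial>leb (len e)) = complex_of_real (\<integral>x. q e x \<partial>leb (len e))" by simp
  qed
  then show ?thesis by (simp add: cf.s.quad_def form_one[OF one(1)] one(2))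
qed

text \<open>Against the constant function the Dirichlet part drops out, so the hypothesis says that
  the functional with density \<open>q\<close> and vertex weights \<open>\<sigma>\<close> vanishes
  on H1. Test functions inside an edge isolate \<open>q\<close>, and smoothness upgrades the result
  to every interior point; vertex hats then isolate each \<open>\<sigma> v\<close>.\<close>

lemma potential_zero:
  assumes 0: "\<And>h. h \<in> \<V> \<Longrightarrow> form one h = 0"
  shows "(\<forall>e\<in>arcs G. \<forall>x\<in>{0<..<len e}. q e x = 0) \<and> (\<forall>v\<in>verts G. \<sigma> v = 0)"
proof -
  have q0: "q e x = 0" if e: "e \<in> arcs G" and x: "x \<in> {0<..<len e}" for e x
  proof -
    let ?q = "\<lambda>x. complex_of_real (q e x)"
    have qi: "integrable (leb (len e)) (\<lambda>x. q e x * (h x :: real))" if "continuous_on {0..len e} h" for h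
      using q_mult_integrable[OF e integrable_leb_continuous[OF that]] by simp
    have qL: "?q \<in> L2_interval (len e)"
    proof -
      have "integrable (leb (len e)) (\<lambda>x. q e x * (q e x * 1))"
        using q_mult_integrable[OF e qi[of "\<lambda>_. 1"]] by simp
      then show ?thesis using q_measurable[OF e] by (simp add: L2_interval_def power2_eq_square)
    qed
    \<comment> \<open>The fundamental lemma of the calculus of variations in disguise: if
      \<open>q\<close> annihilates all test functions, it is a weak derivative of 0, hence all its
      integrals over subintervals vanish.\<close>
    have "has_weak_deriv (len e) (\<lambda>_. 0) ?q"
      unfolding has_weak_deriv_def
    proof
      fix \<phi> assume \<phi>: "\<phi> \<in> test_functions (len e)"
      note tf = test_function_properties[OF \<phi>]
      let ?f = "\<lambda>e'. if e' = e then (\<lambda>x. complex_of_real (\<phi> x)) else (\<lambda>_. 0)"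
      let ?g = "\<lambda>e'. if e' = e then (\<lambda>x. complex_of_real (deriv \<phi> x)) else (\<lambda>_. 0)"
      have "primitive_on (len e) (\<lambda>x. complex_of_real (\<phi> x)) (\<lambda>x. complex_of_real (deriv \<phi> x))"
        unfolding primitive_on_def
      proof (intro allI impI)
        fix x y :: real assume "x \<le> y"
        have "((\<lambda>x. complex_of_real (deriv \<phi> x)) has_integral of_real (\<phi> y) - of_real (\<phi> x)) {x..y}"
          by (rule fundamental_theorem_of_calculus[OF \<open>x \<le> y\<close>], rule has_vector_derivative_of_real)
            (use tf(3) in \<open>auto simp: has_real_derivative_iff_has_vector_derivative intro: has_vector_derivative_at_within\<close>)
        then show "complex_of_real (\<phi> y) - of_real (\<phi> x) = integral {x..y} (\<lambda>x. of_real (deriv \<phi> x))"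
          by (simp add: integral_unique)
      qed
      then have 1: "?g e' \<in> L2_interval (len e') \<and> primitive_on (len e') (?f e') (?g e')" for e'
        using zero_primitive tf(5) by (auto intro!: L2_continuous continuous_intros)
      have 2: "?f e' 0 = (\<lambda>_. 0) (tail G e') \<and> ?f e' (len e') = (\<lambda>_. 0) (head G e')" for e'
        using tf(1,2) by auto
      note ext = extend_H1[OF 1 2]
      have "0 = graph_integral G len (\<lambda>e x. of_real (q e x) * cnj (extend ?f e x))"
        using 0[OF ext(1)] form_one[OF ext(1)] ext(2) by simp
      also have "\<dots> = (\<Sum>e'\<in>arcs G. if e' = e then \<integral>x. ?q x * of_real (\<phi> x) \<partial>leb (len e) else 0)"
        unfolding graph_integral_def
      proof (rule sum.cong[OF refl])
        fix e' assume e': "e' \<in> arcs G"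
        have "(\<integral>x. of_real (q e' x) * cnj (extend ?f e' x) \<partial>leb (len e')) =
            (\<integral>x. (if e' = e then ?q x * of_real (\<phi> x) else 0) \<partial>leb (len e'))"
          using e' by (intro Bochner_Integration.integral_cong refl) (simp add: extend_def)
        then show "(\<integral>x. of_real (q e' x) * cnj (extend ?f e' x) \<partial>leb (len e')) =
            (if e' = e then \<integral>x. ?q x * of_real (\<phi> x) \<partial>leb (len e) else 0)" by simp
      qed
      finally have "(\<integral>x. ?q x * of_real (\<phi> x) \<partial>leb (len e)) = 0" using e by simp
      then show "(\<integral>x. 0 * of_real (deriv \<phi> x) \<partial>leb (len e)) = - (\<integral>x. ?q x * of_real (\<phi> x) \<partial>leb (len e))" by simp
    qed
    then have prim: "primitive_on (len e) (\<lambda>_. 0) ?q"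
      using weak_deriv_iff_primitive[OF length_pos[OF e] _ qL] by simp
    have "?q x = 0"
    proof (rule continuous_zero_of_integrals[OF _ _ x])
      show "continuous_on {0<..<len e} ?q"
        using admissible e by (intro continuous_intros smooth_on_continuous) (auto simp: admissible_potential_def)
      show "integral {a..b} ?q = 0" if "0 < a" "a < b" "b < len e" for a b
        using primitive_onD[OF prim, of a b] that by simp
    qed
    then show ?thesis by simp
  qed
  moreover have "\<sigma> v = 0" if v: "v \<in> verts G" for v
  proof -
    \<comment> \<open>Only the vertex values of the hat matter here, so \<open>k = 1\<close> will
      do.\<close>
    obtain h where h: "h \<in> \<V>" "val h v = 1" "\<forall>w\<in>verts G. w \<noteq> v \<longrightarrow> val h w = 0"
      "energy 1 h \<le> real (vertex_degree G v) * (1 / tanh (1 * min_len))"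
      by (rule vertex_hat[OF zero_less_one v])
    have "graph_integral G len (\<lambda>e x. of_real (q e x) * cnj (h e x)) = graph_integral G len (\<lambda>e x. 0)"
      unfolding graph_integral_def by (intro sum.cong refl Bochner_Integration.integral_cong) (simp add: q0)
    then have "graph_integral G len (\<lambda>e x. of_real (q e x) * cnj (h e x)) = 0" by (simp add: graph_integral_def)
    moreover have "(\<Sum>w\<in>verts G. of_real (\<sigma> w) * cnj (val h w)) = (\<Sum>w\<in>verts G. if w = v then of_real (\<sigma> v) else 0)"
      by (rule sum.cong) (auto simp: h)
    ultimately have "complex_of_real (\<sigma> v) = 0" using 0[OF h(1)] form_one[OF h(1)] v by simp
    then show ?thesis by simp
  qed
  ultimately show ?thesis by blast
qed

end

theorem theorem2:
  fixes G :: "('v, 'e) pre_digraph" and len :: "'e \<Rightarrow> real"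
    and q :: "'e \<Rightarrow> real \<Rightarrow> real" and \<sigma> :: "'v \<Rightarrow> real"
    and lam lam0 :: "nat \<Rightarrow> real"
  assumes "metric_graph G len"
    and "admissible_potential G len q"
    and "graph_integral G len q + 2 * (\<Sum>v\<in>verts G. \<sigma> v / real (vertex_degree G v)) = 0
           \<longrightarrow> graph_integral G len q + (\<Sum>v\<in>verts G. \<sigma> v) \<le> 0"
    and "eigenvalue_sequence G len q \<sigma> lam"
    and "eigenvalue_sequence G len (\<lambda>_ _. 0) (\<lambda>_. 0) lam0"
    and "\<forall>n. lam n = lam0 n"
  shows "(\<forall>e\<in>arcs G. \<forall>x\<in>{0<..<len e}. q e x = 0) \<and> (\<forall>v\<in>verts G. \<sigma> v = 0)"
proof -
  interpret metric_graph G len by (rule assms(1))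
  interpret A: schroedinger_graph G len q \<sigma> by unfold_locales (rule assms(2))
  have adm0: "admissible_potential G len (\<lambda>_ _. 0)"
  proof -
    have "(deriv ^^ n) (\<lambda>_::real. 0::real) = (\<lambda>_. 0)" for n by (induction n) auto
    then show ?thesis by (auto simp: admissible_potential_def smooth_on_def)
  qed
  interpret B: schroedinger_graph G len "\<lambda>_ _. 0" "\<lambda>_. 0" by unfold_locales (rule adm0)
  have lam0: "lam0 = lam" using assms(6) by auto
  obtain f where f: "spectral_form scale_fun \<V> (L2_inner G len) A.form (A.k0\<^sup>2) f lam"
    by (rule A.spectral_form_exists[OF assms(4)])
  interpret A: schroedinger_spectrum G len q \<sigma> f lam
    by (intro schroedinger_spectrum.intro schroedinger_spectrum_axioms.intro A.schroedinger_graph_axioms f)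
  obtain g where g: "spectral_form scale_fun \<V> (L2_inner G len) B.form (B.k0\<^sup>2) g lam"
    using B.spectral_form_exists[OF assms(5)] unfolding lam0 by blast
  interpret B: schroedinger_spectrum G len "\<lambda>_ _. 0" "\<lambda>_. 0" g lam
    by (intro schroedinger_spectrum.intro schroedinger_spectrum_axioms.intro B.schroedinger_graph_axioms g)
  have adm': "admissible_potential G len (\<lambda>e x. - q e x)"
    using assms(2) by (auto simp: admissible_potential_def intro: smooth_on_minus)
  interpret C: schroedinger_graph G len "\<lambda>e x. - q e x" "\<lambda>v. - \<sigma> v" by unfold_locales (rule adm')
  have potC: "C.pot h = - A.pot h" for h
    by (simp add: C.pot_def A.pot_def graph_integral_def sum_negf)
  have potB: "B.pot h = 0" for h by (simp add: B.pot_def graph_integral_def)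
  have ge: "0 \<le> graph_integral G len q + 2 * (\<Sum>v\<in>verts G. \<sigma> v / real (vertex_degree G v))"
  proof (rule B.trace_inequality[OF assms(2)])
    fix N
    \<comment> \<open>Free eigenfunctions as trial vectors for the perturbed operator, whose
      eigenvalues are again \<open>lam\<close>.\<close>
    have "(\<Sum>n<N. lam n) \<le> (\<Sum>n<N. A.cf.S2 (g n))"
      by (rule A.sp.Ky_Fan) (auto intro: B.sp.f_V B.sp.f_unit B.sp.f_orth)
    also have "\<dots> = (\<Sum>n<N. lam n + A.pot (g n))"
    proof (rule sum.cong[OF refl])
      fix n
      have "dirichlet (g n) = lam n" using B.cf.eig_quad[OF B.sp.f_eig, of n] B.sp.f_unit[of n] by (simp add: B.S2_eq potB)
      then show "A.cf.S2 (g n) = lam n + A.pot (g n)" by (simp add: A.S2_eq)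
    qed
    finally show "0 \<le> (\<Sum>n<N. A.pot (g n))" by (simp add: sum.distrib)
  qed
  have "0 \<le> graph_integral G len (\<lambda>e x. - q e x) + 2 * (\<Sum>v\<in>verts G. - \<sigma> v / real (vertex_degree G v))"
  proof (rule A.trace_inequality[OF adm'])
    fix N
    \<comment> \<open>The roles are exchanged: perturbed eigenfunctions are trial vectors for the
      free operator, which differs by the perturbation with opposite sign.\<close>
    have "(\<Sum>n<N. lam n) \<le> (\<Sum>n<N. B.cf.S2 (f n))"
      by (rule B.sp.Ky_Fan) (auto intro: A.sp.f_V A.sp.f_unit A.sp.f_orth)
    also have "\<dots> = (\<Sum>n<N. lam n - A.pot (f n))"
    proof (rule sum.cong[OF refl])
      fix n
      have "dirichlet (f n) + A.pot (f n) = lam n" using A.cf.eig_quad[OF A.sp.f_eig, of n] A.sp.f_unit[of n] by (simp add: A.S2_eq)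
      then show "B.cf.S2 (f n) = lam n - A.pot (f n)" by (simp add: B.S2_eq potB)
    qed
    finally show "0 \<le> (\<Sum>n<N. C.pot (f n))" by (simp add: potC sum_subtractf sum_negf)
  qed
  then have "graph_integral G len q + 2 * (\<Sum>v\<in>verts G. \<sigma> v / real (vertex_degree G v)) \<le> 0"
    by (simp add: graph_integral_def sum_negf)
  with ge assms(3) have le: "A.cf.S2 one \<le> 0" by (simp add: A.S2_one)
  \<comment> \<open>The lowest eigenvalue is shared with the free operator, whose form is
    nonnegative; as the minimum of the Rayleigh quotient it makes the perturbed form nonnegative as
    well.\<close>
  have "lam 0 \<ge> 0"
    using B.cf.eig_quad[OF B.sp.f_eig, of 0] B.sp.f_unit[of 0] dirichlet_nonneg[of "g 0"] by (simp add: B.S2_eq potB)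
  have psd: "0 \<le> A.cf.S2 h" if h: "h \<in> \<V>" for h
    using A.sp.f_min[OF h, of 0] mult_nonneg_nonneg[OF \<open>lam 0 \<ge> 0\<close> A.cf.N2_nonneg[OF h]] by linarith
  have "A.form one h = 0" if h: "h \<in> \<V>" for h
  proof -
    \<comment> \<open>A nonnegative form that is not positive at \<open>one\<close> has
      \<open>one\<close> in its kernel.\<close>
    have "(cmod (A.form one h))\<^sup>2 \<le> A.cf.S2 one * A.cf.S2 h"
      by (rule A.cf.s.Cauchy_Schwarz[OF H1_subspace order_refl psd one(1) h])
    also have "\<dots> \<le> 0" using le psd[OF h] by (simp add: mult_nonpos_nonneg)
    finally show ?thesis by simp
  qed
  then show ?thesis by (rule A.potential_zero)
qed

end
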